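(* If $k$ is a positive integer with $k\equiv 1\pmod 4$, then the super domination number can be computed in polynomial time over the class of $k$-subdivision graphs; that is, there is an algorithm which, given any $k$-subdivision graph $F$, computes $\gamma_{\rm sp}(F)$ in time polynomial in the size of $F$.
   Context: All graphs are finite, simple and undirected. For an integer $k\ge 1$, the $k$-subdivision $S_k(G)$ of $G$ is the graph obtained from $G$ by replacing each edge with a disjoint path of length $k+1$, that is, by subdividing each edge exactly $k$ times. A graph $F$ is a $k$-subdivision graph if $F$ can be obtained as the $k$-subdivision $S_k(G)$ of some graph $G$. For $D\subseteq V(G)$ write $\overline{D}=V(G)\setminus D$, and let $N_G(v)$ be the open neighborhood of $v$. A set $D\subseteq V(G)$ is a dominating set if every vertex of $\overline{D}$ has a neighbor in $D$. A dominating set $D$ is a super dominating set if for every $x\in\overline{D}$ there exists $y\in D$ such that $N_G(y)\cap\overline{D}=\{x\}$. The super domination number $\gamma_{\rm sp}(G)$ is the minimum cardinality of a super dominating set of $G$. *)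

theory Defs
  imports
    "Graph_Theory.Pair_Digraph"
    "Graph_Theory.Digraph_Isomorphism"
    "HOL-Computational_Algebra.Polynomial"
begin

section \<open>Super domination\<close>

text \<open>
  Finite simple undirected graphs are the finite, loop-free, symmetric relations
  \<^locale>\<open>pair_graph\<close>: the edge \<open>uv\<close> is represented by the two arcs \<open>(u, v)\<close> and \<open>(v, u)\<close>.
\<close>

definition nbhd :: "'a pair_pre_digraph \<Rightarrow> 'a \<Rightarrow> 'a set" where
  "nbhd G v = {u. (v, u) \<in> parcs G}"

definition dominating_set :: "'a pair_pre_digraph \<Rightarrow> 'a set \<Rightarrow> bool" where
  "dominating_set G D \<longleftrightarrow>
     D \<subseteq> pverts G \<and> (\<forall>x \<in> pverts G - D. nbhd G x \<inter> D \<noteq> {})"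

definition super_dominating_set :: "'a pair_pre_digraph \<Rightarrow> 'a set \<Rightarrow> bool" where
  "super_dominating_set G D \<longleftrightarrow>
     dominating_set G D \<and>
     (\<forall>x \<in> pverts G - D. \<exists>y \<in> D. nbhd G y \<inter> (pverts G - D) = {x})"

definition super_domination_number :: "'a pair_pre_digraph \<Rightarrow> nat" where
  "super_domination_number G = Min (card ` {D. super_dominating_set G D})"

section \<open>Subdivisions\<close>

datatype 'a subdiv_vertex = Branch 'a | Inner 'a 'a nat

text \<open>
  \<open>subdiv_path k u v i\<close> is the vertex at distance \<open>i\<close> from \<open>u\<close> on the path of length \<open>k + 1\<close>
  that replaces the edge \<open>uv\<close>. The linear order only selects one of the two names of an inner
  vertex, so that \<open>subdiv_path k u v i = subdiv_path k v u (k + 1 - i)\<close> for \<open>u \<noteq> v\<close> and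
  \<open>i \<le> k + 1\<close>.
\<close>

definition subdiv_path :: "nat \<Rightarrow> 'a::linorder \<Rightarrow> 'a \<Rightarrow> nat \<Rightarrow> 'a subdiv_vertex" where
  "subdiv_path k u v i =
     (if i = 0 then Branch u
      else if i = k + 1 then Branch v
      else if u < v then Inner u v i
      else Inner v u (k + 1 - i))"

definition k_subdivision ::
    "nat \<Rightarrow> 'a::linorder pair_pre_digraph \<Rightarrow> 'a subdiv_vertex pair_pre_digraph" where
  "k_subdivision k G =
     \<lparr> pverts = Branch ` pverts G \<union> {subdiv_path k u v i | u v i. (u, v) \<in> parcs G \<and> i \<le> k + 1},
       parcs = {(subdiv_path k u v i, subdiv_path k u v (i + 1)) | u v i.
                  (u, v) \<in> parcs G \<and> i \<le> k} \<rparr>"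

lemma subdiv_path_rev:
  assumes "u \<noteq> v" "i \<le> k + 1"
  shows "subdiv_path k u v i = subdiv_path k v u (k + 1 - i)"
  using assms by (auto simp: subdiv_path_def)

lemma pair_graph_k_subdivision:
  fixes G :: "'a::linorder pair_pre_digraph"
  assumes "pair_graph G"
  shows "pair_graph (k_subdivision k G)"
proof -
  interpret pair_graph G by fact
  let ?S = "k_subdivision k G"
  have vs: "pverts ?S =
      Branch ` pverts G \<union> (\<lambda>((u, v), i). subdiv_path k u v i) ` (parcs G \<times> {..k + 1})"
    by (auto simp: k_subdivision_def image_iff) force+
  have as: "parcs ?S =
      (\<lambda>((u, v), i). (subdiv_path k u v i, subdiv_path k u v (i + 1))) ` (parcs G \<times> {..k})"
    by (auto simp: k_subdivision_def image_iff) force+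
  show ?thesis
  proof unfold_locales
    show "finite (pverts ?S)" unfolding vs using pair_finite_verts pair_finite_arcs by blast
    show "finite (parcs ?S)" unfolding as using pair_finite_arcs by blast
    have "sym (parcs ?S)"
    proof (rule symI)
      fix a b assume "(a, b) \<in> parcs ?S"
      then obtain u v i where *: "(u, v) \<in> parcs G" "i \<le> k"
          "a = subdiv_path k u v i" "b = subdiv_path k u v (i + 1)"
        by (auto simp: k_subdivision_def)
      have "(v, u) \<in> parcs G" "u \<noteq> v"
        using *(1) pair_sym_arcs pair_no_loops[OF *(1)] by (auto simp: symmetric_def dest: symD)
      moreover have "a = subdiv_path k v u (k - i + 1)" "b = subdiv_path k v u (k - i)"
        using * subdiv_path_rev[OF \<open>u \<noteq> v\<close>, of _ k] by (simp_all add: Suc_diff_le)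
      ultimately show "(b, a) \<in> parcs ?S"
        unfolding k_subdivision_def using diff_le_self[of k i] by fastforce
    qed
    then show "symmetric (with_proj ?S)" by (simp add: symmetric_def)
  next
    fix e assume e: "e \<in> parcs ?S"
    then obtain u v i where *: "(u, v) \<in> parcs G" "i \<le> k"
        "e = (subdiv_path k u v i, subdiv_path k u v (i + 1))"
      by (auto simp: k_subdivision_def)
    show "fst e \<in> pverts ?S"
      using * by (force simp: k_subdivision_def)
    show "snd e \<in> pverts ?S"
      using * by (force simp: k_subdivision_def)
    show "fst e \<noteq> snd e"
      using * pair_no_loops[OF *(1)] by (auto simp: subdiv_path_def)
  qed
qed

text \<open>
  The base graph may be taken on natural numbers, since every finite graph is isomorphic to such a graph.
\<close>

definition k_subdivision_graph :: "nat \<Rightarrow> 'b pair_pre_digraph \<Rightarrow> bool" where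
  "k_subdivision_graph k F \<longleftrightarrow>
     pair_graph F \<and>
     (\<exists>G :: nat pair_pre_digraph. pair_graph G \<and>
        digraph_iso (with_proj (k_subdivision k G)) (with_proj F))"

section \<open>Random access machines and polynomial time\<close>

text \<open>
  The random access machine of Cook and Reckhow with natural number registers, truncated
  subtraction and unit cost. There is no multiplication, so register contents have \<open>O(t)\<close>
  bits after \<open>t\<close> steps on the inputs considered here, and polynomial time agrees with that of Turing machines.
\<close>

datatype instr =
    Const nat nat      \<comment> \<open>\<open>Const i c\<close>: \<open>X\<^sub>i := c\<close>\<close>
  | Add nat nat nat    \<comment> \<open>\<open>Add i j l\<close>: \<open>X\<^sub>i := X\<^sub>j + X\<^sub>l\<close>\<close>
  | Sub nat nat nat    \<comment> \<open>\<open>Sub i j l\<close>: \<open>X\<^sub>i := X\<^sub>j - X\<^sub>l\<close>\<close>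
  | Load nat nat       \<comment> \<open>\<open>Load i j\<close>: \<open>X\<^sub>i := X\<close> at address \<open>X\<^sub>j\<close>\<close>
  | Store nat nat      \<comment> \<open>\<open>Store i j\<close>: \<open>X\<close> at address \<open>X\<^sub>i\<close> \<open>:= X\<^sub>j\<close>\<close>
  | Read nat           \<comment> \<open>\<open>Read i\<close>: \<open>X\<^sub>i :=\<close> next input number, or 0 if the input is used up\<close>
  | Jump nat nat       \<comment> \<open>\<open>Jump i m\<close>: continue at \<open>m\<close> if \<open>X\<^sub>i > 0\<close>\<close>

record ram_state =
  pc :: nat
  reg :: "nat \<Rightarrow> nat"
  inp :: "nat list"

fun exec :: "instr \<Rightarrow> ram_state \<Rightarrow> ram_state" where
  "exec (Const i c) s = s\<lparr>pc := pc s + 1, reg := (reg s)(i := c)\<rparr>"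
| "exec (Add i j l) s = s\<lparr>pc := pc s + 1, reg := (reg s)(i := reg s j + reg s l)\<rparr>"
| "exec (Sub i j l) s = s\<lparr>pc := pc s + 1, reg := (reg s)(i := reg s j - reg s l)\<rparr>"
| "exec (Load i j) s = s\<lparr>pc := pc s + 1, reg := (reg s)(i := reg s (reg s j))\<rparr>"
| "exec (Store i j) s = s\<lparr>pc := pc s + 1, reg := (reg s)(reg s i := reg s j)\<rparr>"
| "exec (Read i) s =
     s\<lparr>pc := pc s + 1,
       reg := (reg s)(i := (case inp s of [] \<Rightarrow> 0 | x # _ \<Rightarrow> x)),
       inp := tl (inp s)\<rparr>"
| "exec (Jump i m) s = s\<lparr>pc := (if reg s i > 0 then m else pc s + 1)\<rparr>"

definition halted :: "instr list \<Rightarrow> ram_state \<Rightarrow> bool" where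
  "halted P s \<longleftrightarrow> pc s \<ge> length P"

definition step :: "instr list \<Rightarrow> ram_state \<Rightarrow> ram_state" where
  "step P s = (if halted P s then s else exec (P ! pc s) s)"

definition init :: "nat list \<Rightarrow> ram_state" where
  "init xs = \<lparr>pc = 0, reg = (\<lambda>_. 0), inp = xs\<rparr>"

text \<open>
  The program \<open>P\<close> halts on input \<open>xs\<close> after at most \<open>T\<close> steps with result \<open>y\<close> in register 0.
\<close>

definition computes_within :: "instr list \<Rightarrow> nat list \<Rightarrow> nat \<Rightarrow> nat \<Rightarrow> bool" where
  "computes_within P xs y T \<longleftrightarrow>
     (\<exists>t \<le> T. halted P ((step P ^^ t) (init xs)) \<and> reg ((step P ^^ t) (init xs)) 0 = y)"

text \<open>The number of vertices, followed by the rows of the adjacency matrix.\<close>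

definition graph_code :: "'a pair_pre_digraph \<Rightarrow> 'a list \<Rightarrow> nat list" where
  "graph_code F vs =
     length vs # concat (map (\<lambda>u. map (\<lambda>v. if (u, v) \<in> parcs F then 1 else 0) vs) vs)"

text \<open>
  Membership of the input graph in the class \<open>C\<close> is a promise that the program need not check. The
  program has to be correct for the adjacency matrix with respect to every ordering \<open>vs\<close> of the
  vertices. The size of a graph is its number \<open>n\<close> of vertices; since the input has length
  \<open>n\<^sup>2 + 1\<close> and a simple graph has fewer than \<open>n\<^sup>2\<close> edges (for \<open>n > 0\<close>), other usual notions of
  size are polynomially related to it.
\<close>

definition poly_time_computable_on ::
    "nat pair_pre_digraph set \<Rightarrow> (nat pair_pre_digraph \<Rightarrow> nat) \<Rightarrow> bool" where
  "poly_time_computable_on C f \<longleftrightarrow>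
     (\<exists>(P :: instr list) (p :: nat poly). \<forall>F \<in> C. \<forall>vs. distinct vs \<and> set vs = pverts F \<longrightarrow>
        computes_within P (graph_code F vs) (f F) (poly p (card (pverts F))))"

end

theory Submission
  imports Defs
begin

text \<open>
  For odd \<open>k\<close> a \<open>k\<close>-subdivision graph \<open>F\<close> is the 1-subdivision of some multigraph \<open>H\<close>, and
  \<open>\<gamma>\<^sub>s\<^sub>p(F) = |E(H)| + c\<close>, where \<open>c\<close> counts the components of \<open>H\<close> without an even cycle. Indeed, the
  complement of a super dominating set amounts to a two-colouring of a set of vertices of \<open>H\<close> together
  with an injective choice of incident bichromatic edges. A spanning tree serves all vertices of a
  component but one, and serving all of them is possible iff the component has an even cycle. With
  respect to a spanning forest, a component has no even cycle iff its fundamental cycles are odd and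
  pairwise edge-disjoint: then every fundamental cycle contains a monochromatic edge, which leaves
  too few bichromatic ones.

  The program recovers \<open>H\<close> from \<open>F\<close> by telling branch and edge vertices apart, computes a spanning
  forest by relabelling, and tests the fundamental cycles. All its loops run exactly \<open>n\<close> times, so
  its running time is polynomial by its syntax alone.
\<close>

section \<open>Connectivity and spanning forests\<close>

text \<open>Origin of the colouring: for the complement X of a super dominating set, a vertex of
  \<open>H\<close> is coloured by whether it lies in X. A vertex in X is the only neighbour in X of
  some incident edge, whose other end is therefore outside X; an edge in X is the only neighbour in
  X of one of its ends, which lies outside X. So each element of X uses up one vertex of
  \<open>H\<close>, and a component that is used up completely yields a choice of edges for all of
  its vertices.

  Paths and cycles are never represented. The tree path between two vertices is the set
  \<open>sep\<close> of forest edges whose removal separates them, so the fundamental cycle of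
  \<open>g\<close> is even iff the \<open>sep\<close> of its ends has odd size. This form suits the
  parity argument, an induction along connectivity, and also the program, which only needs component
  labels of the forest without one edge.

  The input is a bare matrix in which the subdividing vertices are not marked. All that the proof
  keeps of the subdivision is a bipartition with one side of degree 2; the program may find another
  such side, and the formula holds for it as well.\<close>

definition conn :: "('v \<times> 'v) set \<Rightarrow> 'v \<Rightarrow> 'v \<Rightarrow> bool" where
  "conn S u v \<longleftrightarrow> (u, v) \<in> (S \<union> S\<inverse>)\<^sup>*"

lemma conn_refl [simp]: "conn S u u"
  by (simp add: conn_def)

lemma conn_sym: "conn S u v \<Longrightarrow> conn S v u"
  unfolding conn_def by (metis converse_Un converse_converse rtrancl_converseI sup_commute)

lemma conn_commute: "conn S u v \<longleftrightarrow> conn S v u"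
  using conn_sym by metis

lemma conn_trans: "conn S u v \<Longrightarrow> conn S v w \<Longrightarrow> conn S u w"
  unfolding conn_def by simp

lemma conn_mono: "S \<subseteq> S' \<Longrightarrow> conn S u v \<Longrightarrow> conn S' u v"
  unfolding conn_def by (meson Un_mono converse_mono rtrancl_mono subsetD)

lemma conn_pair: "(u, v) \<in> S \<Longrightarrow> conn S u v"
  unfolding conn_def by blast

lemma conn_induct [consumes 1, case_names refl step]:
  assumes "conn S x y" and "P x"
    and "\<And>u v. conn S x u \<Longrightarrow> (u, v) \<in> S \<or> (v, u) \<in> S \<Longrightarrow> P u \<Longrightarrow> P v"
  shows "P y"
  using assms(1) unfolding conn_def
  by (induction rule: rtrancl_induct) (use assms(2,3) in \<open>auto simp: conn_def\<close>)

lemma conn_le: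
  assumes "conn S x y" and "\<And>u v. (u, v) \<in> S \<Longrightarrow> conn S' u v"
  shows "conn S' x y"
  using assms(1)
proof (induction rule: conn_induct)
  case (step u v)
  then have "conn S' u v" using assms(2) conn_sym by metis
  then show ?case by (rule conn_trans[OF step(3)])
qed simp

text \<open>A walk that uses the new edge repeatedly can be shortened to use it at most once, in one
  of two directions. This is the step of union-find and, read backwards, the effect of deleting an
  edge.\<close>

lemma conn_insert:
  "conn (insert (a, b) S) x y \<longleftrightarrow>
     conn S x y \<or> conn S x a \<and> conn S b y \<or> conn S x b \<and> conn S a y"
proof
  assume "conn (insert (a, b) S) x y"
  then show "conn S x y \<or> conn S x a \<and> conn S b y \<or> conn S x b \<and> conn S a y"
  proof (induction rule: conn_induct)
    case (step u v)
    from step(2) consider "conn S u v" | "u = a" "v = b" | "u = b" "v = a"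
      by (auto intro: conn_pair conn_sym)
    then show ?case
      by cases (use step(3) in \<open>auto intro: conn_trans conn_sym\<close>)
  qed simp
next
  have "conn (insert (a, b) S) a b" by (simp add: conn_pair)
  moreover have "conn S u v \<Longrightarrow> conn (insert (a, b) S) u v" for u v
    by (rule conn_mono) auto
  ultimately show "conn S x y \<or> conn S x a \<and> conn S b y \<or> conn S x b \<and> conn S a y
      \<Longrightarrow> conn (insert (a, b) S) x y"
    by (meson conn_sym conn_trans)
qed

text \<open>A label has to be a vertex fixed by \<open>L\<close>, so each component is named by one
  of its own vertices. The roots \<open>L r = r\<close> can then be counted in place of the
  components.\<close>

definition labels :: "'v set \<Rightarrow> ('v \<Rightarrow> 'v) \<Rightarrow> ('v \<times> 'v) set \<Rightarrow> bool" where
  "labels V L S \<longleftrightarrow> (\<forall>v\<in>V. L v \<in> V \<and> L (L v) = L v) \<and>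
     (\<forall>u\<in>V. \<forall>v\<in>V. L u = L v \<longleftrightarrow> conn S u v)"

definition merge :: "('v \<Rightarrow> 'v) \<Rightarrow> 'v \<Rightarrow> 'v \<Rightarrow> 'v \<Rightarrow> 'v" where
  "merge L i j v = (if L v = L j then L i else L v)"

lemma labels_empty: "\<forall>v\<in>V. L v = v \<Longrightarrow> labels V L {}"
  by (auto simp: labels_def conn_def)

lemma labels_cong: "labels V L S \<Longrightarrow> \<forall>v\<in>V. L' v = L v \<Longrightarrow> labels V L' S"
  by (auto simp: labels_def)

lemma labels_merge:
  assumes "labels V L S" and "i \<in> V" "j \<in> V"
  shows "labels V (merge L i j) (insert (i, j) S)"
proof -
  have eq: "L u = L v \<longleftrightarrow> conn S u v" if "u \<in> V" "v \<in> V" for u v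
    using assms(1) that by (auto simp: labels_def)
  have "merge L i j u = merge L i j v \<longleftrightarrow> conn (insert (i, j) S) u v" if "u \<in> V" "v \<in> V" for u v
    \<comment> \<open>Every connectivity statement of \<open>conn_insert\<close> becomes an equation
      between labels, after which only a case distinction on \<open>merge\<close> remains.\<close>
    unfolding conn_insert merge_def eq[symmetric, OF that] eq[symmetric, OF that(1) assms(2)]
      eq[symmetric, OF that(1) assms(3)] eq[symmetric, OF assms(2) that(2)]
      eq[symmetric, OF assms(3) that(2)]
    by (auto)
  moreover have "merge L i j v \<in> V \<and> merge L i j (merge L i j v) = merge L i j v" if "v \<in> V" for v
    proof -
    have "L v \<in> V" "L (L v) = L v" "L i \<in> V" "L (L i) = L i"
      using assms that by (auto simp: labels_def)
    then show ?thesis by (simp add: merge_def)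
  qed
  ultimately show ?thesis by (simp add: labels_def)
qed

lemma merge_image:
  assumes "labels V L S" "i \<in> V" "j \<in> V" "L i \<noteq> L j"
  shows "merge L i j ` V = L ` V - {L j}"
  using assms unfolding merge_def by (auto simp: image_iff)

section \<open>Multigraphs with named edges: forests and tree paths\<close>

locale multigraph =
  fixes a b :: "'e \<Rightarrow> 'v"
begin

definition ends :: "'e set \<Rightarrow> ('v \<times> 'v) set" where
  "ends T = (\<lambda>e. (a e, b e)) ` T"

abbreviation cn :: "'e set \<Rightarrow> 'v \<Rightarrow> 'v \<Rightarrow> bool" where
  "cn T \<equiv> conn (ends T)"

text \<open>Acyclicity expressed without cycles: every edge is a bridge.\<close>

definition forest :: "'e set \<Rightarrow> bool" where
  "forest T \<longleftrightarrow> (\<forall>f\<in>T. \<not> cn (T - {f}) (a f) (b f))"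

text \<open>If the forest \<open>T\<close> connects \<open>x\<close> and \<open>y\<close>, these are
  the edges of the tree path between them. Together with \<open>g\<close>, the set
  \<open>sep T (a g) (b g)\<close> is the fundamental cycle of an edge \<open>g\<close> outside
  \<open>T\<close>.\<close>

definition sep :: "'e set \<Rightarrow> 'v \<Rightarrow> 'v \<Rightarrow> 'e set" where
  "sep T x y = {f \<in> T. \<not> cn (T - {f}) x y}"

lemma ends_insert [simp]: "ends (insert e T) = insert (a e, b e) (ends T)"
  by (simp add: ends_def)

lemma ends_empty [simp]: "ends {} = {}"
  by (simp add: ends_def)

lemma ends_mono: "S \<subseteq> T \<Longrightarrow> ends S \<subseteq> ends T"
  by (auto simp: ends_def)

lemma cn_mono: "S \<subseteq> T \<Longrightarrow> cn S x y \<Longrightarrow> cn T x y"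
  by (meson conn_mono ends_mono)

lemma cn_edge: "e \<in> T \<Longrightarrow> cn T (a e) (b e)"
  by (auto simp: ends_def intro: conn_pair)

lemma cn_remove:
  assumes "f \<in> T"
  shows "cn T x y \<longleftrightarrow> cn (T - {f}) x y \<or> cn (T - {f}) x (a f) \<and> cn (T - {f}) (b f) y
           \<or> cn (T - {f}) x (b f) \<and> cn (T - {f}) (a f) y"
  using conn_insert[of "a f" "b f" "ends (T - {f})" x y] assms
  by (metis ends_insert insert_Diff)

lemma forest_subset: "forest T \<Longrightarrow> S \<subseteq> T \<Longrightarrow> forest S"
  unfolding forest_def by (meson Diff_mono cn_mono order_refl subsetD)

lemma forest_insertD:
  assumes "forest (insert f T)" "f \<notin> T"
  shows "\<not> cn T (a f) (b f)"
  using assms unfolding forest_def by (metis Diff_insert_absorb insertI1)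

lemma forest_insertI:
  assumes T: "forest T" and f: "\<not> cn T (a f) (b f)"
  shows "forest (insert f T)"
  unfolding forest_def
proof
  fix g assume g: "g \<in> insert f T"
  have fT: "f \<notin> T" using f cn_edge by blast
  show "\<not> cn (insert f T - {g}) (a g) (b g)"
  proof (cases "g = f")
    case True then show ?thesis using f fT by simp
  next
    case False
    then have gT: "g \<in> T" using g by simp
    have 1: "insert f T - {g} = insert f (T - {g})" using False by auto
    have ng: "\<not> cn (T - {g}) (a g) (b g)" using T gT by (simp add: forest_def)
    have up: "cn (T - {g}) x y \<Longrightarrow> cn T x y" for x y by (rule cn_mono) auto
    show ?thesis
      \<comment> \<open>If \<open>f\<close> reconnected the ends of \<open>g\<close>, then
        \<open>g\<close> and the two remaining pieces of that walk would join the ends of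
        \<open>f\<close> inside \<open>T\<close>.\<close>
      unfolding 1 ends_insert conn_insert
      using ng f up cn_edge[OF gT] by (meson conn_sym conn_trans)
  qed
qed

lemma forest_two_colouring:
  assumes "finite T" "forest T"
  shows "\<exists>\<chi> :: 'v \<Rightarrow> bool. \<forall>e\<in>T. \<chi> (a e) \<noteq> \<chi> (b e)"
  using assms
proof (induction T)
  case (insert f T)
  obtain \<chi> :: "'v \<Rightarrow> bool" where \<chi>: "\<forall>e\<in>T. \<chi> (a e) \<noteq> \<chi> (b e)"
    using insert forest_subset by blast
  have f: "\<not> cn T (a f) (b f)" using insert forest_insertD by blast
  show ?case
  proof (cases "\<chi> (a f) = \<chi> (b f)")
    case True
    \<comment> \<open>The new edge joins two components of \<open>T\<close>. When its ends have
      equal colours, all colours in one of the two are flipped; \<open>\<noteq>\<close> acts as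
      exclusive or.\<close>
    let ?\<chi> = "\<lambda>v. \<chi> v \<noteq> cn T (a f) v"
    have "cn T (a f) (a e) \<longleftrightarrow> cn T (a f) (b e)" if "e \<in> T" for e
      using cn_edge[OF that] by (meson conn_sym conn_trans)
    then have "\<forall>e\<in>insert f T. ?\<chi> (a e) \<noteq> ?\<chi> (b e)" using True f \<chi> by auto
    then show ?thesis by (rule exI[where x = ?\<chi>])
  next
    case False then show ?thesis using \<chi> by blast
  qed
qed simp

text \<open>Every forest edge joins two different classes, so each insertion lowers the number of
  roots by exactly one.\<close>

lemma forest_labels:
  assumes "finite T" "forest T" "finite V" and "\<forall>e\<in>T. a e \<in> V \<and> b e \<in> V"
  shows "\<exists>L. labels V L (ends T) \<and> card (L ` V) + card T = card V"
  using assms(1,2,4)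
proof (induction T)
  case empty
  show ?case by (rule exI[where x = id]) (simp add: labels_empty)
next
  case (insert f T)
  then obtain L where L: "labels V L (ends T)" "card (L ` V) + card T = card V"
    using forest_subset by blast
  have f: "\<not> cn T (a f) (b f)" using insert forest_insertD by blast
  have V: "a f \<in> V" "b f \<in> V" using insert by auto
  then have ne: "L (a f) \<noteq> L (b f)" using L(1) f by (auto simp: labels_def)
  have "card (merge L (a f) (b f) ` V) = card (L ` V) - 1"
    unfolding merge_image[OF L(1) V ne] using V \<open>finite V\<close> by simp
  moreover have "card (L ` V) > 0" using V \<open>finite V\<close> card_gt_0_iff by blast
  ultimately have "card (merge L (a f) (b f) ` V) + card (insert f T) = card V"
    using L(2) insert by simp
  moreover have "labels V (merge L (a f) (b f)) (ends (insert f T))"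
    using labels_merge[OF L(1) V] by simp
  ultimately show ?case by blast
qed

lemma forest_card_less:
  assumes "finite T" "forest T" "finite V" "V \<noteq> {}" and "\<forall>e\<in>T. a e \<in> V \<and> b e \<in> V"
  shows "card T < card V"
proof -
  obtain L where L: "labels V L (ends T)" "card (L ` V) + card T = card V"
    using forest_labels[OF assms(1-3,5)] by blast
  moreover have "card (L ` V) > 0" using assms by (simp add: card_gt_0_iff)
  ultimately show ?thesis by simp
qed

text \<open>
  Moving one end along a forest edge \<open>f\<^sub>0\<close> changes \<open>sep\<close> by exactly \<open>f\<^sub>0\<close>.
\<close>

lemma sep_parity:
  assumes T: "finite T" "forest T" and xy: "cn T x y"
  shows "odd (card {f \<in> sep T x y. \<chi> (a f) \<noteq> \<chi> (b f)}) \<longleftrightarrow> \<chi> x \<noteq> (\<chi> y :: bool)"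
  using xy
proof (induction rule: conn_induct)
  case refl
  have "sep T x x = {}" by (simp add: sep_def)
  then show ?case by simp
next
  case (step u v)
  let ?B = "\<lambda>y. {f \<in> sep T x y. \<chi> (a f) \<noteq> \<chi> (b f)}"
  obtain h where h: "h \<in> T" "u = a h \<and> v = b h \<or> u = b h \<and> v = a h"
    using step(2) by (auto simp: ends_def)
  have same: "f \<in> sep T x u \<longleftrightarrow> f \<in> sep T x v" if "f \<noteq> h" for f
  proof -
    have "cn (T - {f}) (a h) (b h)" if "f \<in> T" using cn_edge[of h "T - {f}"] h \<open>f \<noteq> h\<close> by auto
    then have "cn (T - {f}) x u \<longleftrightarrow> cn (T - {f}) x v" if "f \<in> T"
      using h(2) that by (meson conn_sym conn_trans)
    then show ?thesis by (auto simp: sep_def)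
  qed
  have tog: "h \<in> sep T x u \<longleftrightarrow> h \<notin> sep T x v"
  proof -
    have "\<not> cn (T - {h}) u v" using T(2) h conn_sym unfolding forest_def by metis
    then have "\<not> (cn (T - {h}) x u \<and> cn (T - {h}) x v)" by (meson conn_sym conn_trans)
    \<comment> \<open>A walk from \<open>x\<close> to \<open>u\<close> in \<open>T\<close> either
      avoids \<open>h\<close> or, cut at its first use of \<open>h\<close>, already ends in
      \<open>u\<close> or \<open>v\<close>.\<close>
    moreover have "cn (T - {h}) x u \<or> cn (T - {h}) x v"
      using step(1) h unfolding cn_remove[OF h(1)] by (metis)
    ultimately show ?thesis using h(1) by (auto simp: sep_def)
  qed
  have fin: "finite (?B y)" for y using T(1) by (simp add: sep_def)
  show ?case
  proof (cases "\<chi> (a h) = \<chi> (b h)")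
    case True
    then have "f \<in> ?B u \<longleftrightarrow> f \<in> ?B v" for f using same by (cases "f = h") auto
    then have "?B u = ?B v" by blast
    moreover have "\<chi> u = \<chi> v" using True h by auto
    ultimately show ?thesis using step(3) by simp
  next
    case False
    then have \<chi>: "\<chi> u \<noteq> \<chi> v" using h by auto
    have "odd (card (?B v)) \<longleftrightarrow> even (card (?B u))"
    proof (cases "h \<in> sep T x u")
      case True
      then have "f \<in> ?B u \<longleftrightarrow> f \<in> insert h (?B v)" for f
        using same tog False by (cases "f = h") auto
      then have "?B u = insert h (?B v)" "h \<notin> ?B v" using tog True by blast+
      then show ?thesis using fin[of v] by simp
    next
      case F: False
      then have "f \<in> ?B v \<longleftrightarrow> f \<in> insert h (?B u)" for f
        using same tog False by (cases "f = h") auto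
      then have "?B v = insert h (?B u)" "h \<notin> ?B u" using F by blast+
      then show ?thesis using fin[of u] by simp
    qed
    then show ?thesis using step(3) \<chi> by auto
  qed
qed

text \<open>
  Every vertex other than the root takes the first edge of a shortest path to the root.
\<close>

lemma parent_edges:
  assumes S: "\<forall>v\<in>K. cn S v r"
  shows "\<exists>\<epsilon>. inj_on \<epsilon> (K - {r}) \<and>
           (\<forall>v\<in>K - {r}. \<epsilon> v \<in> S \<and> (a (\<epsilon> v) = v \<or> b (\<epsilon> v) = v))"
proof -
  define R where "R = ends S \<union> (ends S)\<inverse>"
  define d where "d v = (LEAST n. (v, r) \<in> R ^^ n)" for v
  have step: "\<exists>e\<in>S. \<exists>w. (a e = v \<and> b e = w \<or> a e = w \<and> b e = v) \<and> d w < d v"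
    if "v \<in> K - {r}" for v
  proof -
    have "(v, r) \<in> R\<^sup>*" using S that by (auto simp: conn_def R_def)
    then obtain n where "(v, r) \<in> R ^^ n" using rtrancl_imp_relpow by blast
    then have dv: "(v, r) \<in> R ^^ d v" unfolding d_def by (rule LeastI)
    have "d v \<noteq> 0" using dv that by (intro notI) simp
    then obtain m where m: "d v = Suc m" using not0_implies_Suc by blast
    then obtain w where w: "(v, w) \<in> R" "(w, r) \<in> R ^^ m"
      using dv by (metis relpow_Suc_D2)
    have "d w \<le> m" unfolding d_def using w(2) by (rule Least_le)
    then have "d w < d v" using m by simp
    then show ?thesis using w(1) by (fastforce simp: R_def ends_def)
  qed
  then obtain \<epsilon> w where \<epsilon>: "\<And>v. v \<in> K - {r} \<Longrightarrow> \<epsilon> v \<in> S \<and>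
      (a (\<epsilon> v) = v \<and> b (\<epsilon> v) = w v \<or> a (\<epsilon> v) = w v \<and> b (\<epsilon> v) = v) \<and> d (w v) < d v"
    by metis
  have "inj_on \<epsilon> (K - {r})"
  proof (rule inj_onI)
    fix u v assume uv: "u \<in> K - {r}" "v \<in> K - {r}" "\<epsilon> u = \<epsilon> v"
    \<comment> \<open>Distinct \<open>u\<close> and \<open>v\<close> with the same edge would each
      be the successor of the other, and the distance would have to drop in both directions.\<close>
    show "u = v" using \<epsilon>[OF uv(1)] \<epsilon>[OF uv(2)] uv(3) by (metis less_asym)
  qed
  then show ?thesis using \<epsilon> by blast
qed

end

section \<open>Bichromatic transversals of the components, relative to a spanning forest\<close>

locale spanned_multigraph = multigraph a b for a b :: "'e \<Rightarrow> 'v" +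
  fixes V :: "'v set" and E T :: "'e set" and L :: "'v \<Rightarrow> 'v"
  assumes finite_V: "finite V" and finite_E: "finite E"
    and ends_in_V: "\<And>e. e \<in> E \<Longrightarrow> a e \<in> V \<and> b e \<in> V"
    and T_sub: "T \<subseteq> E" and forest_T: "forest T"
    and labels_T: "labels V L (ends T)"
    and spanning: "\<And>e. e \<in> E \<Longrightarrow> L (a e) = L (b e)"
begin

text \<open>The test for an even cycle in the component with root \<open>r\<close>: an even
  fundamental cycle, or a forest edge on two fundamental cycles. Because of \<open>spanning\<close>,
  the components of \<open>T\<close> are those of the whole multigraph.\<close>

definition bad :: "'v \<Rightarrow> bool" where
  "bad r \<longleftrightarrow> (\<exists>g\<in>E - T. L (a g) = r \<and> odd (card (sep T (a g) (b g)))) \<or>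
     (\<exists>f\<in>T. L (a f) = r \<and> 2 \<le> card {g \<in> E - T. f \<in> sep T (a g) (b g)})"

definition transversal :: "('v \<Rightarrow> bool) \<Rightarrow> 'v set \<Rightarrow> ('v \<Rightarrow> 'e) \<Rightarrow> bool" where
  "transversal \<chi> M \<epsilon> \<longleftrightarrow> inj_on \<epsilon> M \<and>
     (\<forall>v\<in>M. \<epsilon> v \<in> E \<and> (a (\<epsilon> v) = v \<or> b (\<epsilon> v) = v) \<and> \<chi> (a (\<epsilon> v)) \<noteq> \<chi> (b (\<epsilon> v)))"

abbreviation comp :: "'v \<Rightarrow> 'v set" where
  "comp r \<equiv> {v \<in> V. L v = r}"

lemma finite_T: "finite T"
  using T_sub finite_E finite_subset by blast

lemma L_eq_iff: "u \<in> V \<Longrightarrow> v \<in> V \<Longrightarrow> L u = L v \<longleftrightarrow> cn T u v"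
  using labels_T by (simp add: labels_def)

lemma cn_T: "e \<in> E \<Longrightarrow> cn T (a e) (b e)"
  using L_eq_iff ends_in_V spanning by blast

text \<open>Removing \<open>f\<close> splits its tree into the sides of its two ends, and the
  closing edge \<open>g\<close> leads from one side to the other; which end of \<open>g\<close> lies
  on which side is left open.\<close>

lemma sep_crosses:
  assumes "g \<in> E" "f \<in> sep T (a g) (b g)"
  shows "cn (T - {f}) (a f) (a g) \<and> cn (T - {f}) (b f) (b g) \<or>
         cn (T - {f}) (b f) (a g) \<and> cn (T - {f}) (a f) (b g)"
  using cn_T[OF assms(1)] assms(2) cn_remove[of f T "a g" "b g"] by (auto simp: sep_def conn_commute)

lemma sep_same_label:
  assumes "g \<in> E" "f \<in> sep T (a g) (b g)"
  shows "L (a f) = L (a g)"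
proof -
  have f: "f \<in> T" using assms(2) by (simp add: sep_def)
  have "cn T (a f) (a g)"
    using sep_crosses[OF assms] cn_edge[OF f] cn_mono[of "T - {f}" T] by (meson Diff_subset conn_trans)
  then show ?thesis using L_eq_iff ends_in_V assms(1) f T_sub by blast
qed

lemma T_two_colouring: "\<exists>\<chi> :: 'v \<Rightarrow> bool. \<forall>e\<in>T. \<chi> (a e) \<noteq> \<chi> (b e)"
  by (rule forest_two_colouring[OF finite_T forest_T])

lemma transversal_rootless:
  assumes r: "r \<in> V" "L r = r"
  shows "\<exists>\<chi> \<epsilon>. transversal \<chi> (comp r - {r}) \<epsilon>"
proof -
  obtain \<chi> :: "'v \<Rightarrow> bool" where \<chi>: "\<forall>e\<in>T. \<chi> (a e) \<noteq> \<chi> (b e)" using T_two_colouring ..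
  have "cn T v r" if "v \<in> comp r" for v using L_eq_iff[of v r] that r by simp
  then have "\<forall>v\<in>comp r. cn T v r" by blast
  from parent_edges[OF this] obtain \<epsilon> where "inj_on \<epsilon> (comp r - {r})"
      "\<forall>v\<in>comp r - {r}. \<epsilon> v \<in> T \<and> (a (\<epsilon> v) = v \<or> b (\<epsilon> v) = v)" by blast
  then have "transversal \<chi> (comp r - {r}) \<epsilon>" using \<chi> T_sub by (auto simp: transversal_def)
  then show ?thesis by blast
qed

text \<open>The component is rooted at the end \<open>a g\<close> of the spare edge. Parent edges
  from \<open>S\<close> serve all other vertices, and \<open>g\<close>, being outside
  \<open>S\<close>, is free to serve the root.\<close>

lemma transversal_extra_edge:
  assumes S: "S \<subseteq> E" "\<forall>e\<in>S. \<chi> (a e) \<noteq> \<chi> (b e)" "\<forall>v\<in>comp r. cn S v (a g)"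
    and g: "g \<in> E - S" "\<chi> (a g) \<noteq> \<chi> (b g)"
  shows "\<exists>\<epsilon>. transversal \<chi> (comp r) \<epsilon>"
proof -
  obtain \<epsilon> where \<epsilon>: "inj_on \<epsilon> (comp r - {a g})"
      "\<forall>v\<in>comp r - {a g}. \<epsilon> v \<in> S \<and> (a (\<epsilon> v) = v \<or> b (\<epsilon> v) = v)"
    using parent_edges[OF S(3)] by blast
  have "transversal \<chi> (comp r) (\<epsilon>(a g := g))"
    unfolding transversal_def
  proof (intro conjI ballI)
    show "inj_on (\<epsilon>(a g := g)) (comp r)"
    proof (rule inj_onI)
      fix u v assume uv: "u \<in> comp r" "v \<in> comp r" "(\<epsilon>(a g := g)) u = (\<epsilon>(a g := g)) v"
      have "\<epsilon> w \<noteq> g" if "w \<in> comp r" "w \<noteq> a g" for w using \<epsilon>(2) g(1) that by auto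
      then show "u = v" using uv inj_onD[OF \<epsilon>(1), of u v] by (auto split: if_splits)
    qed
  next
    fix v assume v: "v \<in> comp r"
    let ?e = "(\<epsilon>(a g := g)) v"
    show "?e \<in> E" using v \<epsilon>(2) S(1) g(1) by (cases "v = a g") auto
    show "a ?e = v \<or> b ?e = v" using v \<epsilon>(2) by (cases "v = a g") auto
    show "\<chi> (a ?e) \<noteq> \<chi> (b ?e)" using v \<epsilon>(2) S(2) g(2) by (cases "v = a g") auto
  qed
  then show ?thesis by blast
qed

lemma sep_parity_two_colouring:
  assumes "\<forall>e\<in>T. \<chi> (a e) \<noteq> \<chi> (b e)" "g \<in> E"
  shows "odd (card (sep T (a g) (b g))) \<longleftrightarrow> \<chi> (a g) \<noteq> (\<chi> (b g) :: bool)"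
proof -
  have "{f \<in> sep T (a g) (b g). \<chi> (a f) \<noteq> \<chi> (b f)} = sep T (a g) (b g)"
    using assms(1) by (auto simp: sep_def)
  then show ?thesis using sep_parity[OF finite_T forest_T cn_T[OF assms(2)], of \<chi>] by simp
qed

text \<open>The colouring that alternates along the forest also makes \<open>g\<close> bichromatic,
  since the tree path between its ends is odd. So \<open>g\<close> is the spare edge.\<close>

lemma transversal_even_cycle:
  assumes "g \<in> E - T" "L (a g) = r" "odd (card (sep T (a g) (b g)))"
  shows "\<exists>\<chi> \<epsilon>. transversal \<chi> (comp r) \<epsilon>"
proof -
  obtain \<chi> :: "'v \<Rightarrow> bool" where \<chi>: "\<forall>e\<in>T. \<chi> (a e) \<noteq> \<chi> (b e)" using T_two_colouring ..
  have "\<chi> (a g) \<noteq> \<chi> (b g)" using sep_parity_two_colouring[OF \<chi>] assms by blast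
  moreover have "\<forall>v\<in>comp r. cn T v (a g)"
    using L_eq_iff assms ends_in_V by auto
  ultimately show ?thesis using transversal_extra_edge[OF T_sub \<chi>] assms(1) by blast
qed

text \<open>
  Two odd fundamental cycles through \<open>f\<close>: recolouring one side of \<open>T - {f}\<close> makes both closing
  edges bichromatic, so one of them can replace \<open>f\<close> and the other serves the root.
\<close>

lemma transversal_two_cycles:
  assumes f: "f \<in> T" "L (a f) = r"
    and g: "g\<^sub>1 \<in> E - T" "g\<^sub>2 \<in> E - T" "g\<^sub>1 \<noteq> g\<^sub>2"
      "f \<in> sep T (a g\<^sub>1) (b g\<^sub>1)" "f \<in> sep T (a g\<^sub>2) (b g\<^sub>2)"
  shows "\<exists>\<chi> \<epsilon>. transversal \<chi> (comp r) \<epsilon>"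
proof -
  have gE: "g\<^sub>1 \<in> E" "g\<^sub>2 \<in> E" using g by auto
  have lab: "L (a g\<^sub>1) = r" "L (a g\<^sub>2) = r"
    using sep_same_label[OF gE(1) g(4)] sep_same_label[OF gE(2) g(5)] f by auto
  show ?thesis
  proof (cases "odd (card (sep T (a g\<^sub>1) (b g\<^sub>1))) \<or> odd (card (sep T (a g\<^sub>2) (b g\<^sub>2)))")
    case True
    then show ?thesis using transversal_even_cycle g lab by blast
  next
    case False
    obtain \<chi> :: "'v \<Rightarrow> bool" where \<chi>: "\<forall>e\<in>T. \<chi> (a e) \<noteq> \<chi> (b e)" using T_two_colouring ..
    have mono: "\<chi> (a g\<^sub>1) = \<chi> (b g\<^sub>1)" "\<chi> (a g\<^sub>2) = \<chi> (b g\<^sub>2)"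
      using sep_parity_two_colouring[OF \<chi>] False gE by blast+
    let ?T = "T - {f}"
    let ?\<chi> = "\<lambda>v. \<chi> v \<noteq> cn ?T (a f) v"
    let ?S = "insert g\<^sub>1 ?T"
    have cross: "cn ?T (a f) (a g) \<noteq> cn ?T (a f) (b g)" if "g \<in> E" "f \<in> sep T (a g) (b g)" for g
    proof -
      have "\<not> cn ?T (a g) (b g)" using that(2) by (simp add: sep_def)
      then show ?thesis using sep_crosses[OF that] by (meson conn_sym conn_trans)
    qed
    have "cn ?T (a f) (a e) = cn ?T (a f) (b e)" if "e \<in> ?T" for e
      using cn_edge[OF that] by (meson conn_sym conn_trans)
    then have col: "\<forall>e\<in>?S. ?\<chi> (a e) \<noteq> ?\<chi> (b e)"
      using \<chi> cross[OF gE(1) g(4)] mono by auto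
    have col2: "?\<chi> (a g\<^sub>2) \<noteq> ?\<chi> (b g\<^sub>2)" using cross[OF gE(2) g(5)] mono by auto
    have up: "cn ?T x y \<Longrightarrow> cn ?S x y" for x y by (rule cn_mono) auto
    \<comment> \<open>\<open>g\<^sub>1\<close> bridges the gap left by \<open>f\<close>, so the
      exchanged edge set still spans the component.\<close>
    have "cn ?S (a f) (b f)"
      using sep_crosses[OF gE(1) g(4)] up cn_edge[of g\<^sub>1 ?S]
      by (meson conn_sym conn_trans insertI1)
    then have "cn ?S (a e) (b e)" if "e \<in> T" for e
      using that cn_edge[of e ?S] by (cases "e = f") auto
    then have "cn ?S x y" if "cn T x y" for x y
      using that by (rule_tac conn_le[of "ends T"]) (auto simp: ends_def[of T])
    then have "cn ?S v (a g\<^sub>2)" if "v \<in> comp r" for v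
      using L_eq_iff[of v "a g\<^sub>2"] that lab ends_in_V[OF gE(2)] by simp
    then have "\<forall>v\<in>comp r. cn ?S v (a g\<^sub>2)" by blast
    moreover have "?S \<subseteq> E" using gE T_sub by auto
    moreover have "g\<^sub>2 \<in> E - ?S" using g by auto
    ultimately have "\<exists>\<epsilon>. transversal ?\<chi> (comp r) \<epsilon>"
      using col col2 by (intro transversal_extra_edge)
    then show ?thesis by (rule exI[of "\<lambda>\<chi>. \<exists>\<epsilon>. transversal \<chi> (comp r) \<epsilon>"])
  qed
qed

lemma transversal_bad:
  assumes "bad r"
  shows "\<exists>\<chi> \<epsilon>. transversal \<chi> (comp r) \<epsilon>"
  using assms unfolding bad_def
proof
  assume "\<exists>g\<in>E - T. L (a g) = r \<and> odd (card (sep T (a g) (b g)))"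
  then show ?thesis using transversal_even_cycle by blast
next
  assume "\<exists>f\<in>T. L (a f) = r \<and> 2 \<le> card {g \<in> E - T. f \<in> sep T (a g) (b g)}"
  then obtain f where f: "f \<in> T" "L (a f) = r" "2 \<le> card {g \<in> E - T. f \<in> sep T (a g) (b g)}"
    by blast
  obtain g\<^sub>1 g\<^sub>2 where "g\<^sub>1 \<noteq> g\<^sub>2" "{g\<^sub>1, g\<^sub>2} \<subseteq> {g \<in> E - T. f \<in> sep T (a g) (b g)}"
    using f(3) by (metis (no_types, lifting) card_2_iff obtain_subset_with_card_n)
  then show ?thesis using transversal_two_cycles[OF f(1,2)] by blast
qed

text \<open>A transversal of a component needs as many bichromatic edges as there are vertices.
  Choosing one monochromatic edge on each fundamental cycle is injective, as no edge lies on two of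
  them. Hence there are at least as many monochromatic edges as non-forest edges, so at most as many
  bichromatic edges as forest edges, which are fewer than the vertices.\<close>

lemma no_transversal_good:
  assumes r: "r \<in> V" "L r = r" and good: "\<not> bad r"
  shows "\<not> transversal \<chi> (comp r) \<epsilon>"
proof
  assume tr: "transversal \<chi> (comp r) \<epsilon>"
  define EK where "EK = {e \<in> E. L (a e) = r}"
  define BK where "BK = {e \<in> EK. \<chi> (a e) \<noteq> \<chi> (b e)}"
  have fin: "finite EK" "finite BK" using finite_E by (simp_all add: EK_def BK_def)
  have "\<epsilon> ` comp r \<subseteq> BK"
  proof
    fix e assume "e \<in> \<epsilon> ` comp r"
    then obtain v where v: "v \<in> comp r" "e = \<epsilon> v" by blast
    then have "e \<in> E" "a e = v \<or> b e = v" "\<chi> (a e) \<noteq> \<chi> (b e)"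
      using tr by (auto simp: transversal_def)
    then show "e \<in> BK" using v spanning[of e] by (auto simp: BK_def EK_def)
  qed
  then have "card (comp r) \<le> card BK"
    using tr fin by (intro card_inj_on_le[of \<epsilon>]) (auto simp: transversal_def)
  moreover have "card (EK - T) \<le> card (EK - BK)"
  proof -
    have "\<exists>m\<in>insert g (sep T (a g) (b g)). \<chi> (a m) = \<chi> (b m)" if g: "g \<in> EK - T" for g
    proof (rule ccontr)
      assume "\<not> ?thesis"
      then have n: "\<chi> (a g) \<noteq> \<chi> (b g)" "{f \<in> sep T (a g) (b g). \<chi> (a f) \<noteq> \<chi> (b f)} = sep T (a g) (b g)"
        by auto
      have "g \<in> E" using g by (simp add: EK_def)
      \<comment> \<open>When all of \<open>sep\<close> is bichromatic, its size has the parity of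
        the colour change between the ends of \<open>g\<close>. An odd size would make the cycle
        even.\<close>
      then have "odd (card (sep T (a g) (b g)))"
        using sep_parity[OF finite_T forest_T cn_T, of g \<chi>] n by simp
      then show False using good g by (auto simp: bad_def EK_def)
    qed
    then obtain m where m: "\<And>g. g \<in> EK - T \<Longrightarrow> m g \<in> insert g (sep T (a g) (b g)) \<and> \<chi> (a (m g)) = \<chi> (b (m g))"
      by metis
    have "m ` (EK - T) \<subseteq> EK - BK"
    proof
      fix h assume "h \<in> m ` (EK - T)"
      then obtain g where g: "g \<in> EK - T" "h = m g" by blast
      have "h \<in> EK"
      proof (cases "h = g")
        case False
        then have "h \<in> sep T (a g) (b g)" using m g by auto
        then show ?thesis using sep_same_label[of g h] g(1) T_sub by (auto simp: EK_def sep_def)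
      qed (use g in simp)
      then show "h \<in> EK - BK" using m[OF g(1)] g(2) by (simp add: BK_def)
    qed
    moreover have "inj_on m (EK - T)"
    proof (rule inj_onI, rule ccontr)
      fix g h assume gh: "g \<in> EK - T" "h \<in> EK - T" "m g = m h" "g \<noteq> h"
      have sub: "sep T x y \<subseteq> T" for x y by (auto simp: sep_def)
      have mg: "m g = g \<or> m g \<in> sep T (a g) (b g)" "m g = h \<or> m g \<in> sep T (a h) (b h)"
        using m[OF gh(1)] m[OF gh(2)] unfolding gh(3)[symmetric] by blast+
      have "g \<notin> T" "h \<notin> T" using gh by blast+
      \<comment> \<open>A fundamental cycle contains no closing edge but its own, so an edge chosen
        for two cycles is a forest edge on both.\<close>
      then have in_sep: "m g \<in> sep T (a g) (b g)" "m g \<in> sep T (a h) (b h)"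
        using mg gh(4) sub by (metis subsetD)+
      have "card {g, h} \<le> card {g' \<in> E - T. m g \<in> sep T (a g') (b g')}"
        using in_sep gh finite_E by (intro card_mono) (auto simp: EK_def)
      moreover have "L (a (m g)) = r" "m g \<in> T"
        using sep_same_label[of g "m g"] in_sep(1) gh(1) by (auto simp: EK_def sep_def)
      ultimately show False using good gh(4) by (auto simp: bad_def)
    qed
    ultimately show ?thesis using fin by (intro card_inj_on_le[of m]) auto
  qed
  moreover have "card (T \<inter> EK) < card (comp r)"
  proof (rule forest_card_less)
    show "forest (T \<inter> EK)" using forest_T by (rule forest_subset) simp
    show "\<forall>e\<in>T \<inter> EK. a e \<in> comp r \<and> b e \<in> comp r"
      using ends_in_V spanning by (auto simp: EK_def)
  qed (use finite_T finite_V r in auto)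
  moreover have "card (EK - T) = card EK - card (T \<inter> EK)"
    using fin by (metis Int_commute card_Diff_subset_Int finite_Int)
  moreover have "card (EK - BK) = card EK - card BK" "card BK \<le> card EK"
    using fin by (auto simp: BK_def card_Diff_subset card_mono)
  moreover have "card (T \<inter> EK) \<le> card EK" using fin by (simp add: card_mono)
  ultimately show False by linarith
qed

text \<open>One root for each component without an even cycle: the cardinality is the number
  \<open>c\<close> of the overview.\<close>

definition good_roots :: "'v set" where
  "good_roots = {r \<in> V. L r = r \<and> \<not> bad r}"

text \<open>The solutions of the components can be glued, each vertex taking colour and edge from
  its own component. The ends of an edge share a label, so an edge is coloured within one solution,
  and edges chosen in different components differ.\<close>

lemma transversal_exists: "\<exists>\<chi> \<epsilon>. transversal \<chi> (V - good_roots) \<epsilon>"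
proof -
  have lab: "L v \<in> V \<and> L (L v) = L v" if "v \<in> V" for v
    using labels_T that by (simp add: labels_def)
  have "\<exists>\<chi> \<epsilon>. transversal \<chi> (comp r - good_roots) \<epsilon>" if r: "r \<in> L ` V" for r
  proof -
    have r: "r \<in> V" "L r = r" using r lab by auto
    then have "comp r - good_roots = (if bad r then comp r else comp r - {r})"
      by (auto simp: good_roots_def)
    then show ?thesis using transversal_bad transversal_rootless r by auto
  qed
  then obtain \<chi> \<epsilon> where tr: "\<And>r. r \<in> L ` V \<Longrightarrow> transversal (\<chi> r) (comp r - good_roots) (\<epsilon> r)"
    by metis
  let ?\<chi> = "\<lambda>v. \<chi> (L v) v" and ?\<epsilon> = "\<lambda>v. \<epsilon> (L v) v"
  have edge: "?\<epsilon> v \<in> E" "a (?\<epsilon> v) = v \<or> b (?\<epsilon> v) = v" "?\<chi> (a (?\<epsilon> v)) \<noteq> ?\<chi> (b (?\<epsilon> v))"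
      "L (a (?\<epsilon> v)) = L v"
    if "v \<in> V - good_roots" for v
  proof -
    have v: "v \<in> comp (L v) - good_roots" "L v \<in> L ` V" using that by auto
    then show 1: "?\<epsilon> v \<in> E" and 2: "a (?\<epsilon> v) = v \<or> b (?\<epsilon> v) = v" using tr unfolding transversal_def by blast+
    show 3: "L (a (?\<epsilon> v)) = L v" using 1 2 spanning by metis
    have "\<chi> (L v) (a (?\<epsilon> v)) \<noteq> \<chi> (L v) (b (?\<epsilon> v))" using v tr unfolding transversal_def by blast
    then show "?\<chi> (a (?\<epsilon> v)) \<noteq> ?\<chi> (b (?\<epsilon> v))" using 3 spanning[OF 1] by simp
  qed
  have "inj_on ?\<epsilon> (V - good_roots)"
  proof (rule inj_onI)
    fix u v assume uv: "u \<in> V - good_roots" "v \<in> V - good_roots" "?\<epsilon> u = ?\<epsilon> v"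
    then have "L u = L v" using edge(4) by metis
    moreover have "inj_on (\<epsilon> (L v)) (comp (L v) - good_roots)"
      using tr uv by (simp add: transversal_def)
    ultimately show "u = v" using uv by (intro inj_onD[of "\<epsilon> (L v)"]) auto
  qed
  then have "transversal ?\<chi> (V - good_roots) ?\<epsilon>" unfolding transversal_def using edge by blast
  then show ?thesis by blast
qed

end

section \<open>Super domination in 1-subdivisions\<close>

lemma super_domination_number_eqI:
  assumes "finite (pverts F)"
    and "\<And>D. super_dominating_set F D \<Longrightarrow> card (pverts F - D) + n \<le> card (pverts F)"
    and "super_dominating_set F D" "card D = n"
  shows "super_domination_number F = n"
  unfolding super_domination_number_def
proof (rule Min_eqI)
  have sub: "D \<subseteq> pverts F" if "super_dominating_set F D" for D
    using that by (simp add: super_dominating_set_def dominating_set_def)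
  then have "{D. super_dominating_set F D} \<subseteq> Pow (pverts F)" by blast
  then have "finite {D. super_dominating_set F D}"
    by (rule finite_subset) (simp add: assms(1))
  then show "finite (card ` {D. super_dominating_set F D})" by (rule finite_imageI)
  show "n \<in> card ` {D. super_dominating_set F D}" using assms(3,4) by blast
  fix m assume "m \<in> card ` {D. super_dominating_set F D}"
  then obtain D where D: "super_dominating_set F D" "m = card D" by blast
  have "finite D" using sub[OF D(1)] assms(1) by (rule finite_subset)
  then have "card (pverts F - D) = card (pverts F) - card D" "card D \<le> card (pverts F)"
    using sub[OF D(1)] assms(1) by (simp_all add: card_Diff_subset card_mono)
  then show "n \<le> m" using assms(2)[OF D(1)] D(2) by simp
qed

text \<open>The edges of the multigraph are the vertices of \<open>F\<close> that subdivide them,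
  hence one type for both. Parallel edges are allowed; a loop would leave its subdividing vertex
  with a single neighbour.\<close>

locale subdivided = spanned_multigraph a b V E T L
  for a b :: "'v \<Rightarrow> 'v" and V E T L +
  fixes F :: "'v pair_pre_digraph"
  assumes disjoint: "V \<inter> E = {}" and pverts_F: "pverts F = V \<union> E"
    and nbhd_E: "\<And>e. e \<in> E \<Longrightarrow> nbhd F e = {a e, b e}"
    and ends_ne: "\<And>e. e \<in> E \<Longrightarrow> a e \<noteq> b e"
    and nbhd_V: "\<And>v. v \<in> V \<Longrightarrow> nbhd F v = {e \<in> E. a e = v \<or> b e = v}"
begin

lemma card_pverts: "card (pverts F) = card V + card E"
  unfolding pverts_F using disjoint finite_V finite_E by (simp add: card_Un_disjoint)

lemma good_roots_sub: "good_roots \<subseteq> V"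
  by (auto simp: good_roots_def)

text \<open>Every \<open>v\<close> in \<open>M\<close> puts one element into the complement
  \<open>X\<close>: itself if it is coloured, and otherwise its edge \<open>\<epsilon> v\<close>.
  Whichever of the two stays outside has the other as its only neighbour in \<open>X\<close>,
  because a bichromatic edge has exactly one coloured and one uncoloured end.\<close>

lemma super_dominating_set_of_transversal:
  assumes tr: "transversal \<chi> M \<epsilon>" and M: "M \<subseteq> V"
  shows "\<exists>D. super_dominating_set F D \<and> card D + card M = card V + card E"
proof -
  define X where "X = {v \<in> M. \<chi> v} \<union> \<epsilon> ` {v \<in> M. \<not> \<chi> v}"
  have \<epsilon>: "\<epsilon> v \<in> E" "a (\<epsilon> v) = v \<or> b (\<epsilon> v) = v" "\<chi> (a (\<epsilon> v)) \<noteq> \<chi> (b (\<epsilon> v))" if "v \<in> M" for v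
    using tr that by (auto simp: transversal_def)
  have inj: "inj_on \<epsilon> M" using tr by (simp add: transversal_def)
  have finM: "finite M" using M finite_V finite_subset by blast
  have X_sub: "X \<subseteq> pverts F" unfolding X_def pverts_F using \<epsilon>(1) M by auto
  have finX: "finite X" unfolding X_def using finM by simp
  have "card X = card {v \<in> M. \<chi> v} + card {v \<in> M. \<not> \<chi> v}"
  proof -
    have "{v \<in> M. \<chi> v} \<inter> \<epsilon> ` {v \<in> M. \<not> \<chi> v} = {}" using \<epsilon>(1) M disjoint by auto
    moreover have "card (\<epsilon> ` {v \<in> M. \<not> \<chi> v}) = card {v \<in> M. \<not> \<chi> v}"
      by (rule card_image) (rule inj_on_subset[OF inj], auto)
    ultimately show ?thesis unfolding X_def using finM by (simp add: card_Un_disjoint)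
  qed
  also have "\<dots> = card M"
    using finM by (subst card_Un_disjoint[symmetric]) (auto intro: arg_cong[where f = card])
  finally have cardX: "card X = card M" .
  have priv: "\<exists>y \<in> pverts F - X. nbhd F y \<inter> X = {x}" if x: "x \<in> X" for x
  proof -
    consider v where "v \<in> M" "\<chi> v" "x = v" | v where "v \<in> M" "\<not> \<chi> v" "x = \<epsilon> v"
      using x by (auto simp: X_def)
    then show ?thesis
    proof cases
      case 1
      have "\<epsilon> v \<notin> X"
        using 1 \<epsilon>(1)[OF 1(1)] M disjoint inj_onD[OF inj] by (auto simp: X_def)
      moreover have "\<epsilon> v \<in> pverts F" using \<epsilon>(1)[OF 1(1)] by (simp add: pverts_F)
      moreover have "nbhd F (\<epsilon> v) \<inter> X = {v}"
      proof -
        have "u = v" if "u \<in> X" "u = a (\<epsilon> v) \<or> u = b (\<epsilon> v)" for u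
        proof -
          have "u \<in> V" using that(2) ends_in_V[OF \<epsilon>(1)[OF 1(1)]] by auto
          then have "\<chi> u" using that(1) \<epsilon>(1) disjoint by (auto simp: X_def)
          then show ?thesis using \<epsilon>(2,3)[OF 1(1)] 1(2) that(2) by auto
        qed
        then show ?thesis using nbhd_E[OF \<epsilon>(1)[OF 1(1)]] \<epsilon>(2)[OF 1(1)] x 1(3) by auto
      qed
      ultimately show ?thesis using 1(3) by blast
    next
      case 2
      have vV: "v \<in> V" using 2 M by auto
      then have "v \<notin> X" using 2(2) \<epsilon>(1) disjoint by (auto simp: X_def)
      moreover have "nbhd F v \<inter> X = {\<epsilon> v}"
      proof -
        have "\<And>e. e \<in> X \<Longrightarrow> e \<in> E \<Longrightarrow> a e = v \<or> b e = v \<Longrightarrow> e = \<epsilon> v"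
        proof -
          fix e assume e: "e \<in> X" "e \<in> E" "a e = v \<or> b e = v"
          obtain u where u: "u \<in> M" "\<not> \<chi> u" "e = \<epsilon> u" using e disjoint M by (auto simp: X_def)
          then have "u = v" using \<epsilon>(2,3)[OF u(1)] e(3) 2(2) by auto
          then show "e = \<epsilon> v" using u by simp
        qed
        moreover have "\<epsilon> v \<in> X" using x 2(3) by simp
        ultimately show ?thesis unfolding nbhd_V[OF vV] using \<epsilon>(1,2)[OF 2(1)] by blast
      qed
      ultimately show ?thesis using vV 2(3) by (auto simp: pverts_F)
    qed
  qed
  define D where "D = pverts F - X"
  have DX: "pverts F - D = X" using X_sub by (auto simp: D_def)
  have sym: "y \<in> nbhd F x" if "x \<in> pverts F" "y \<in> pverts F" "x \<in> nbhd F y" for x y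
    using that nbhd_E nbhd_V ends_in_V disjoint unfolding pverts_F by fastforce
  have "super_dominating_set F D"
    unfolding super_dominating_set_def dominating_set_def DX
  proof (intro conjI ballI)
    show "D \<subseteq> pverts F" by (auto simp: D_def)
    fix x assume x: "x \<in> X"
    show "\<exists>y\<in>D. nbhd F y \<inter> X = {x}" using priv[OF x] by (simp add: D_def)
    then obtain y where "y \<in> D" "x \<in> nbhd F y" by blast
    then have "y \<in> nbhd F x" using sym x X_sub by (auto simp: D_def)
    then show "nbhd F x \<inter> D \<noteq> {}" using \<open>y \<in> D\<close> by blast
  qed
  moreover have "card D + card M = card V + card E"
  proof -
    have "finite (pverts F)" using finite_V finite_E by (simp add: pverts_F)
    then have "card D = card (pverts F) - card X" "card X \<le> card (pverts F)"
      using X_sub finX by (auto simp: D_def card_Diff_subset card_mono)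
    then show ?thesis using card_pverts cardX by linarith
  qed
  ultimately show ?thesis by blast
qed

text \<open>The injection \<open>\<mu>\<close> sends each element of the complement to the vertex of
  \<open>H\<close> that it uses up: itself, or the end that has it as private neighbour. If it
  covered a component completely, a transversal could be read off, so it misses a vertex in each
  component with a good root.\<close>

lemma card_complement_super_dominating_set:
  assumes D: "super_dominating_set F D"
  shows "card (pverts F - D) + card good_roots \<le> card V"
proof -
  define X where "X = pverts F - D"
  have DV: "D \<subseteq> pverts F" using D by (simp add: super_dominating_set_def dominating_set_def)
  have D_iff: "y \<in> D \<longleftrightarrow> y \<in> pverts F \<and> y \<notin> X" for y using DV by (auto simp: X_def)
  obtain y where y: "\<And>x. x \<in> X \<Longrightarrow> y x \<in> D \<and> nbhd F (y x) \<inter> X = {x}"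
    using D unfolding super_dominating_set_def X_def by metis
  have X: "X \<subseteq> V \<union> E" by (auto simp: X_def pverts_F)
  define \<mu> where "\<mu> x = (if x \<in> V then x else y x)" for x
  have xE: "y x \<in> V \<and> (a x = y x \<or> b x = y x) \<and> x \<in> E" if "x \<in> X" "x \<notin> V" for x
  proof -
    have "x \<in> E" using that X by auto
    have "x \<in> nbhd F (y x)" "y x \<in> V \<union> E" using y[OF that(1)] DV by (auto simp: pverts_F)
    moreover have "y x \<notin> E" using nbhd_E ends_in_V disjoint \<open>x \<in> nbhd F (y x)\<close> that(2) by fastforce
    ultimately show ?thesis using nbhd_V \<open>x \<in> E\<close> by auto
  qed
  have xV: "y x \<in> E \<and> (a (y x) = x \<or> b (y x) = x)" if "x \<in> X" "x \<in> V" for x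
  proof -
    have "x \<in> nbhd F (y x)" "y x \<in> V \<union> E" using y[OF that(1)] DV by (auto simp: pverts_F)
    moreover have "y x \<notin> V" using nbhd_V disjoint \<open>x \<in> nbhd F (y x)\<close> that(2) by fastforce
    ultimately show ?thesis using nbhd_E by auto
  qed
  have yX: "y x \<notin> X" if "x \<in> X" for x using y[OF that] D_iff by blast
  have inj: "inj_on \<mu> X"
  proof (rule inj_onI)
    fix x x' assume xx: "x \<in> X" "x' \<in> X" "\<mu> x = \<mu> x'"
    have yy: "x = x'" if "y x = y x'" using y[OF xx(1)] y[OF xx(2)] that by (metis singleton_inject)
    show "x = x'"
    proof (cases "x \<in> V"; cases "x' \<in> V")
      assume "x \<in> V" "x' \<notin> V"
      then show ?thesis using xx yX by (auto simp: \<mu>_def)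
    next
      assume "x \<notin> V" "x' \<in> V"
      then show ?thesis using xx yX by (auto simp: \<mu>_def)
    qed (use xx yy in \<open>auto simp: \<mu>_def\<close>)
  qed
  have \<mu>V: "\<mu> ` X \<subseteq> V" using xE by (auto simp: \<mu>_def)
  have "\<exists>v\<in>comp r. v \<notin> \<mu> ` X" if r: "r \<in> good_roots" for r
  proof (rule ccontr)
    assume "\<not> ?thesis"
    then have full: "\<And>v. v \<in> comp r \<Longrightarrow> v \<in> \<mu> ` X" by blast
    \<comment> \<open>A vertex in \<open>X\<close> gets the edge whose private neighbour it is; any
      other vertex gets the edge in \<open>X\<close> that \<open>\<mu>\<close> maps to it.\<close>
    define \<epsilon> where "\<epsilon> v = (if v \<in> X then y v else the_inv_into X \<mu> v)" for v
    define \<chi> where "\<chi> v \<longleftrightarrow> v \<in> X" for v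
    have A: "\<epsilon> v \<in> E" "a (\<epsilon> v) = v \<or> b (\<epsilon> v) = v" "nbhd F (\<epsilon> v) \<inter> X = {v}" "\<epsilon> v \<notin> X"
      if "v \<in> comp r" "v \<in> X" for v
      using xV[of v] y[of v] yX[of v] that by (auto simp: \<epsilon>_def)
    have B: "\<epsilon> v \<in> X" "y (\<epsilon> v) = v" "\<epsilon> v \<notin> V" if "v \<in> comp r" "v \<notin> X" for v
    proof -
      have "\<epsilon> v \<in> X" "\<mu> (\<epsilon> v) = v"
        using full[OF that(1)] that(2) inj by (auto simp: \<epsilon>_def the_inv_into_into f_the_inv_into_f)
      then show "\<epsilon> v \<in> X" "y (\<epsilon> v) = v" "\<epsilon> v \<notin> V" using that(2) by (auto simp: \<mu>_def split: if_splits)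
    qed
    have B': "\<epsilon> v \<in> E" "a (\<epsilon> v) = v \<or> b (\<epsilon> v) = v" if "v \<in> comp r" "v \<notin> X" for v
      using xE[of "\<epsilon> v"] B[OF that] by auto
    have E: "\<epsilon> v \<in> E" "a (\<epsilon> v) = v \<or> b (\<epsilon> v) = v" if "v \<in> comp r" for v
      using A[OF that] B'[OF that] by blast+
    have other: "w \<in> comp r" if "v \<in> comp r" "w = a (\<epsilon> v) \<or> w = b (\<epsilon> v)" for v w
      using E[OF that(1)] that spanning[of "\<epsilon> v"] ends_in_V[of "\<epsilon> v"] by auto
    have "transversal \<chi> (comp r) \<epsilon>"
      unfolding transversal_def
    proof (intro conjI ballI inj_onI)
      fix v assume v: "v \<in> comp r"
      show "\<epsilon> v \<in> E" "a (\<epsilon> v) = v \<or> b (\<epsilon> v) = v" using E[OF v] by auto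
      let ?e = "\<epsilon> v"
      show "\<chi> (a ?e) \<noteq> \<chi> (b ?e)"
      proof (cases "v \<in> X")
        case True
        then show ?thesis
          using A[OF v True] nbhd_E[of ?e] ends_ne[of ?e] by (auto simp: \<chi>_def)
      next
        case False
        \<comment> \<open>Here coverage of the whole component matters: an end \<open>w\<close>
          outside \<open>X\<close> would be used up by \<open>\<epsilon> w\<close>, its only
          neighbour in \<open>X\<close>. That would have to be \<open>?e\<close>, which is already
          assigned to \<open>v\<close>.\<close>
        have "w \<in> X" if w: "w = a ?e \<or> w = b ?e" "w \<noteq> v" for w
        proof (rule ccontr)
          assume "w \<notin> X"
          have wK: "w \<in> comp r" using other[OF v] w by blast
          have "?e \<in> nbhd F w" using nbhd_V[of w] wK w E(1)[OF v] by auto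
          moreover have "nbhd F w \<inter> X = {\<epsilon> w}" using y[of "\<epsilon> w"] B[OF wK \<open>w \<notin> X\<close>] by auto
          ultimately have "?e = \<epsilon> w" using B(1)[OF v False] by blast
          then show False using B(2)[OF v False] B(2)[OF wK \<open>w \<notin> X\<close>] w(2) by simp
        qed
        then show ?thesis using E[OF v] False ends_ne[of ?e] unfolding \<chi>_def by metis
      qed
    next
      fix u v assume uv: "u \<in> comp r" "v \<in> comp r" "\<epsilon> u = \<epsilon> v"
      show "u = v"
        using A[OF uv(1)] A[OF uv(2)] B[OF uv(1)] B[OF uv(2)] uv(3)
        by (metis singleton_insert_inj_eq)
    qed
    then show False using no_transversal_good[of r] r by (auto simp: good_roots_def)
  qed
  then obtain w where w: "\<And>r. r \<in> good_roots \<Longrightarrow> w r \<in> comp r \<and> w r \<notin> \<mu> ` X" by metis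
  have "L (w r) = r" if "r \<in> good_roots" for r using w[OF that] by simp
  then have "inj_on w good_roots" by (metis inj_onI)
  then have "card good_roots = card (w ` good_roots)" by (simp add: card_image)
  moreover have "card X = card (\<mu> ` X)" using inj by (simp add: card_image)
  moreover have "card (\<mu> ` X) + card (w ` good_roots) = card (\<mu> ` X \<union> w ` good_roots)"
  proof (rule card_Un_disjoint[symmetric])
    show "finite (\<mu> ` X)" using \<mu>V finite_V by (rule finite_subset)
    show "finite (w ` good_roots)" using good_roots_sub finite_V by (simp add: finite_subset)
    show "\<mu> ` X \<inter> w ` good_roots = {}"
    proof (rule equals0I)
      fix x assume "x \<in> \<mu> ` X \<inter> w ` good_roots"
      then obtain r where "r \<in> good_roots" "w r \<in> \<mu> ` X" by (metis IntE imageE)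
      then show False using w by blast
    qed
  qed
  moreover have "card (\<mu> ` X \<union> w ` good_roots) \<le> card V"
    using \<mu>V w finite_V by (intro card_mono) auto
  ultimately show ?thesis by (simp add: X_def)
qed

theorem super_domination_number_subdivided:
  "super_domination_number F = card E + card good_roots"
proof -
  obtain \<chi> \<epsilon> where "transversal \<chi> (V - good_roots) \<epsilon>" using transversal_exists by blast
  from super_dominating_set_of_transversal[OF this] obtain D where
    D: "super_dominating_set F D" "card D + card (V - good_roots) = card V + card E" by blast
  have "card (V - good_roots) = card V - card good_roots" "card good_roots \<le> card V"
    using finite_V good_roots_sub by (auto simp: card_Diff_subset finite_subset card_mono)
  then have "card D = card E + card good_roots" using D(2) by linarith
  then show ?thesis
    using D(1) card_complement_super_dominating_set finite_V finite_E
    by (intro super_domination_number_eqI)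
      (fastforce simp: card_pverts pverts_F card_Un_disjoint disjoint)+
qed

end

section \<open>A loop language compiled to the random access machine\<close>

datatype aexp = Num nat | Cell nat aexp | Plus aexp aexp | Minus aexp aexp

datatype com =
    Skip
  | Assign nat aexp aexp
  | Input nat
  | Seq com com  (infixr ";;" 60)
  | Cond aexp com com
  | For nat com

type_synonym store = "nat \<Rightarrow> nat \<Rightarrow> nat"

fun aval :: "aexp \<Rightarrow> store \<Rightarrow> nat" where
  "aval (Num m) s = m"
| "aval (Cell c e) s = s c (aval e s)"
| "aval (Plus e1 e2) s = aval e1 s + aval e2 s"
| "aval (Minus e1 e2) s = aval e1 s - aval e2 s"

definition upd :: "nat \<Rightarrow> nat \<Rightarrow> nat \<Rightarrow> store \<Rightarrow> store" where
  "upd c i x s = s(c := (s c)(i := x))"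

lemma upd_apply: "upd c i x s d = (if d = c then (s d)(i := x) else s d)"
  by (simp add: upd_def)

text \<open>The counter is written before the first round and after every round, the last included.
  It thus holds the number of completed rounds whenever the compiled loop tests for its end.\<close>

primrec loop :: "(nat \<Rightarrow> 'a \<Rightarrow> 'a) \<Rightarrow> ('a \<Rightarrow> 'a) \<Rightarrow> nat \<Rightarrow> 'a \<Rightarrow> 'a" where
  "loop u f 0 x = u 0 x"
| "loop u f (Suc j) x = u (Suc j) (f (loop u f j x))"

fun sem :: "nat \<Rightarrow> com \<Rightarrow> store \<times> nat list \<Rightarrow> store \<times> nat list" where
  "sem n Skip st = st"
| "sem n (Assign c e1 e2) st = apfst (\<lambda>s. upd c (aval e1 s) (aval e2 s) s) st"
| "sem n (Input c) (s, xs) = (upd c 0 (case xs of [] \<Rightarrow> 0 | x # _ \<Rightarrow> x) s, tl xs)"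
| "sem n (c1 ;; c2) st = sem n c2 (sem n c1 st)"
| "sem n (Cond e c1 c2) st = (if aval e (fst st) > 0 then sem n c1 st else sem n c2 st)"
| "sem n (For i c) st = loop (\<lambda>j. apfst (upd i 0 j)) (sem n c) n st"

fun assigned :: "com \<Rightarrow> nat set" where
  "assigned Skip = {}"
| "assigned (Assign c e1 e2) = {c}"
| "assigned (Input c) = {c}"
| "assigned (c1 ;; c2) = assigned c1 \<union> assigned c2"
| "assigned (Cond e c1 c2) = assigned c1 \<union> assigned c2"
| "assigned (For i c) = insert i (assigned c)"

text \<open>The frame rule, for whole columns.\<close>

lemma sem_unassigned: "x \<notin> assigned c \<Longrightarrow> fst (sem n c st) x = fst st x"
proof (induction c arbitrary: st)
  case (Input c) then show ?case by (cases st) (auto simp: upd_def)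
next
  case (For i c)
  have "fst (loop (\<lambda>j. apfst (upd i 0 j)) (sem n c) m st) x = fst st x" for m
    by (induction m) (use For in \<open>auto simp: upd_def\<close>)
  then show ?case by simp
qed (auto simp: upd_def)

text \<open>
  Cell \<open>(c, i)\<close> lives at address \<open>W * i + c\<close>, so that scalars, the cells
  \<open>(c, 0)\<close>, are registers. Columns from \<open>K\<close> on hold temporaries. Column 1 holds the
  number of iterations of every loop.
\<close>

locale layout =
  fixes K W :: nat
  assumes K: "1 < K"
begin

text \<open>\<open>d\<close> is the first free temporary. An expression leaves its value there and
  uses higher ones on the way; addressing takes \<open>d + 1\<close>. Registers from
  \<open>K\<close> up to \<open>W - 1\<close> belong to no cell, so everything has to stay below
  \<open>W\<close>.\<close>

fun wf_aexp :: "nat \<Rightarrow> aexp \<Rightarrow> bool" where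
  "wf_aexp d (Num m) \<longleftrightarrow> d + 1 < W"
| "wf_aexp d (Cell c e) \<longleftrightarrow> c < K \<and> d + 1 < W \<and> wf_aexp d e"
| "wf_aexp d (Plus e1 e2) \<longleftrightarrow> wf_aexp d e1 \<and> wf_aexp (d + 1) e2"
| "wf_aexp d (Minus e1 e2) \<longleftrightarrow> wf_aexp d e1 \<and> wf_aexp (d + 1) e2"

fun wf_com :: "com \<Rightarrow> bool" where
  "wf_com Skip \<longleftrightarrow> True"
| "wf_com (Assign c e1 e2) \<longleftrightarrow> c < K \<and> c \<noteq> 1 \<and> wf_aexp K e1 \<and> wf_aexp (K + 2) e2"
| "wf_com (Input c) \<longleftrightarrow> c < K \<and> c \<noteq> 1 \<and> K \<le> W"
| "wf_com (c1 ;; c2) \<longleftrightarrow> wf_com c1 \<and> wf_com c2"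
| "wf_com (Cond e c1 c2) \<longleftrightarrow> wf_aexp K e \<and> wf_com c1 \<and> wf_com c2"
| "wf_com (For i c) \<longleftrightarrow> i < K \<and> i \<noteq> 1 \<and> K < W \<and> i \<notin> assigned c \<and> wf_com c"

lemma wf_com_assigned: "wf_com c \<Longrightarrow> 1 \<notin> assigned c"
  by (induction c) auto

text \<open>The machine cannot multiply, so the index is added \<open>W\<close> times. Since
  \<open>W\<close> is a constant, so is the length of this code.\<close>

fun caddr :: "nat \<Rightarrow> nat \<Rightarrow> instr list" where
  "caddr c d = Const (d + 1) c # replicate W (Add (d + 1) (d + 1) d)"

fun caexp :: "nat \<Rightarrow> aexp \<Rightarrow> instr list" where
  "caexp d (Num m) = [Const d m]"
| "caexp d (Cell c e) = caexp d e @ caddr c d @ [Load d (d + 1)]"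
| "caexp d (Plus e1 e2) = caexp d e1 @ caexp (d + 1) e2 @ [Add d d (d + 1)]"
| "caexp d (Minus e1 e2) = caexp d e1 @ caexp (d + 1) e2 @ [Sub d d (d + 1)]"

text \<open>Jump targets are absolute, hence the argument \<open>p\<close>, the position of the
  first instruction. An unconditional jump is a \<open>Jump\<close> on the temporary
  \<open>K\<close> after setting it to 1. A loop has five instructions in front of its body and
  three behind it.\<close>

fun ccom :: "nat \<Rightarrow> com \<Rightarrow> instr list" where
  "ccom p Skip = []"
| "ccom p (Assign c e1 e2) =
     caexp K e1 @ caddr c K @ caexp (K + 2) e2 @ [Store (K + 1) (K + 2)]"
| "ccom p (Input c) = [Read c]"
| "ccom p (c1 ;; c2) = ccom p c1 @ ccom (p + length (ccom p c1)) c2"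
| "ccom p (Cond e c1 c2) =
    (let ce = caexp K e; q = p + length ce + 1; cc2 = ccom q c2; r = q + length cc2 + 2;
         cc1 = ccom r c1
     in ce @ [Jump K r] @ cc2 @ [Const K 1, Jump K (r + length cc1)] @ cc1)"
| "ccom p (For i c) =
    (let cc = ccom (p + 5) c
     in [Const i 0, Sub K 1 i, Jump K (p + 5), Const K 1, Jump K (p + 8 + length cc)] @ cc @
        [Const K 1, Add i i K, Jump K (p + 1)])"

text \<open>Each round of a loop adds five steps to its body, two for the test and three to advance
  the counter and jump back. The other five are the initialisation and the last test with its
  exit.\<close>

fun cost :: "com \<Rightarrow> nat \<Rightarrow> nat" where
  "cost Skip n = 0"
| "cost (Assign c e1 e2) n = length (ccom 0 (Assign c e1 e2))"
| "cost (Input c) n = 1"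
| "cost (c1 ;; c2) n = cost c1 n + cost c2 n"
| "cost (Cond e c1 c2) n = length (caexp K e) + 3 + cost c1 n + cost c2 n"
| "cost (For i c) n = 5 + n * (cost c n + 5)"

lemma cost_poly: "\<exists>p. \<forall>n. cost c n = poly p n"
proof (induction c)
  case Skip show ?case by (rule exI[of _ 0]) simp
next
  case (Assign c e1 e2) show ?case
    by (rule exI[of _ "[:length (ccom 0 (Assign c e1 e2)):]"]) simp
next
  case (Input c) show ?case by (rule exI[of _ 1]) simp
next
  case (Seq c1 c2)
  then obtain p q where "\<forall>n. cost c1 n = poly p n" "\<forall>n. cost c2 n = poly q n" by blast
  then show ?case by (intro exI[of _ "p + q"]) simp
next
  case (Cond e c1 c2)
  then obtain p q where "\<forall>n. cost c1 n = poly p n" "\<forall>n. cost c2 n = poly q n" by blast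
  then show ?case by (intro exI[of _ "[:length (caexp K e) + 3:] + p + q"]) simp
next
  case (For i c)
  then obtain p where "\<forall>n. cost c n = poly p n" by blast
  then show ?case by (intro exI[of _ "[:5:] + [:0, 1:] * (p + [:5:])"]) simp
qed

section \<open>Simulation of the loop language by the machine\<close>

definition code_at :: "instr list \<Rightarrow> nat \<Rightarrow> instr list \<Rightarrow> bool" where
  "code_at P p is \<longleftrightarrow> (\<forall>i < length is. p + i < length P \<and> P ! (p + i) = is ! i)"

lemma code_at_Nil [simp]: "code_at P p []"
  by (simp add: code_at_def)

lemma code_at_append [simp]:
  "code_at P p (xs @ ys) \<longleftrightarrow> code_at P p xs \<and> code_at P (p + length xs) ys"
  unfolding code_at_def
proof safe
  fix i assume H: "\<forall>i<length (xs @ ys). p + i < length P \<and> P ! (p + i) = (xs @ ys) ! i"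
  show "p + i < length P" "P ! (p + i) = xs ! i" if "i < length xs"
    using H[rule_format, of i] that by (auto simp: nth_append)
  show "p + length xs + i < length P" "P ! (p + length xs + i) = ys ! i" if "i < length ys"
    using H[rule_format, of "length xs + i"] that by (auto simp: nth_append add.assoc)
next
  fix i
  assume H: "\<forall>i<length xs. p + i < length P \<and> P ! (p + i) = xs ! i"
    "\<forall>i<length ys. p + length xs + i < length P \<and> P ! (p + length xs + i) = ys ! i"
    "i < length (xs @ ys)"
  show "p + i < length P" "P ! (p + i) = (xs @ ys) ! i"
    using H(1)[rule_format, of i] H(2)[rule_format, of "i - length xs"] H(3)
    by (cases "i < length xs"; simp add: nth_append)+
qed

lemma code_at_Cons [simp]:
  "code_at P p (x # xs) \<longleftrightarrow> p < length P \<and> P ! p = x \<and> code_at P (p + 1) xs"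
  using code_at_append[of P p "[x]" xs] by (simp add: code_at_def)

definition reach :: "instr list \<Rightarrow> nat \<Rightarrow> ram_state \<Rightarrow> ram_state \<Rightarrow> bool" where
  "reach P T \<sigma> \<tau> \<longleftrightarrow> (\<exists>t \<le> T. (step P ^^ t) \<sigma> = \<tau>)"

lemma reach_refl [simp]: "reach P T \<sigma> \<sigma>"
  unfolding reach_def by (rule exI[of _ 0]) simp

lemma reach_trans: "reach P T \<sigma> \<tau> \<Longrightarrow> reach P T' \<tau> \<rho> \<Longrightarrow> reach P (T + T') \<sigma> \<rho>"
  unfolding reach_def by (metis add_le_mono funpow_add comp_apply add.commute)

lemma reach_mono: "reach P T \<sigma> \<tau> \<Longrightarrow> T \<le> T' \<Longrightarrow> reach P T' \<sigma> \<tau>"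
  unfolding reach_def using order_trans by blast

lemma reach_step:
  assumes "pc \<sigma> < length P" "P ! pc \<sigma> = i"
  shows "reach P 1 \<sigma> (exec i \<sigma>)"
  unfolding reach_def by (rule exI[of _ 1]) (use assms in \<open>simp add: step_def halted_def\<close>)

abbreviation mk :: "nat \<Rightarrow> (nat \<Rightarrow> nat) \<Rightarrow> nat list \<Rightarrow> ram_state" where
  "mk p r xs \<equiv> \<lparr>pc = p, reg = r, inp = xs\<rparr>"

text \<open>Registers outside the cells of the first \<open>K\<close> columns are unconstrained, so
  temporaries may hold anything.\<close>

definition rel :: "store \<Rightarrow> (nat \<Rightarrow> nat) \<Rightarrow> bool" where
  "rel s r \<longleftrightarrow> (\<forall>c<K. \<forall>i. r (W * i + c) = s c i)"

lemma addr_eq_iff: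
  assumes "c < W" "d < W"
  shows "W * i + c = W * j + d \<longleftrightarrow> i = j \<and> c = d"
  using assms by (metis add.commute mod_mult_self1_is_0 mod_less div_mult_self1 div_less
      add_left_cancel less_nat_zero_code mod_mult_self2 mult_cancel1 add_right_cancel
      not_less_zero)

lemma temp_not_addr: "c < K \<Longrightarrow> K \<le> d \<Longrightarrow> d < W \<Longrightarrow> W * i + c \<noteq> d"
  using addr_eq_iff[of c d i 0] by auto

lemma rel_temp: "rel s r \<Longrightarrow> K \<le> d \<Longrightarrow> d < W \<Longrightarrow> rel s (r(d := x))"
  unfolding rel_def using temp_not_addr by auto

lemma rel_upd:
  assumes "rel s r" "c < K" "K \<le> W"
  shows "rel (upd c i x s) (r(W * i + c := x))"
  unfolding rel_def
proof (intro allI impI)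
  fix c' j assume "c' < K"
  then show "(r(W * i + c := x)) (W * j + c') = upd c i x s c' j"
    using assms addr_eq_iff[of c' c j i] by (auto simp: rel_def upd_def)
qed

lemma reach_adds:
  assumes "code_at P p (replicate m (Add (d + 1) (d + 1) d))"
  shows "reach P m (mk p r xs) (mk (p + m) (r(d + 1 := r (d + 1) + m * r d)) xs)"
  using assms
proof (induction m arbitrary: p r)
  case (Suc m)
  let ?r = "r(d + 1 := r (d + 1) + r d)"
  have "reach P 1 (mk p r xs) (mk (p + 1) ?r xs)"
    using reach_step[of "mk p r xs" P] Suc.prems by simp
  moreover have "reach P m (mk (p + 1) ?r xs)
      (mk (p + 1 + m) (?r(d + 1 := ?r (d + 1) + m * ?r d)) xs)"
    by (rule Suc.IH) (use Suc.prems in simp)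
  moreover have "?r(d + 1 := ?r (d + 1) + m * ?r d) = r(d + 1 := r (d + 1) + Suc m * r d)"
    by (simp add: add.assoc)
  ultimately show ?case using reach_trans[of P 1 _ _ m] by (simp del: fun_upd_apply)
qed simp

lemma reach_caddr:
  assumes "code_at P p (caddr c d)"
  shows "reach P (length (caddr c d)) (mk p r xs)
    (mk (p + length (caddr c d)) (r(d + 1 := W * r d + c)) xs)"
proof -
  have "reach P 1 (mk p r xs) (mk (p + 1) (r(d + 1 := c)) xs)"
    using reach_step[of "mk p r xs" P] assms by simp
  moreover have "reach P W (mk (p + 1) (r(d + 1 := c)) xs)
      (mk (p + 1 + W) (r(d + 1 := W * r d + c)) xs)"
    using reach_adds[of P "p + 1" W d "r(d + 1 := c)"] assms by (simp add: add.commute mult.commute)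
  ultimately show ?thesis using reach_trans by fastforce
qed

text \<open>Registers below \<open>d\<close> are left alone, which protects a left operand, or the
  target address of an assignment, while the next expression is evaluated.\<close>

lemma reach_caexp:
  assumes "code_at P p (caexp d e)" "rel s r" "wf_aexp d e" "K \<le> d"
  shows "\<exists>r'. reach P (length (caexp d e)) (mk p r xs) (mk (p + length (caexp d e)) r' xs) \<and>
           r' d = aval e s \<and> rel s r' \<and> (\<forall>a<d. r' a = r a)"
  using assms
proof (induction e arbitrary: p d r)
  case (Num m)
  have "reach P 1 (mk p r xs) (mk (p + 1) (r(d := m)) xs)"
    using reach_step[of "mk p r xs" P] Num by simp
  moreover have "rel s (r(d := m))" using rel_temp[of s r d m] Num by simp
  moreover have "(r(d := m)) d = m" "\<forall>a<d. (r(d := m)) a = r a" by simp_all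
  ultimately show ?case by (intro exI[of _ "r(d := m)"]) (simp del: fun_upd_apply)
next
  case (Cell c e)
  let ?l = "length (caexp d e)" and ?m = "length (caddr c d)"
  have "\<exists>r'. reach P ?l (mk p r xs) (mk (p + ?l) r' xs) \<and> r' d = aval e s \<and> rel s r' \<and> (\<forall>a<d. r' a = r a)"
    using Cell.prems by (intro Cell.IH) auto
  then obtain r1 where r1: "reach P ?l (mk p r xs) (mk (p + ?l) r1 xs)"
    "r1 d = aval e s" "rel s r1" "\<forall>a<d. r1 a = r a" by blast
  let ?r2 = "r1(d + 1 := W * r1 d + c)"
  have 2: "reach P ?m (mk (p + ?l) r1 xs) (mk (p + ?l + ?m) ?r2 xs)"
    using Cell.prems by (intro reach_caddr) simp
  have rel2: "rel s ?r2" using rel_temp[OF r1(3)] Cell.prems by simp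
  let ?r3 = "?r2(d := ?r2 (?r2 (d + 1)))"
  have 3: "reach P 1 (mk (p + ?l + ?m) ?r2 xs) (mk (p + ?l + ?m + 1) ?r3 xs)"
    using reach_step[of "mk (p + ?l + ?m) ?r2 xs" P] Cell.prems by (simp add: add.assoc)
  have "?r2 (?r2 (d + 1)) = s c (aval e s)"
    using rel2 Cell.prems r1(2) by (simp add: rel_def)
  moreover have "rel s ?r3" using rel_temp[OF rel2] Cell.prems by simp
  moreover have "?r3 d = ?r2 (?r2 (d + 1))" "\<forall>a<d. ?r3 a = r a" using r1(4) by simp_all
  ultimately show ?case
    using reach_trans[OF reach_trans[OF r1(1) 2] 3]
    by (intro exI[of _ ?r3]) (simp add: add.assoc del: fun_upd_apply)
next
  case (Plus e1 e2)
  let ?l = "length (caexp d e1)" and ?m = "length (caexp (d + 1) e2)"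
  have "\<exists>r'. reach P ?l (mk p r xs) (mk (p + ?l) r' xs) \<and> r' d = aval e1 s \<and> rel s r' \<and> (\<forall>a<d. r' a = r a)"
    using Plus.prems by (intro Plus.IH(1)) auto
  then obtain r1 where r1: "reach P ?l (mk p r xs) (mk (p + ?l) r1 xs)"
    "r1 d = aval e1 s" "rel s r1" "\<forall>a<d. r1 a = r a" by blast
  have "\<exists>r'. reach P ?m (mk (p + ?l) r1 xs) (mk (p + ?l + ?m) r' xs) \<and> r' (d + 1) = aval e2 s \<and> rel s r' \<and> (\<forall>a<d + 1. r' a = r1 a)"
    using Plus.prems r1 by (intro Plus.IH(2)) auto
  then obtain r2 where r2: "reach P ?m (mk (p + ?l) r1 xs) (mk (p + ?l + ?m) r2 xs)"
    "r2 (d + 1) = aval e2 s" "rel s r2" "\<forall>a<d + 1. r2 a = r1 a" by blast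
  let ?r3 = "r2(d := r2 d + r2 (d + 1))"
  have 3: "reach P 1 (mk (p + ?l + ?m) r2 xs) (mk (p + ?l + ?m + 1) ?r3 xs)"
    using reach_step[of "mk (p + ?l + ?m) r2 xs" P] Plus.prems by (simp add: add.assoc)
  have "d < W" using Plus.prems(3) by (induction e1 arbitrary: d) auto
  then have "rel s ?r3" using rel_temp[OF r2(3)] Plus.prems by simp
  moreover have "?r3 d = aval e1 s + aval e2 s" "\<forall>a<d. ?r3 a = r a" using r1 r2 by simp_all
  ultimately show ?case
    using reach_trans[OF reach_trans[OF r1(1) r2(1)] 3]
    by (intro exI[of _ ?r3]) (simp add: add.assoc del: fun_upd_apply)
next
  case (Minus e1 e2)
  let ?l = "length (caexp d e1)" and ?m = "length (caexp (d + 1) e2)"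
  have "\<exists>r'. reach P ?l (mk p r xs) (mk (p + ?l) r' xs) \<and> r' d = aval e1 s \<and> rel s r' \<and> (\<forall>a<d. r' a = r a)"
    using Minus.prems by (intro Minus.IH(1)) auto
  then obtain r1 where r1: "reach P ?l (mk p r xs) (mk (p + ?l) r1 xs)"
    "r1 d = aval e1 s" "rel s r1" "\<forall>a<d. r1 a = r a" by blast
  have "\<exists>r'. reach P ?m (mk (p + ?l) r1 xs) (mk (p + ?l + ?m) r' xs) \<and> r' (d + 1) = aval e2 s \<and> rel s r' \<and> (\<forall>a<d + 1. r' a = r1 a)"
    using Minus.prems r1 by (intro Minus.IH(2)) auto
  then obtain r2 where r2: "reach P ?m (mk (p + ?l) r1 xs) (mk (p + ?l + ?m) r2 xs)"
    "r2 (d + 1) = aval e2 s" "rel s r2" "\<forall>a<d + 1. r2 a = r1 a" by blast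
  let ?r3 = "r2(d := r2 d - r2 (d + 1))"
  have 3: "reach P 1 (mk (p + ?l + ?m) r2 xs) (mk (p + ?l + ?m + 1) ?r3 xs)"
    using reach_step[of "mk (p + ?l + ?m) r2 xs" P] Minus.prems by (simp add: add.assoc)
  have "d < W" using Minus.prems(3) by (induction e1 arbitrary: d) auto
  then have "rel s ?r3" using rel_temp[OF r2(3)] Minus.prems by simp
  moreover have "?r3 d = aval e1 s - aval e2 s" "\<forall>a<d. ?r3 a = r a" using r1 r2 by simp_all
  ultimately show ?case
    using reach_trans[OF reach_trans[OF r1(1) r2(1)] 3]
    by (intro exI[of _ ?r3]) (simp add: add.assoc del: fun_upd_apply)
qed

lemma wf_aexp_less: "wf_aexp d e \<Longrightarrow> d + 1 < W"
  by (induction e arbitrary: d) auto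

lemma sem_one: "wf_com c \<Longrightarrow> fst (sem n c st) 1 = fst st 1"
  using sem_unassigned wf_com_assigned by blast

text \<open>Compiled loops compare their counter with register 1, while \<open>sem\<close> takes the
  number of rounds as a parameter; the assumption on column 1 ties the two together.\<close>

theorem reach_ccom:
  assumes "code_at P p (ccom p c)" "rel s r" "wf_com c" "s 1 0 = n"
  shows "\<exists>r'. reach P (cost c n) (mk p r xs)
           (mk (p + length (ccom p c)) r' (snd (sem n c (s, xs)))) \<and>
         rel (fst (sem n c (s, xs))) r'"
  using assms
proof (induction c arbitrary: p s r xs)
  case Skip
  have "reach P 0 (mk p r xs) (mk p r xs)" by simp
  then show ?case using Skip.prems(2) by (intro exI[of _ r]) simp
next
  case (Assign c e1 e2)
  let ?l = "length (caexp K e1)" and ?m = "length (caddr c K)" and ?k = "length (caexp (K + 2) e2)"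
  have W: "K + 2 < W" using Assign.prems wf_aexp_less[of "K + 2" e2] by auto
  obtain r1 where r1: "reach P ?l (mk p r xs) (mk (p + ?l) r1 xs)"
    "r1 K = aval e1 s" "rel s r1"
    using reach_caexp[of P p K e1 s r xs] Assign.prems by auto
  let ?r2 = "r1(K + 1 := W * r1 K + c)"
  have 2: "reach P ?m (mk (p + ?l) r1 xs) (mk (p + ?l + ?m) ?r2 xs)"
    using Assign.prems by (intro reach_caddr) simp
  have rel2: "rel s ?r2" using rel_temp[OF r1(3)] W by simp
  obtain r3 where r3: "reach P ?k (mk (p + ?l + ?m) ?r2 xs) (mk (p + ?l + ?m + ?k) r3 xs)"
    "r3 (K + 2) = aval e2 s" "rel s r3" "\<forall>a<K + 2. r3 a = ?r2 a"
    using reach_caexp[of P "p + ?l + ?m" "K + 2" e2 s ?r2 xs] Assign.prems rel2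
    by (auto simp: add.assoc)
  let ?r4 = "r3(r3 (K + 1) := r3 (K + 2))"
  have 4: "reach P 1 (mk (p + ?l + ?m + ?k) r3 xs) (mk (p + ?l + ?m + ?k + 1) ?r4 xs)"
    using reach_step[of "mk (p + ?l + ?m + ?k) r3 xs" P] Assign.prems by (simp add: add.assoc)
  have "r3 (K + 1) = W * aval e1 s + c" using r3(4) r1(2) by simp
  then have "rel (upd c (aval e1 s) (aval e2 s) s) ?r4"
    using rel_upd[OF r3(3), of c "aval e1 s" "aval e2 s"] Assign.prems r3(2) W by simp
  then show ?case
    using reach_trans[OF reach_trans[OF reach_trans[OF r1(1) 2] r3(1)] 4]
    by (intro exI[of _ ?r4]) (simp add: add.assoc del: fun_upd_apply)
next
  case (Input c)
  let ?x = "case xs of [] \<Rightarrow> 0 | x # _ \<Rightarrow> x"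
  have "reach P 1 (mk p r xs) (mk (p + 1) (r(c := ?x)) (tl xs))"
    using reach_step[of "mk p r xs" P] Input.prems by simp
  moreover have "rel (upd c 0 ?x s) (r(c := ?x))"
  proof -
    have "K \<le> W" using Input.prems by simp
    then show ?thesis using rel_upd[OF Input.prems(2), of c 0 ?x] Input.prems by simp
  qed
  ultimately show ?case by (intro exI[of _ "r(c := ?x)"]) (simp del: fun_upd_apply)
next
  case (Seq c1 c2)
  let ?st = "sem n c1 (s, xs)"
  obtain r1 where r1: "reach P (cost c1 n) (mk p r xs) (mk (p + length (ccom p c1)) r1 (snd ?st))"
    "rel (fst ?st) r1"
    using Seq.IH(1)[of p s r xs] Seq.prems by auto
  have "fst ?st 1 0 = n" using Seq.prems sem_one[of c1 n "(s, xs)"] by simp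
  then obtain r2 where "reach P (cost c2 n) (mk (p + length (ccom p c1)) r1 (snd ?st))
      (mk (p + length (ccom p c1) + length (ccom (p + length (ccom p c1)) c2)) r2
        (snd (sem n c2 (fst ?st, snd ?st))))" "rel (fst (sem n c2 (fst ?st, snd ?st))) r2"
    using Seq.IH(2)[of "p + length (ccom p c1)" "fst ?st" r1 "snd ?st"] Seq.prems r1(2) by auto
  then show ?case using reach_trans[OF r1(1)] by (intro exI[of _ r2]) (simp add: add.assoc)
next
  case (Cond e c1 c2)
  define l where "l = length (caexp K e)"
  define q where "q = p + l + 1"
  define k2 where "k2 = length (ccom q c2)"
  define z where "z = q + k2 + 2"
  define k1 where "k1 = length (ccom z c1)"
  have code: "ccom p (Cond e c1 c2) = caexp K e @ [Jump K z] @ ccom q c2 @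
      [Const K 1, Jump K (z + k1)] @ ccom z c1"
    by (simp add: Let_def l_def q_def k2_def z_def k1_def add.assoc)
  have len: "p + length (ccom p (Cond e c1 c2)) = z + k1"
    unfolding code by (simp add: l_def q_def k2_def z_def k1_def)
  have at: "code_at P p (caexp K e)" "p + l < length P" "P ! (p + l) = Jump K z"
      "code_at P q (ccom q c2)" "q + k2 < length P" "P ! (q + k2) = Const K 1"
      "q + k2 + 1 < length P" "P ! (q + k2 + 1) = Jump K (z + k1)" "code_at P z (ccom z c1)"
    using Cond.prems(1) unfolding code
    by (simp_all add: l_def q_def k2_def z_def k1_def add.assoc)
  obtain r1 where r1: "reach P l (mk p r xs) (mk (p + l) r1 xs)"
    "r1 K = aval e s" "rel s r1"
    using reach_caexp[of P p K e s r xs] Cond.prems(2-3) at(1) by (auto simp: l_def)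
  have W: "K < W" using Cond.prems(3) wf_aexp_less[of K e] by simp
  have 2: "reach P 1 (mk (p + l) r1 xs) (mk (if r1 K > 0 then z else q) r1 xs)"
    using reach_step[of "mk (p + l) r1 xs" P] at(2,3) by (cases "r1 K > 0") (simp_all add: q_def)
  show ?case
  proof (cases "aval e s > 0")
    case True
    obtain r' where r': "reach P (cost c1 n) (mk z r1 xs) (mk (z + k1) r' (snd (sem n c1 (s, xs))))"
        "rel (fst (sem n c1 (s, xs))) r'"
      using Cond.IH(1)[OF at(9) r1(3)] Cond.prems by (auto simp: k1_def)
    have "reach P (l + 1 + cost c1 n) (mk p r xs) (mk (z + k1) r' (snd (sem n c1 (s, xs))))"
      using reach_trans[OF reach_trans[OF r1(1) 2]] r'(1) True r1(2) by simp
    then have "reach P (cost (Cond e c1 c2) n) (mk p r xs) (mk (z + k1) r' (snd (sem n c1 (s, xs))))"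
      by (rule reach_mono) (simp add: l_def)
    then show ?thesis unfolding len using r'(2) True by auto
  next
    case False
    let ?xs = "snd (sem n c2 (s, xs))"
    obtain r' where r': "reach P (cost c2 n) (mk q r1 xs) (mk (q + k2) r' ?xs)"
        "rel (fst (sem n c2 (s, xs))) r'"
      using Cond.IH(2)[OF at(4) r1(3)] Cond.prems by (auto simp: k2_def)
    let ?r = "r'(K := 1)"
    have 3: "reach P 1 (mk (q + k2) r' ?xs) (mk (q + k2 + 1) ?r ?xs)"
      using reach_step[of "mk (q + k2) r' ?xs" P] at(5,6) by simp
    have 4: "reach P 1 (mk (q + k2 + 1) ?r ?xs) (mk (z + k1) ?r ?xs)"
      using reach_step[of "mk (q + k2 + 1) ?r ?xs" P] at(7,8) by simp
    have "reach P (l + 1 + cost c2 n + 1 + 1) (mk p r xs) (mk (z + k1) ?r ?xs)"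
      using reach_trans[OF reach_trans[OF reach_trans[OF reach_trans[OF r1(1) 2]]], OF _ 3 4]
        r'(1) False r1(2) by simp
    then have "reach P (cost (Cond e c1 c2) n) (mk p r xs) (mk (z + k1) ?r ?xs)"
      by (rule reach_mono) (simp add: l_def)
    then show ?thesis unfolding len using rel_temp[OF r'(2), of K 1] False W
      by (intro exI[of _ ?r]) (simp del: fun_upd_apply)
  qed
next
  case (For i c)
  define k where "k = length (ccom (p + 5) c)"
  define hd5 where "hd5 = [Const i 0, Sub K 1 i, Jump K (p + 5), Const K 1, Jump K (p + 8 + k)]"
  define tl3 where "tl3 = [Const K 1, Add i i K, Jump K (p + 1)]"
  have code: "ccom p (For i c) = hd5 @ ccom (p + 5) c @ tl3"
    by (simp add: Let_def k_def hd5_def tl3_def)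
  have l5: "length hd5 = 5" "length tl3 = 3" by (simp_all add: hd5_def tl3_def)
  have len: "p + length (ccom p (For i c)) = p + 8 + k" unfolding code by (simp add: k_def l5)
  have at0: "code_at P p hd5" "code_at P (p + 5) (ccom (p + 5) c)" "code_at P (p + 5 + k) tl3"
    using For.prems(1) unfolding code by (simp_all add: k_def l5)
  have at: "p < length P" "P ! p = Const i 0" "p + 1 < length P" "P ! (p + 1) = Sub K 1 i"
      "p + 2 < length P" "P ! (p + 2) = Jump K (p + 5)" "p + 3 < length P" "P ! (p + 3) = Const K 1"
      "p + 4 < length P" "P ! (p + 4) = Jump K (p + 8 + k)"
    using at0(1) unfolding hd5_def by (simp_all add: numeral_eq_Suc)
  have at3: "p + 5 + k < length P" "P ! (p + 5 + k) = Const K 1"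
      "p + 6 + k < length P" "P ! (p + 6 + k) = Add i i K"
      "p + 7 + k < length P" "P ! (p + 7 + k) = Jump K (p + 1)"
    using at0(3) unfolding tl3_def by (simp_all add: numeral_eq_Suc)
  have i: "i < K" "i \<noteq> 1" "K < W" "i \<notin> assigned c" "wf_com c" using For.prems(3) by auto
  define lp where "lp j = loop (\<lambda>j. apfst (upd i 0 j)) (sem n c) j (s, xs)" for j
  have lp: "lp 0 = (upd i 0 0 s, xs)" "sem n (For i c) (s, xs) = lp n"
      "lp (Suc j) = apfst (upd i 0 (Suc j)) (sem n c (lp j))" for j
    by (simp_all add: lp_def)
  have inv: "fst (lp j) i 0 = j \<and> fst (lp j) 1 0 = n" for j
  proof (induction j)
    case 0
    then show ?case using For.prems(4) i lp(1) by (simp add: upd_apply)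
  next
    case (Suc j)
    then show ?case using sem_one[OF i(5), of n "lp j"] i lp(3) by (simp add: upd_apply)
  qed
  \<comment> \<open>After \<open>j\<close> rounds control is back at the test, at position
    \<open>p + 1\<close>.\<close>
  have iter: "\<exists>r'. reach P (1 + j * (cost c n + 5)) (mk p r xs) (mk (p + 1) r' (snd (lp j))) \<and>
      rel (fst (lp j)) r'" if "j \<le> n" for j
    using that
  proof (induction j)
    case 0
    have "reach P 1 (mk p r xs) (mk (p + 1) (r(i := 0)) xs)"
      using reach_step[of "mk p r xs" P] at by simp
    moreover have "rel (upd i 0 0 s) (r(i := 0))"
      using rel_upd[OF For.prems(2), of i 0 0] i by simp
    ultimately show ?case by (intro exI[of _ "r(i := 0)"]) (simp add: lp(1) del: fun_upd_apply)
  next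
    case (Suc j)
    then obtain r0 where r0: "reach P (1 + j * (cost c n + 5)) (mk p r xs) (mk (p + 1) r0 (snd (lp j)))"
        "rel (fst (lp j)) r0" by auto
    let ?s = "fst (lp j)" and ?xs = "snd (lp j)"
    have v: "r0 i = j" "r0 1 = n"
      using r0(2) inv[of j] i K unfolding rel_def by (metis add_0 mult_0_right)+
    let ?r1 = "r0(K := n - j)"
    have 1: "reach P 1 (mk (p + 1) r0 ?xs) (mk (p + 2) ?r1 ?xs)"
      using reach_step[of "mk (p + 1) r0 ?xs" P] at v by simp
    have 2: "reach P 1 (mk (p + 2) ?r1 ?xs) (mk (p + 5) ?r1 ?xs)"
      using reach_step[of "mk (p + 2) ?r1 ?xs" P] at Suc.prems by simp
    have rel1: "rel ?s ?r1" using rel_temp[OF r0(2)] i by simp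
    let ?xs' = "snd (sem n c (lp j))"
    obtain r2 where r2: "reach P (cost c n) (mk (p + 5) ?r1 ?xs) (mk (p + 5 + k) r2 ?xs')"
        "rel (fst (sem n c (lp j))) r2"
      using For.IH[OF at0(2) rel1 i(5), of ?xs] inv[of j] unfolding k_def prod.collapse by blast
    have r2i: "r2 i = j"
      using r2(2) sem_unassigned[OF i(4), of n "lp j"] inv[of j] i unfolding rel_def
      by (metis add_0 mult_0_right)
    let ?r3 = "r2(K := 1)" and ?r4 = "r2(K := 1, i := Suc j)"
    have 3: "reach P 1 (mk (p + 5 + k) r2 ?xs') (mk (p + 6 + k) ?r3 ?xs')"
      using reach_step[of "mk (p + 5 + k) r2 ?xs'" P] at3 by (simp add: ac_simps)
    have 4: "reach P 1 (mk (p + 6 + k) ?r3 ?xs') (mk (p + 7 + k) ?r4 ?xs')"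
      using reach_step[of "mk (p + 6 + k) ?r3 ?xs'" P] at3 r2i i by (simp add: ac_simps)
    have 5: "reach P 1 (mk (p + 7 + k) ?r4 ?xs') (mk (p + 1) ?r4 ?xs')"
      using reach_step[of "mk (p + 7 + k) ?r4 ?xs'" P] at3 i by (simp add: ac_simps)
    have "rel (upd i 0 (Suc j) (fst (sem n c (lp j)))) ?r4"
      using rel_upd[OF rel_temp[OF r2(2), of K 1], of i 0 "Suc j"] i by simp
    moreover have "reach P (1 + Suc j * (cost c n + 5)) (mk p r xs) (mk (p + 1) ?r4 ?xs')"
      by (rule reach_mono[OF reach_trans[OF reach_trans[OF reach_trans[OF reach_trans[OF reach_trans[OF
            reach_trans[OF r0(1) 1] 2] r2(1)] 3] 4] 5]]) simp
    ultimately show ?case unfolding lp(3) snd_apfst fst_apfst by (intro exI[of _ ?r4] conjI)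
  qed
  obtain r0 where r0: "reach P (1 + n * (cost c n + 5)) (mk p r xs) (mk (p + 1) r0 (snd (lp n)))"
      "rel (fst (lp n)) r0" using iter[of n] by auto
  let ?xs = "snd (lp n)"
  have v: "r0 i = n" "r0 1 = n"
    using r0(2) inv[of n] i K unfolding rel_def by (metis add_0 mult_0_right)+
  let ?r1 = "r0(K := 0)" and ?r2 = "r0(K := 1)"
  have 1: "reach P 1 (mk (p + 1) r0 ?xs) (mk (p + 2) ?r1 ?xs)"
    using reach_step[of "mk (p + 1) r0 ?xs" P] at v by (simp add: numeral_eq_Suc)
  have 2: "reach P 1 (mk (p + 2) ?r1 ?xs) (mk (p + 3) ?r1 ?xs)"
    using reach_step[of "mk (p + 2) ?r1 ?xs" P] at by (simp add: numeral_eq_Suc)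
  have 3: "reach P 1 (mk (p + 3) ?r1 ?xs) (mk (p + 4) ?r2 ?xs)"
    using reach_step[of "mk (p + 3) ?r1 ?xs" P] at by (simp add: numeral_eq_Suc)
  have 4: "reach P 1 (mk (p + 4) ?r2 ?xs) (mk (p + 8 + k) ?r2 ?xs)"
    using reach_step[of "mk (p + 4) ?r2 ?xs" P] at by (simp add: numeral_eq_Suc)
  have "reach P (cost (For i c) n) (mk p r xs) (mk (p + 8 + k) ?r2 ?xs)"
    by (rule reach_mono[OF reach_trans[OF reach_trans[OF reach_trans[OF reach_trans[OF r0(1) 1] 2] 3] 4]])
      simp
  moreover have "rel (fst (lp n)) ?r2" using rel_temp[OF r0(2)] i by simp
  ultimately show ?case unfolding len lp(2) by (intro exI[of _ ?r2] conjI)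
qed

text \<open>\<open>Read 1\<close> moves the first input number, which is the number of vertices in a
  graph code, to the place where all loops look for their bound. All other registers are 0, which
  the program relies on for its uninitialised columns.\<close>

theorem computes_within_ccom:
  assumes "wf_com c" "K < W"
  shows "computes_within (Read 1 # ccom 1 c) (n # xs)
    (fst (sem n c (upd 1 0 n (\<lambda>_ _. 0), xs)) 0 0) (cost c n + 1)"
proof -
  let ?P = "Read 1 # ccom 1 c" and ?s = "upd 1 0 n (\<lambda>_ _. 0)"
  let ?r = "(\<lambda>_. 0)(1 := n)"
  have "reach ?P 1 (init (n # xs)) (mk 1 ?r xs)"
    using reach_step[of "init (n # xs)" ?P] by (simp add: init_def)
  moreover have "rel ?s ?r"
    using rel_upd[of "\<lambda>_ _. 0" "\<lambda>_. 0" 1 0 n] assms(2) K by (simp add: rel_def)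
  then obtain r' where r': "reach ?P (cost c n) (mk 1 ?r xs)
      (mk (1 + length (ccom 1 c)) r' (snd (sem n c (?s, xs))))" "rel (fst (sem n c (?s, xs))) r'"
    using reach_ccom[of ?P 1 c ?s ?r n xs] assms(1) by (auto simp: code_at_def upd_def)
  ultimately have "reach ?P (1 + cost c n) (init (n # xs))
      (mk (1 + length (ccom 1 c)) r' (snd (sem n c (?s, xs))))"
    using reach_trans by blast
  then obtain t where t: "t \<le> 1 + cost c n"
    "(step ?P ^^ t) (init (n # xs)) = mk (1 + length (ccom 1 c)) r' (snd (sem n c (?s, xs)))"
    by (auto simp: reach_def)
  moreover have "r' 0 = fst (sem n c (?s, xs)) 0 0"
    using r'(2) K unfolding rel_def by (metis add_0 mult_0_right not_less_zero less_trans zero_less_one)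
  ultimately show ?thesis unfolding computes_within_def
    by (intro exI[of _ t]) (simp add: halted_def)
qed

end

section \<open>The algorithm\<close>

text \<open>
  Memory columns of the program. \<open>DEG\<close>, \<open>EA\<close>, \<open>EB\<close>: degree and last two neighbours of a vertex;
  \<open>LS\<close>: classes of the relation generated by having a common neighbour; \<open>BD\<close>: classes with a vertex
  of degree other than 2; \<open>IE\<close>: vertices in the role of edges; \<open>LC\<close>: components; \<open>TR\<close>: the spanning
  forest; \<open>LT\<close>: components of the forest without one edge; \<open>PA\<close>: parity of \<open>sep\<close> for the non-forest
  edges; \<open>BA\<close>: the predicate \<open>bad\<close>.
\<close>

abbreviation (input) "cX \<equiv> 2 :: nat"
abbreviation (input) "cI \<equiv> 3 :: nat"
abbreviation (input) "cJ \<equiv> 4 :: nat"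
abbreviation (input) "cM \<equiv> 5 :: nat"
abbreviation (input) "cP \<equiv> 6 :: nat"
abbreviation (input) "cQ \<equiv> 7 :: nat"
abbreviation (input) "DEG \<equiv> 8 :: nat"
abbreviation (input) "EA \<equiv> 9 :: nat"
abbreviation (input) "EB \<equiv> 10 :: nat"
abbreviation (input) "LS \<equiv> 11 :: nat"
abbreviation (input) "BD \<equiv> 12 :: nat"
abbreviation (input) "IE \<equiv> 13 :: nat"
abbreviation (input) "LC \<equiv> 14 :: nat"
abbreviation (input) "TR \<equiv> 15 :: nat"
abbreviation (input) "LT \<equiv> 16 :: nat"
abbreviation (input) "PA \<equiv> 17 :: nat"
abbreviation (input) "BA \<equiv> 18 :: nat"
abbreviation (input) "CNT \<equiv> 19 :: nat"

abbreviation (input) scal :: "nat \<Rightarrow> aexp" where "scal c \<equiv> Cell c (Num 0)"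
abbreviation (input) arr :: "nat \<Rightarrow> nat \<Rightarrow> aexp" where "arr c i \<equiv> Cell c (scal i)"

declare sem.simps(6) [simp del]

text \<open>Under truncated subtraction the sum of both differences is 0 exactly on equality; hence
  the exchanged branches.\<close>

definition IfEq :: "aexp \<Rightarrow> aexp \<Rightarrow> com \<Rightarrow> com \<Rightarrow> com" where
  "IfEq e1 e2 c1 c2 = Cond (Plus (Minus e1 e2) (Minus e2 e1)) c2 c1"

lemma sem_IfEq [simp]:
  "sem n (IfEq e1 e2 c1 c2) st =
     (if aval e1 (fst st) = aval e2 (fst st) then sem n c1 st else sem n c2 st)"
  by (auto simp: IfEq_def)

lemma assigned_IfEq [simp]: "assigned (IfEq e1 e2 c1 c2) = assigned c1 \<union> assigned c2"
  by (auto simp: IfEq_def)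

text \<open>The invariant must survive rewriting of the counter cell (\<open>stable\<close>). In
  return, each step knows the value of the counter and that columns not assigned in the loop still
  have their initial content.\<close>

lemma For_rule:
  assumes base: "I 0 st"
    and step: "\<And>j st'. j < n \<Longrightarrow> I j st' \<Longrightarrow> fst st' i 0 = j \<Longrightarrow>
      (\<And>x. x \<notin> assigned (For i c) \<Longrightarrow> fst st' x = fst st x) \<Longrightarrow> I (Suc j) (sem n c st')"
    and stable: "\<And>j k st'. I j st' \<Longrightarrow> I j (apfst (upd i 0 k) st')"
  shows "I n (sem n (For i c) st)"
proof -
  define lp where "lp j = loop (\<lambda>j. apfst (upd i 0 j)) (sem n c) j st" for j
  have lp: "lp 0 = apfst (upd i 0 0) st" "lp (Suc j) = apfst (upd i 0 (Suc j)) (sem n c (lp j))" for j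
    by (simp_all add: lp_def)
  have "j \<le> n \<Longrightarrow> I j (lp j) \<and> fst (lp j) i 0 = j \<and>
      (\<forall>x. x \<notin> assigned (For i c) \<longrightarrow> fst (lp j) x = fst st x)" for j
  proof (induction j)
    case 0
    then show ?case using base stable by (simp add: lp upd_apply)
  next
    case (Suc j)
    then have "I (Suc j) (sem n c (lp j))" by (intro step) auto
    then show ?case
      using Suc stable by (simp add: lp upd_apply sem_unassigned)
  qed
  then show ?thesis by (simp add: lp_def sem.simps(6))
qed

fun input_free :: "com \<Rightarrow> bool" where
  "input_free (Input c) \<longleftrightarrow> False"
| "input_free (c1 ;; c2) \<longleftrightarrow> input_free c1 \<and> input_free c2"
| "input_free (Cond e c1 c2) \<longleftrightarrow> input_free c1 \<and> input_free c2"
| "input_free (For i c) \<longleftrightarrow> input_free c"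
| "input_free _ \<longleftrightarrow> True"

lemma sem_input_free: "input_free c \<Longrightarrow> snd (sem n c st) = snd st"
proof (induction c arbitrary: st)
  case (For i c)
  then have "snd (loop (\<lambda>j. apfst (upd i 0 j)) (sem n c) m st) = snd st" for m
    by (induction m) auto
  then show ?case by (simp add: sem.simps(6))
qed auto

subsection \<open>Union-find by relabelling\<close>

text \<open>Both labels are copied to scalars first, since the loop overwrites the cells they come
  from.\<close>

definition merge_com :: "nat \<Rightarrow> aexp \<Rightarrow> aexp \<Rightarrow> com" where
  "merge_com l e1 e2 =
     Assign cP (Num 0) (Cell l e1) ;; Assign cQ (Num 0) (Cell l e2) ;;
     For cM (IfEq (arr l cM) (scal cQ) (Assign l (scal cM) (scal cP)) Skip)"

lemma assigned_merge_com [simp]: "assigned (merge_com l e1 e2) = {cP, cQ, cM, l}"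
  by (auto simp: merge_com_def)

lemma input_free_merge_com [simp]: "input_free (merge_com l e1 e2)"
  by (simp add: merge_com_def IfEq_def)

text \<open>The second expression is evaluated after \<open>cP\<close> has been written, hence its
  assumption for every value there.\<close>

lemma sem_merge_com:
  assumes l: "l \<noteq> cP" "l \<noteq> cQ" "l \<noteq> cM"
    and e: "aval e1 (fst st) = i" "\<And>x. aval e2 (upd cP 0 x (fst st)) = j"
  shows "fst (sem n (merge_com l e1 e2) st) l =
    (\<lambda>v. if v < n then merge (fst st l) i j v else fst st l v)"
proof -
  let ?st = "apfst (\<lambda>s. upd cQ 0 (s l (aval e2 s)) s) (apfst (\<lambda>s. upd cP 0 (s l (aval e1 s)) s) st)"
  let ?c = "IfEq (arr l cM) (scal cQ) (Assign l (scal cM) (scal cP)) Skip"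
  let ?I = "\<lambda>k (st' :: store \<times> nat list). fst st' l = (\<lambda>v. if v < k then merge (fst st l) i j v else fst st l v)"
  have "?I n (sem n (For cM ?c) ?st)"
  proof (rule For_rule[where I = ?I])
    show "?I 0 ?st" using l by (simp add: upd_apply)
  next
    fix k st' assume k: "k < n" "?I k st'" "fst st' cM 0 = k"
      and fr: "\<And>x. x \<notin> assigned (For cM ?c) \<Longrightarrow> fst st' x = fst ?st x"
    have "fst st' cP 0 = fst st l i" "fst st' cQ 0 = fst st l j"
      using fr[of cP] fr[of cQ] l e by (simp_all add: upd_apply)
    then show "?I (Suc k) (sem n ?c st')"
      using k l by (auto simp: upd_apply merge_def fun_eq_iff less_Suc_eq)
  next
    fix k m st' assume "?I k st'"
    then show "?I k (apfst (upd cM 0 m) st')" using l by (simp add: upd_apply)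
  qed
  then show ?thesis by (simp add: merge_com_def)
qed

definition init_com :: "nat \<Rightarrow> com" where
  "init_com l = For cM (Assign l (scal cM) (scal cM))"

lemma assigned_init_com [simp]: "assigned (init_com l) = {cM, l}"
  by (auto simp: init_com_def)

lemma input_free_init_com [simp]: "input_free (init_com l)"
  by (simp add: init_com_def)

lemma sem_init_com:
  assumes "l \<noteq> cM" "v < n"
  shows "fst (sem n (init_com l) st) l v = v"
proof -
  let ?I = "\<lambda>k (st' :: store \<times> nat list). \<forall>v<k. fst st' l v = v"
  have "?I n (sem n (For cM (Assign l (scal cM) (scal cM))) st)"
    by (rule For_rule[where I = ?I]) (use assms(1) in \<open>auto simp: upd_apply less_Suc_eq\<close>)
  then show ?thesis using assms(2) by (simp add: init_com_def)
qed

subsection \<open>Reading the graph\<close>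

text \<open>Two neighbours of one vertex lie on the same side of the bipartition. Merging each new
  neighbour with the preceding one puts them all into one class. For a vertex of degree 2, the two
  remembered neighbours are all there are.\<close>

definition read_entry :: com where
  "read_entry =
     Cond (arr DEG cI) (merge_com LS (arr EA cI) (scal cJ)) Skip ;;
     Assign EB (scal cI) (arr EA cI) ;;
     Assign EA (scal cI) (scal cJ) ;;
     Assign DEG (scal cI) (Plus (arr DEG cI) (Num 1))"

definition read_com :: com where
  "read_com = For cI (For cJ (Input cX ;; Cond (scal cX) read_entry Skip))"

text \<open>\<open>E0\<close> is the promised set of subdividing vertices. It is a witness for the
  proofs only: the program has no access to it and need not recover it.\<close>

locale half_graph =
  fixes n :: nat and adj :: "nat \<Rightarrow> nat \<Rightarrow> bool" and E0 :: "nat set"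
  assumes adj_sym: "adj u v \<Longrightarrow> adj v u"
    and E0_adj: "u < n \<Longrightarrow> v < n \<Longrightarrow> adj u v \<Longrightarrow> v \<in> E0 \<longleftrightarrow> u \<notin> E0"
    and E0_card: "u < n \<Longrightarrow> u \<in> E0 \<Longrightarrow> card {v. v < n \<and> adj u v} = 2"
begin

definition nb :: "nat \<Rightarrow> nat \<Rightarrow> nat set" where
  "nb z j = {u. u < j \<and> adj z u}"

definition row :: "nat \<Rightarrow> nat list" where
  "row z = map (\<lambda>u. if adj z u then 1 else 0) [0..<n]"

definition rows :: "nat \<Rightarrow> nat list" where
  "rows z = concat (map row [z..<n])"

definition row_ok :: "nat \<Rightarrow> nat \<Rightarrow> store \<Rightarrow> bool" where
  "row_ok z j s \<longleftrightarrow> s DEG z = card (nb z j) \<and>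
     (nb z j \<noteq> {} \<longrightarrow> s EA z \<in> nb z j) \<and>
     (2 \<le> card (nb z j) \<longrightarrow> s EB z \<in> nb z j \<and> s EB z \<noteq> s EA z) \<and>
     (\<forall>u\<in>nb z j. \<forall>v\<in>nb z j. s LS u = s LS v)"

text \<open>The classes may be finer than the two sides, but never mix them; in particular adjacent
  vertices have different labels.\<close>

definition sound :: "store \<Rightarrow> bool" where
  "sound s \<longleftrightarrow> (\<forall>u<n. \<forall>v<n. s LS u = s LS v \<longrightarrow> (u \<in> E0 \<longleftrightarrow> v \<in> E0))"

definition read_inv :: "nat \<Rightarrow> nat \<Rightarrow> store \<Rightarrow> bool" where
  "read_inv z j s \<longleftrightarrow> (\<forall>z'<z. row_ok z' n s) \<and> (z < n \<longrightarrow> row_ok z j s) \<and>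
     (\<forall>z'. z < z' \<longrightarrow> s DEG z' = 0) \<and> sound s"

lemma finite_nb [simp]: "finite (nb z j)"
  by (simp add: nb_def)

lemma nb_Suc: "nb z (Suc j) = (if adj z j then insert j (nb z j) else nb z j)"
  by (auto simp: nb_def less_Suc_eq)

lemma nb_0 [simp]: "nb z 0 = {}"
  by (simp add: nb_def)

lemma j_notin_nb [simp]: "j \<notin> nb z j"
  by (simp add: nb_def)

lemma read_inv_cong:
  assumes "read_inv z j s" "\<And>c. c \<in> {DEG, EA, EB, LS} \<Longrightarrow> s' c = s c"
  shows "read_inv z j s'"
proof -
  have eqs: "s' DEG = s DEG" "s' EA = s EA" "s' EB = s EB" "s' LS = s LS" by (rule assms(2), simp)+
  show ?thesis using assms(1) unfolding read_inv_def row_ok_def sound_def eqs .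
qed

lemma read_inv_upd: "c \<notin> {DEG, EA, EB, LS} \<Longrightarrow> read_inv z j s \<Longrightarrow> read_inv z j (upd c i x s)"
  by (rule read_inv_cong[of z j s]) (auto simp: upd_apply)

lemma row_ok_0: "row_ok z 0 s \<longleftrightarrow> s DEG z = 0"
  by (simp add: row_ok_def)

lemma row_ok_cong: "nb z j = nb z j' \<Longrightarrow> row_ok z j s \<longleftrightarrow> row_ok z j' s"
  by (simp add: row_ok_def)

lemma read_inv_next: "read_inv z n s \<Longrightarrow> z < n \<Longrightarrow> read_inv (Suc z) 0 s"
  by (auto simp: read_inv_def row_ok_0 less_Suc_eq)

lemma read_entry_inv:
  assumes inv: "read_inv z j s" and z: "z < n" and j: "j < n" and adj: "adj z j"
    and IJ: "s cI 0 = z" "s cJ 0 = j"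
  shows "read_inv z (Suc j) (fst (sem n read_entry (s, xs)))"
proof -
  define s1 where "s1 = fst (sem n (Cond (arr DEG cI) (merge_com LS (arr EA cI) (scal cJ)) Skip) (s, xs))"
  have fr: "s1 c = s c" if "c \<notin> {cP, cQ, cM, LS}" for c
    unfolding s1_def using that by (subst sem_unassigned) auto
  have ok: "row_ok z j s" using inv z by (simp add: read_inv_def)
  have LS1: "s1 LS v = (if s DEG z > 0 \<and> v < n then merge (s LS) (s EA z) j v else s LS v)" for v
  proof (cases "s DEG z > 0")
    case True
    have "fst (sem n (merge_com LS (arr EA cI) (scal cJ)) (s, xs)) LS =
        (\<lambda>v. if v < n then merge (fst (s, xs) LS) (s EA z) j v else fst (s, xs) LS v)"
      by (rule sem_merge_com) (simp_all add: IJ upd_apply)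
    then show ?thesis unfolding s1_def using True IJ by simp
  next
    case False
    then show ?thesis unfolding s1_def using IJ by simp
  qed
  define s2 where "s2 = fst (sem n read_entry (s, xs))"
  have s2: "s2 = upd DEG z (s DEG z + 1) (upd EA z j (upd EB z (s EA z) s1))"
    unfolding s2_def read_entry_def sem.simps(4) sem.simps(2) s1_def[symmetric] fst_apfst
    by (simp add: fr IJ upd_apply)
  have EAn: "s EA z < n \<and> adj z (s EA z)" if "s DEG z > 0"
  proof -
    have "nb z j \<noteq> {}" using ok that by (auto simp: row_ok_def)
    then have "s EA z \<in> nb z j" using ok by (simp add: row_ok_def)
    then show ?thesis using j by (simp add: nb_def)
  qed
  have coarse: "s1 LS u = s1 LS v" if "s LS u = s LS v" "u < n" "v < n" for u v
    using that by (simp add: LS1 merge_def)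
  have row: "row_ok z' n s2" if "z' < z" for z'
  proof -
    have eqs: "s2 DEG z' = s DEG z'" "s2 EA z' = s EA z'" "s2 EB z' = s EB z'" "s2 LS = s1 LS"
      using that by (simp_all add: s2 upd_apply fr)
    have ok': "row_ok z' n s" using inv that by (simp add: read_inv_def)
    have "s1 LS u = s1 LS v" if "u \<in> nb z' n" "v \<in> nb z' n" for u v
    proof (rule coarse)
      show "s LS u = s LS v" using ok' that unfolding row_ok_def by blast
      show "u < n" "v < n" using that by (simp_all add: nb_def)
    qed
    then show ?thesis using ok' unfolding row_ok_def eqs by blast
  qed
  have "row_ok z (Suc j) s2"
  proof -
    have nb': "nb z (Suc j) = insert j (nb z j)" using adj by (simp add: nb_Suc)
    have D: "s DEG z = card (nb z j)" using ok by (simp add: row_ok_def)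
    have L: "s1 LS u = s1 LS v" if "u \<in> nb z (Suc j)" "v \<in> nb z (Suc j)" for u v
    proof -
      have 1: "s1 LS u = s1 LS v" if "u \<in> nb z j" "v \<in> nb z j" for u v
      proof (rule coarse)
        show "s LS u = s LS v" using ok that unfolding row_ok_def by blast
        show "u < n" "v < n" using that j by (simp_all add: nb_def)
      qed
      \<comment> \<open>The earlier neighbours already share a label, so merging \<open>j\<close>
        with the last of them merges it with all.\<close>
      have 2: "s1 LS u = s1 LS j" if u: "u \<in> nb z j" for u
      proof -
        have "s DEG z > 0" using u D card_gt_0_iff by fastforce
        moreover have "s EA z \<in> nb z j" using ok u by (auto simp: row_ok_def)
        ultimately have "s1 LS (s EA z) = s1 LS j" using j EAn by (simp add: LS1 merge_def)
        then show ?thesis using 1[OF u \<open>s EA z \<in> nb z j\<close>] by simp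
      qed
      show ?thesis using that 1 2 unfolding nb' by (metis insertE)
    qed
    have eqs: "s2 DEG z = s DEG z + 1" "s2 EA z = j" "s2 EB z = s EA z" "s2 LS = s1 LS"
      by (simp_all add: s2 upd_apply fr)
    have "s EA z \<in> nb z j" if "2 \<le> card (nb z (Suc j))"
    proof -
      have "nb z j \<noteq> {}" using that by (auto simp: nb')
      then show ?thesis using ok by (simp add: row_ok_def)
    qed
    moreover have "s EA z \<noteq> j" if "s EA z \<in> nb z j" using that by auto
    moreover have "card (nb z (Suc j)) = card (nb z j) + 1" by (simp add: nb')
    ultimately have "2 \<le> card (nb z (Suc j)) \<Longrightarrow> s EA z \<in> nb z (Suc j) \<and> s EA z \<noteq> j"
        "s DEG z + 1 = card (nb z (Suc j))" "j \<in> nb z (Suc j)"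
      using D unfolding nb' by simp_all
    then show ?thesis unfolding row_ok_def eqs using L by blast
  qed
  moreover have "sound s2"
  proof -
    have s: "sound s" using inv by (simp add: read_inv_def)
    have "s EA z \<in> E0 \<longleftrightarrow> j \<in> E0" if "s DEG z > 0"
      using EAn[OF that] E0_adj[OF z] j adj by blast
    \<comment> \<open>Every new label is an old label of some vertex on the same side, so two
      vertices that agree now are compared through their old labels.\<close>
    then have rep: "\<exists>w'<n. s1 LS w = s LS w' \<and> (w \<in> E0 \<longleftrightarrow> w' \<in> E0)" if w: "w < n" for w
    proof (cases "s DEG z > 0 \<and> s LS w = s LS j")
      case True
      then have "w \<in> E0 \<longleftrightarrow> j \<in> E0" using s[unfolded sound_def, rule_format, OF w j] by blast
      then show ?thesis
        using True w EAn \<open>s DEG z > 0 \<Longrightarrow> s EA z \<in> E0 \<longleftrightarrow> j \<in> E0\<close>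
        by (intro exI[of _ "s EA z"]) (simp add: LS1 merge_def)
    next
      case False
      then have "s1 LS w = s LS w" by (cases "s DEG z > 0") (simp_all add: LS1 merge_def)
      then show ?thesis using w by (intro exI[of _ w] conjI) simp_all
    qed
    have "u \<in> E0 \<longleftrightarrow> v \<in> E0" if "u < n" "v < n" "s1 LS u = s1 LS v" for u v
      using rep[OF that(1)] rep[OF that(2)] that(3) s unfolding sound_def by metis
    moreover have "s2 LS = s1 LS" by (simp add: s2 upd_apply)
    ultimately show ?thesis unfolding sound_def by (simp only:) blast
  qed
  moreover have "\<forall>z'>z. s2 DEG z' = 0" using inv by (simp add: read_inv_def s2 upd_apply fr)
  ultimately show ?thesis using row s2_def by (simp add: read_inv_def)
qed

lemma read_row:
  assumes inv: "read_inv z 0 (fst st)" and z: "z < n" and I: "fst st cI 0 = z"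
    and xs: "snd st = row z @ ys"
  shows "read_inv z n (fst (sem n (For cJ (Input cX ;; Cond (scal cX) read_entry Skip)) st)) \<and>
    snd (sem n (For cJ (Input cX ;; Cond (scal cX) read_entry Skip)) st) = ys"
proof -
  let ?c = "Input cX ;; Cond (scal cX) read_entry Skip"
  let ?I = "\<lambda>j (st' :: store \<times> nat list). read_inv z j (fst st') \<and> snd st' = drop j (row z) @ ys"
  have len: "length (row z) = n" by (simp add: row_def)
  have free: "input_free read_entry" by (simp add: read_entry_def)
  have asg: "assigned read_entry = {cP, cQ, cM, LS, EB, EA, DEG}"
    by (auto simp: read_entry_def)
  have "?I n (sem n (For cJ ?c) st)"
  proof (rule For_rule[where I = ?I])
    show "?I 0 st" using inv xs by simp
  next
    fix j st' assume j: "j < n" "?I j st'" "fst st' cJ 0 = j"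
      and fr: "\<And>x. x \<notin> assigned (For cJ ?c) \<Longrightarrow> fst st' x = fst st x"
    obtain s xs' where st': "st' = (s, xs')" by (cases st')
    have hd: "drop j (row z) = (if adj z j then 1 else 0) # drop (Suc j) (row z)"
    proof -
      have "drop j (row z) = row z ! j # drop (Suc j) (row z)"
        using j(1) len by (simp add: Cons_nth_drop_Suc)
      then show ?thesis using j(1) by (simp add: row_def)
    qed
    let ?s = "upd cX 0 (if adj z j then 1 else 0) s"
    have step: "sem n (Input cX) st' = (?s, drop (Suc j) (row z) @ ys)"
      using j(2) by (simp add: st' hd)
    have inv': "read_inv z j ?s"
      by (rule read_inv_upd) (use j(2) in \<open>simp_all add: st'\<close>)
    show "?I (Suc j) (sem n ?c st')"
    proof (cases "adj z j")
      case True
      have "s cI 0 = z" using fr[of cI] I by (simp add: asg st')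
      then have "read_inv z (Suc j) (fst (sem n read_entry (?s, drop (Suc j) (row z) @ ys)))"
        using j st' by (intro read_entry_inv[OF inv' z j(1) True]) (simp_all add: upd_apply)
      then show ?thesis using True step sem_input_free[OF free] by (simp add: upd_apply)
    next
      case False
      have "row_ok z (Suc j) ?s = row_ok z j ?s" using False by (intro row_ok_cong) (simp add: nb_Suc)
      then have "read_inv z (Suc j) ?s" using inv' by (simp add: read_inv_def)
      then show ?thesis using False step by (simp add: upd_apply)
    qed
  next
    fix j k st' assume "?I j st'"
    then show "?I j (apfst (upd cJ 0 k) st')"
      by (simp add: read_inv_upd)
  qed
  then show ?thesis using len by simp
qed

lemma read_com:
  assumes "\<And>v. v < n \<Longrightarrow> fst st LS v = v" "\<And>v. fst st DEG v = 0" and xs: "snd st = rows 0"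
  defines "s' \<equiv> fst (sem n read_com st)"
  shows "\<And>z. z < n \<Longrightarrow> row_ok z n s'" "sound s'"
proof -
  let ?c = "For cJ (Input cX ;; Cond (scal cX) read_entry Skip)"
  let ?I = "\<lambda>z (st' :: store \<times> nat list). read_inv z 0 (fst st') \<and> snd st' = rows z"
  have "?I n (sem n (For cI ?c) st)"
  proof (rule For_rule[where I = ?I])
    show "?I 0 st" using assms(1-3) by (auto simp: read_inv_def row_ok_0 sound_def)
  next
    fix z st' assume z: "z < n" "?I z st'" "fst st' cI 0 = z"
      and fr: "\<And>x. x \<notin> assigned (For cI ?c) \<Longrightarrow> fst st' x = fst st x"
    have "rows z = row z @ rows (Suc z)" using z(1) by (simp add: rows_def upt_conv_Cons)
    then have "read_inv z n (fst (sem n ?c st')) \<and> snd (sem n ?c st') = rows (Suc z)"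
      using z by (intro read_row) auto
    then show "?I (Suc z) (sem n ?c st')"
      using z(1) read_inv_next by blast
  next
    fix j k st' assume "?I j st'"
    then show "?I j (apfst (upd cI 0 k) st')"
      by (simp add: read_inv_upd)
  qed
  then have "read_inv n 0 s'" by (simp add: s'_def read_com_def)
  then show "\<And>z. z < n \<Longrightarrow> row_ok z n s'" "sound s'" by (simp_all add: read_inv_def)
qed

end

text \<open>All neighbours of a vertex share a label, so \<open>EA\<close> suffices to find the
  opposite class. The sum acts as a disjunction, and its truncated difference is positive iff the
  own label is the smaller one. An isolated vertex has degree 0, so its own class is marked and the
  default content of \<open>EA\<close> is never consulted.\<close>

definition classify_com :: com where
  "classify_com =
     For cI (IfEq (arr DEG cI) (Num 2) Skip (Assign BD (arr LS cI) (Num 1))) ;;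
     For cI (Cond (Cell BD (arr LS cI)) Skip
       (Cond (Plus (Cell BD (Cell LS (arr EA cI))) (Minus (Cell LS (arr EA cI)) (arr LS cI)))
         (Assign IE (scal cI) (Num 1)) Skip))"

lemma assigned_classify_com [simp]: "assigned classify_com = {cI, BD, IE}"
  by (auto simp: classify_com_def)

text \<open>
  In every component one side consists of vertices of degree 2. If both sides do, the component is
  a cycle and either side may play the role of the edges, so the class with the smaller label is
  taken.
\<close>

lemma (in half_graph) classify_com:
  assumes rows: "\<And>z. z < n \<Longrightarrow> row_ok z n (fst st)" and sound: "sound (fst st)"
    and zero: "\<And>c. fst st BD c = 0" "\<And>z. fst st IE z = 0"
  defines "E \<equiv> {z. fst (sem n classify_com st) IE z > 0}"
  shows "E \<subseteq> {..<n}"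
    and "\<And>u v. u < n \<Longrightarrow> v < n \<Longrightarrow> adj u v \<Longrightarrow> v \<in> E \<longleftrightarrow> u \<notin> E"
    and "\<And>z. z \<in> E \<Longrightarrow> card (nb z n) = 2"
proof -
  let ?s = "fst st"
  let ?c1 = "IfEq (arr DEG cI) (Num 2) Skip (Assign BD (arr LS cI) (Num 1))"
  let ?c2 = "Cond (Cell BD (arr LS cI)) Skip
       (Cond (Plus (Cell BD (Cell LS (arr EA cI))) (Minus (Cell LS (arr EA cI)) (arr LS cI)))
         (Assign IE (scal cI) (Num 1)) Skip)"
  let ?I = "\<lambda>j (st' :: store \<times> nat list). \<forall>c. fst st' BD c > 0 \<longleftrightarrow> (\<exists>z<j. ?s LS z = c \<and> ?s DEG z \<noteq> 2)"
  define st1 where "st1 = sem n (For cI ?c1) st"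
  define st2 where "st2 = sem n (For cI ?c2) st1"
  have "?I n (sem n (For cI ?c1) st)"
  proof (rule For_rule[where I = ?I])
    show "?I 0 st" using zero by simp
  next
    fix j st' assume j: "j < n" "?I j st'" "fst st' cI 0 = j"
      and fr: "\<And>x. x \<notin> assigned (For cI ?c1) \<Longrightarrow> fst st' x = ?s x"
    have "fst st' DEG = ?s DEG" "fst st' LS = ?s LS" using fr by simp_all
    then show "?I (Suc j) (sem n ?c1 st')"
      using j by (auto simp: upd_apply less_Suc_eq)
  next
    fix j k st' assume "?I j st'"
    then show "?I j (apfst (upd cI 0 k) st')" by (simp add: upd_apply)
  qed
  then have BD: "fst st1 BD c > 0 \<longleftrightarrow> (\<exists>z<n. ?s LS z = c \<and> ?s DEG z \<noteq> 2)" for c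
    by (simp add: st1_def)
  have st1: "fst st1 x = ?s x" if "x \<notin> {cI, BD}" for x
    unfolding st1_def using that by (subst sem_unassigned) auto
  define isE where "isE z \<longleftrightarrow> fst st1 BD (?s LS z) = 0 \<and>
      (fst st1 BD (?s LS (?s EA z)) > 0 \<or> ?s LS z < ?s LS (?s EA z))" for z
  let ?J = "\<lambda>j (st' :: store \<times> nat list). \<forall>z. fst st' IE z > 0 \<longleftrightarrow> z < j \<and> isE z"
  have "?J n (sem n (For cI ?c2) st1)"
  proof (rule For_rule[where I = ?J])
    show "?J 0 st1" using zero st1 by simp
  next
    fix j st' assume j: "j < n" "?J j st'" "fst st' cI 0 = j"
      and fr: "\<And>x. x \<notin> assigned (For cI ?c2) \<Longrightarrow> fst st' x = fst st1 x"
    have "fst st' BD = fst st1 BD" "fst st' LS = ?s LS" "fst st' EA = ?s EA"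
      using fr st1 by simp_all
    then have "fst (sem n ?c2 st') = (if isE j then upd IE j 1 (fst st') else fst st')"
      using j(3) by (simp add: isE_def)
    then show "?J (Suc j) (sem n ?c2 st')"
      using j(2) by (auto simp: upd_apply less_Suc_eq)
  next
    fix j k st' assume "?J j st'"
    then show "?J j (apfst (upd cI 0 k) st')" by (simp add: upd_apply)
  qed
  then have E: "z \<in> E \<longleftrightarrow> z < n \<and> isE z" for z
    by (simp add: E_def classify_com_def st1_def)
  show "E \<subseteq> {..<n}" using E by auto
  have deg: "?s DEG z = card (nb z n)" if "z < n" for z using rows[OF that] unfolding row_ok_def by blast
  show "card (nb z n) = 2" if "z \<in> E" for z
    using that deg[of z] BD[of "?s LS z"] by (auto simp: E isE_def)
  fix u v assume uv: "u < n" "v < n" "adj u v"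
  have nbr: "?s LS (?s EA x) = ?s LS y" if "x < n" "y < n" "adj x y" for x y
  proof -
    have "y \<in> nb x n" using that by (simp add: nb_def)
    then show ?thesis using rows[OF that(1), unfolded row_ok_def] by (metis empty_iff)
  qed
  have "?s LS (?s EA u) = ?s LS v" "?s LS (?s EA v) = ?s LS u"
    by (rule nbr[OF uv], rule nbr[OF uv(2,1) adj_sym[OF uv(3)]])
  moreover have "?s LS u \<noteq> ?s LS v"
    using sound[unfolded sound_def, rule_format, OF uv(1,2)] E0_adj[OF uv] by blast
  \<comment> \<open>One of \<open>u\<close> and \<open>v\<close> lies in \<open>E0\<close>; its
    class stays inside \<open>E0\<close>, where all degrees are 2.\<close>
  moreover have "fst st1 BD (?s LS u) = 0 \<or> fst st1 BD (?s LS v) = 0"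
  proof -
    have E0: "fst st1 BD (?s LS w) = 0" if w: "w < n" "w \<in> E0" for w
    proof -
      have "?s DEG z = 2" if "z < n" "?s LS z = ?s LS w" for z
      proof -
        have "z \<in> E0" using sound[unfolded sound_def, rule_format, OF that(1) w(1) that(2)] w(2) by blast
        then show ?thesis using E0_card[of z] that(1) deg[OF that(1)] by (simp add: nb_def)
      qed
      then show ?thesis using BD[of "?s LS w"] by auto
    qed
    show ?thesis using E0[of u] E0[of v] E0_adj[OF uv] uv(1,2) by (cases "u \<in> E0") simp_all
  qed
  ultimately show "v \<in> E \<longleftrightarrow> u \<notin> E" using uv by (auto simp: E isE_def)
qed

subsection \<open>The spanning forest and its fundamental cycles\<close>

text \<open>Kruskal's procedure without weights.\<close>

definition forest_com :: com where
  "forest_com = init_com LC ;;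
     For cI (Cond (arr IE cI)
       (IfEq (Cell LC (arr EA cI)) (Cell LC (arr EB cI)) Skip
         (merge_com LC (arr EA cI) (arr EB cI) ;; Assign TR (scal cI) (Num 1))) Skip)"

text \<open>Decides membership in \<open>sep\<close>: the forest edge in \<open>cI\<close> separates
  two vertices iff they get different labels here.\<close>

definition cut_labels_com :: com where
  "cut_labels_com = init_com LT ;;
     For cJ (Cond (arr TR cJ)
       (IfEq (scal cI) (scal cJ) Skip (merge_com LT (arr EA cJ) (arr EB cJ))) Skip)"

text \<open>Executed once per forest edge. \<open>CNT\<close> starts afresh and becomes the number
  of fundamental cycles through that edge; \<open>PA\<close> is toggled and accumulates over all
  executions.\<close>

definition count_com :: com where
  "count_com = Assign CNT (Num 0) (Num 0) ;;
     For cJ (Cond (arr IE cJ) (Cond (arr TR cJ) Skip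
       (IfEq (Cell LT (arr EA cJ)) (Cell LT (arr EB cJ)) Skip
         (Assign PA (scal cJ) (Minus (Num 1) (arr PA cJ)) ;;
          Assign CNT (Num 0) (Plus (scal CNT) (Num 1))))) Skip)"

definition cycles_com :: com where
  "cycles_com =
     For cI (Cond (arr TR cI)
       (cut_labels_com ;; count_com ;;
        Cond (Minus (scal CNT) (Num 1)) (Assign BA (Cell LC (arr EA cI)) (Num 1)) Skip) Skip)"

definition bad_com :: com where
  "bad_com = For cJ (Cond (arr PA cJ) (Assign BA (Cell LC (arr EA cJ)) (Num 1)) Skip)"

text \<open>Edge vertices keep their initial label and so look like roots; testing \<open>IE\<close>
  first counts them once, as edges.\<close>

definition answer_com :: com where
  "answer_com =
     (let inc = Assign 0 (Num 0) (Plus (scal 0) (Num 1)) in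
      For cI (Cond (arr IE cI) inc
        (IfEq (arr LC cI) (scal cI) (Cond (arr BA cI) Skip inc) Skip)))"

lemma assigned_coms [simp]:
  "assigned forest_com = {cI, cM, cP, cQ, LC, TR}"
  "assigned cut_labels_com = {cJ, cM, cP, cQ, LT}"
  "assigned count_com = {cJ, PA, CNT}"
  "assigned cycles_com = {cI, cJ, cM, cP, cQ, LT, PA, CNT, BA}"
  "assigned bad_com = {cJ, BA}"
  by (auto simp: forest_com_def cut_labels_com_def count_com_def cycles_com_def bad_com_def)

lemma merge_cong: "L u = L v \<Longrightarrow> merge L i j u = merge L i j v"
  by (simp add: merge_def)

locale edge_arrays = multigraph a b for a b :: "nat \<Rightarrow> nat" +
  fixes n :: nat and V E :: "nat set"
  assumes E_less: "E \<subseteq> {..<n}" and V_less: "V \<subseteq> {..<n}"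
    and ends_V: "\<And>e. e \<in> E \<Longrightarrow> a e \<in> V \<and> b e \<in> V"
begin

definition arrays :: "store \<Rightarrow> bool" where
  "arrays s \<longleftrightarrow> s EA = a \<and> s EB = b \<and> (\<forall>e. s IE e > 0 \<longleftrightarrow> e \<in> E)"

lemma finite_V: "finite V" and finite_E: "finite E"
  using V_less E_less finite_subset by blast+

lemma labels_merge_less:
  assumes "labels V L S" "i \<in> V" "j \<in> V" "L' = (\<lambda>v. if v < n then merge L i j v else L v)"
  shows "labels V L' (insert (i, j) S)"
  by (rule labels_cong[OF labels_merge[OF assms(1-3)]]) (use V_less assms(4) in auto)

lemma forest_com:
  assumes ar: "arrays (fst st)" and zero: "\<And>e. fst st TR e = 0"
  defines "s' \<equiv> fst (sem n forest_com st)"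
  defines "T \<equiv> {e. s' TR e > 0}"
  shows "T \<subseteq> E" "forest T" "labels V (s' LC) (ends T)" "\<And>e. e \<in> E \<Longrightarrow> s' LC (a e) = s' LC (b e)"
proof -
  let ?m = "merge_com LC (arr EA cI) (arr EB cI)"
  let ?c = "Cond (arr IE cI)
       (IfEq (Cell LC (arr EA cI)) (Cell LC (arr EB cI)) Skip
         (?m ;; Assign TR (scal cI) (Num 1))) Skip"
  define tr where "tr s = {e. s TR e > 0}" for s :: store
  define inv where "inv j s \<longleftrightarrow> tr s \<subseteq> {e \<in> E. e < j} \<and> forest (tr s) \<and> labels V (s LC) (ends (tr s)) \<and>
      (\<forall>e\<in>E. e < j \<longrightarrow> s LC (a e) = s LC (b e))" for j s
  let ?I = "\<lambda>j (st' :: store \<times> nat list). inv j (fst st')"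
  define st1 where "st1 = sem n (init_com LC) st"
  have st1: "fst st1 x = fst st x" if "x \<notin> {cM, LC}" for x
    unfolding st1_def using that by (subst sem_unassigned) auto
  have "?I n (sem n (For cI ?c) st1)"
  proof (rule For_rule[where I = ?I])
    have "tr (fst st1) = {}" using st1 zero by (simp add: tr_def)
    moreover have "labels V (fst st1 LC) {}"
      using V_less by (intro labels_empty) (auto simp: st1_def sem_init_com)
    ultimately show "?I 0 st1" by (simp add: inv_def forest_def)
  next
    fix j st' assume j: "j < n" "?I j st'" "fst st' cI 0 = j"
      and fr: "\<And>x. x \<notin> assigned (For cI ?c) \<Longrightarrow> fst st' x = fst st1 x"
    let ?L = "fst st' LC" and ?T = "tr (fst st')"
    have col: "fst st' EA = a" "fst st' EB = b" "fst st' IE = fst st IE"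
      using fr st1 ar by (simp_all add: arrays_def)
    have IE: "fst st IE j > 0 \<longleftrightarrow> j \<in> E" using ar by (simp add: arrays_def)
    show "?I (Suc j) (sem n ?c st')"
    proof (cases "j \<in> E \<and> ?L (a j) \<noteq> ?L (b j)")
      case False
      then have "sem n ?c st' = st'" using IE col j(3) by auto
      then show ?thesis using False j(2) by (auto simp: inv_def less_Suc_eq)
    next
      case True
      define st2 where "st2 = sem n ?m st'"
      have L2: "fst st2 LC = (\<lambda>v. if v < n then merge ?L (a j) (b j) v else ?L v)"
        unfolding st2_def by (rule sem_merge_com) (simp_all add: col j(3) upd_apply)
      have st2: "fst st2 x = fst st' x" if "x \<notin> {cP, cQ, cM, LC}" for x
        unfolding st2_def using that by (subst sem_unassigned) auto
      have sem: "fst (sem n ?c st') = upd TR j 1 (fst st2)"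
        using True IE col j(3) st2[of cI] by (simp add: st2_def)
      have T: "tr (upd TR j 1 (fst st2)) = insert j ?T"
        using st2[of TR] by (auto simp: tr_def upd_apply)
      have Vj: "a j \<in> V" "b j \<in> V" using True ends_V by auto
      have lab: "labels V ?L (ends ?T)" using j(2) by (simp add: inv_def)
      have "\<not> cn ?T (a j) (b j)" using lab Vj True by (auto simp: labels_def)
      then have "forest (insert j ?T)" using j(2) forest_insertI by (simp add: inv_def)
      moreover have "labels V (fst st2 LC) (ends (insert j ?T))"
        using labels_merge_less[OF lab Vj L2] by simp
      moreover have "fst st2 LC (a e) = fst st2 LC (b e)" if "e \<in> E" "e < Suc j" for e
      proof (cases "e = j")
        case True
        then show ?thesis using Vj V_less by (auto simp: L2 merge_def)
      next
        case False
        then have "?L (a e) = ?L (b e)" using that j(2) by (simp add: inv_def)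
        moreover have "a e < n" "b e < n" using ends_V[OF that(1)] V_less by auto
        ultimately show ?thesis using merge_cong by (simp add: L2)
      qed
      moreover have "insert j ?T \<subseteq> {e \<in> E. e < Suc j}"
        using j(2) True by (auto simp: inv_def)
      ultimately show ?thesis unfolding sem inv_def T by (simp add: upd_apply)
    qed
  next
    fix j k st' assume "?I j st'"
    then show "?I j (apfst (upd cI 0 k) st')" by (simp add: upd_apply inv_def tr_def)
  qed
  then have "inv n s'" by (simp add: s'_def forest_com_def st1_def)
  then show "T \<subseteq> E" "forest T" "labels V (s' LC) (ends T)"
      "\<And>e. e \<in> E \<Longrightarrow> s' LC (a e) = s' LC (b e)"
    using E_less by (auto simp: inv_def tr_def T_def)
qed

lemma cut_labels_com:
  assumes ar: "arrays (fst st)" and T: "\<And>e. fst st TR e > 0 \<longleftrightarrow> e \<in> T" "T \<subseteq> E"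
    and f: "fst st cI 0 = f"
  shows "labels V (fst (sem n cut_labels_com st) LT) (ends (T - {f}))"
proof -
  let ?m = "merge_com LT (arr EA cJ) (arr EB cJ)"
  let ?c = "Cond (arr TR cJ) (IfEq (scal cI) (scal cJ) Skip ?m) Skip"
  let ?T = "\<lambda>j. {e \<in> T. e < j \<and> e \<noteq> f}"
  let ?I = "\<lambda>j (st' :: store \<times> nat list). labels V (fst st' LT) (ends (?T j))"
  define st1 where "st1 = sem n (init_com LT) st"
  have st1: "fst st1 x = fst st x" if "x \<notin> {cM, LT}" for x
    unfolding st1_def using that by (subst sem_unassigned) auto
  have "?I n (sem n (For cJ ?c) st1)"
  proof (rule For_rule[where I = ?I])
    have "labels V (fst st1 LT) {}"
      using V_less by (intro labels_empty) (auto simp: st1_def sem_init_com)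
    then show "?I 0 st1" by simp
  next
    fix j st' assume j: "j < n" "?I j st'" "fst st' cJ 0 = j"
      and fr: "\<And>x. x \<notin> assigned (For cJ ?c) \<Longrightarrow> fst st' x = fst st1 x"
    have col: "fst st' EA = a" "fst st' EB = b" "fst st' TR = fst st TR" "fst st' cI 0 = f"
      using fr st1 ar f by (simp_all add: arrays_def)
    show "?I (Suc j) (sem n ?c st')"
    proof (cases "j \<in> T \<and> j \<noteq> f")
      case False
      then have "sem n ?c st' = st'" using T col j(3) by auto
      moreover have "?T (Suc j) = ?T j" using False by (auto simp: less_Suc_eq)
      ultimately show ?thesis using j(2) by simp
    next
      case True
      have "fst (sem n ?m st') LT =
          (\<lambda>v. if v < n then merge (fst st' LT) (a j) (b j) v else fst st' LT v)"
        by (rule sem_merge_com) (simp_all add: col j(3) upd_apply)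
      then have "labels V (fst (sem n ?m st') LT) (insert (a j, b j) (ends (?T j)))"
        using labels_merge_less[OF j(2)] True T ends_V by blast
      moreover have "?T (Suc j) = insert j (?T j)" using True by (auto simp: less_Suc_eq)
      ultimately show ?thesis using True T col j(3) by simp
    qed
  next
    fix j k st' assume "?I j st'"
    then show "?I j (apfst (upd cJ 0 k) st')" by (simp add: upd_apply)
  qed
  moreover have "?T n = T - {f}" using T E_less by auto
  ultimately show ?thesis by (simp add: cut_labels_com_def st1_def)
qed

lemma count_com:
  assumes ar: "arrays (fst st)" and T: "\<And>e. fst st TR e > 0 \<longleftrightarrow> e \<in> T"
  defines "C \<equiv> {g \<in> E - T. fst st LT (a g) \<noteq> fst st LT (b g)}"
  shows "fst (sem n count_com st) CNT 0 = card C"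
    and "fst (sem n count_com st) PA g = (if g \<in> C then 1 - fst st PA g else fst st PA g)"
proof -
  let ?c = "Cond (arr IE cJ) (Cond (arr TR cJ) Skip
       (IfEq (Cell LT (arr EA cJ)) (Cell LT (arr EB cJ)) Skip
         (Assign PA (scal cJ) (Minus (Num 1) (arr PA cJ)) ;;
          Assign CNT (Num 0) (Plus (scal CNT) (Num 1))))) Skip"
  let ?I = "\<lambda>j (st' :: store \<times> nat list). fst st' CNT 0 = card {g \<in> C. g < j} \<and>
      (\<forall>g. fst st' PA g = (if g \<in> C \<and> g < j then 1 - fst st PA g else fst st PA g))"
  define st1 where "st1 = sem n (Assign CNT (Num 0) (Num 0)) st"
  have st1: "fst st1 x = fst st x" if "x \<noteq> CNT" for x
    unfolding st1_def using that by (simp add: upd_apply)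
  have finC: "finite C" using finite_E by (simp add: C_def)
  have "?I n (sem n (For cJ ?c) st1)"
  proof (rule For_rule[where I = ?I])
    show "?I 0 st1" by (simp add: st1_def upd_apply)
  next
    fix j st' assume j: "j < n" "?I j st'" "fst st' cJ 0 = j"
      and fr: "\<And>x. x \<notin> assigned (For cJ ?c) \<Longrightarrow> fst st' x = fst st1 x"
    have col: "fst st' EA = a" "fst st' EB = b" "fst st' TR = fst st TR" "fst st' LT = fst st LT"
        "fst st' IE = fst st IE"
      using fr st1 ar by (simp_all add: arrays_def)
    have IE: "fst st IE j > 0 \<longleftrightarrow> j \<in> E" using ar by (simp add: arrays_def)
    have C: "j \<in> C \<longleftrightarrow> fst st IE j > 0 \<and> fst st TR j = 0 \<and> fst st LT (a j) \<noteq> fst st LT (b j)"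
      using IE T[of j] by (auto simp: C_def)
    show "?I (Suc j) (sem n ?c st')"
    proof (cases "j \<in> C")
      case False
      then have "sem n ?c st' = st'" using C col j(3) by auto
      moreover have "g \<in> C \<and> g < Suc j \<longleftrightarrow> g \<in> C \<and> g < j" for g using False by (auto simp: less_Suc_eq)
      ultimately show ?thesis using j(2) by simp
    next
      case True
      then have sem: "fst (sem n ?c st') =
          upd CNT 0 (fst st' CNT 0 + 1) (upd PA j (1 - fst st' PA j) (fst st'))"
        using C col j(3) by (simp add: upd_apply)
      have "{g \<in> C. g < Suc j} = insert j {g \<in> C. g < j}" using True by (auto simp: less_Suc_eq)
      then have "card {g \<in> C. g < Suc j} = card {g \<in> C. g < j} + 1" using finC by simp
      then show ?thesis unfolding sem using j(2) True by (auto simp: upd_apply less_Suc_eq)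
    qed
  next
    fix j k st' assume "?I j st'"
    then show "?I j (apfst (upd cJ 0 k) st')" by (simp add: upd_apply)
  qed
  moreover have "g \<in> C \<and> g < n \<longleftrightarrow> g \<in> C" for g using E_less by (auto simp: C_def)
  ultimately show "fst (sem n count_com st) CNT 0 = card C"
    and "fst (sem n count_com st) PA g = (if g \<in> C then 1 - fst st PA g else fst st PA g)"
    by (simp_all add: count_com_def st1_def)
qed

text \<open>One loop over the forest edges serves all fundamental cycles at once: after
  \<open>j\<close> rounds, \<open>PA\<close> holds the parity of the part of each tree path below
  \<open>j\<close>, while the number of cycles through a single edge is final within its
  round.\<close>

lemma cycles_com:
  assumes ar: "arrays (fst st)" and T: "\<And>e. fst st TR e > 0 \<longleftrightarrow> e \<in> T" "T \<subseteq> E"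
    and zero: "\<And>g. fst st PA g = 0" "\<And>r. fst st BA r = 0"
  defines "s' \<equiv> fst (sem n cycles_com st)"
  shows "s' PA g = (if g \<in> E - T then card (sep T (a g) (b g)) mod 2 else 0)"
    and "s' BA r > 0 \<longleftrightarrow>
      (\<exists>f\<in>T. fst st LC (a f) = r \<and> 2 \<le> card {g \<in> E - T. f \<in> sep T (a g) (b g)})"
proof -
  let ?c = "Cond (arr TR cI)
       (cut_labels_com ;; count_com ;;
        Cond (Minus (scal CNT) (Num 1)) (Assign BA (Cell LC (arr EA cI)) (Num 1)) Skip) Skip"
  define C where "C f = {g \<in> E - T. f \<in> sep T (a g) (b g)}" for f
  define inv where "inv j s \<longleftrightarrow>
      (\<forall>g. s PA g = (if g \<in> E - T then card {f \<in> sep T (a g) (b g). f < j} mod 2 else 0)) \<and>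
      (\<forall>r. s BA r > 0 \<longleftrightarrow> (\<exists>f\<in>T. f < j \<and> fst st LC (a f) = r \<and> 2 \<le> card (C f)))"
    for j and s :: store
  have sepT: "sep T x y \<subseteq> T" for x y by (auto simp: sep_def)
  have finT: "finite T" using T(2) finite_E finite_subset by blast
  let ?I = "\<lambda>j (st' :: store \<times> nat list). inv j (fst st')"
  have "?I n (sem n (For cI ?c) st)"
  proof (rule For_rule[where I = ?I])
    show "?I 0 st" using zero by (simp add: inv_def)
  next
    fix j st' assume j: "j < n" "?I j st'" "fst st' cI 0 = j"
      and fr: "\<And>x. x \<notin> assigned (For cI ?c) \<Longrightarrow> fst st' x = fst st x"
    have col: "fst st' EA = a" "fst st' EB = b" "fst st' TR = fst st TR" "fst st' LC = fst st LC"
        "fst st' IE = fst st IE"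
      using fr ar by (simp_all add: arrays_def)
    show "?I (Suc j) (sem n ?c st')"
    proof (cases "j \<in> T")
      case False
      then have "sem n ?c st' = st'" using T(1)[of j] col j(3) by simp
      moreover have "f < Suc j \<longleftrightarrow> f < j" if "f \<in> T" for f using that False by (auto simp: less_Suc_eq)
      then have "{f \<in> sep T x y. f < Suc j} = {f \<in> sep T x y. f < j}"
        "(\<exists>f\<in>T. f < Suc j \<and> P f) \<longleftrightarrow> (\<exists>f\<in>T. f < j \<and> P f)" for x y P using sepT by blast+
      ultimately show ?thesis using j(2) by (simp add: inv_def)
    next
      case True
      define st1 where "st1 = sem n cut_labels_com st'"
      define st2 where "st2 = sem n count_com st1"
      have st1: "fst st1 x = fst st' x" if "x \<notin> {cJ, cM, cP, cQ, LT}" for x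
        unfolding st1_def using that by (subst sem_unassigned) auto
      have st2: "fst st2 x = fst st1 x" if "x \<notin> {cJ, PA, CNT}" for x
        unfolding st2_def using that by (subst sem_unassigned) auto
      have "arrays (fst st')" using ar col by (simp add: arrays_def)
      then have lab: "labels V (fst st1 LT) (ends (T - {j}))"
        unfolding st1_def using T col j(3) by (intro cut_labels_com) auto
      have ar1: "arrays (fst st1)" using ar col st1 by (simp add: arrays_def)
      have T1: "fst st1 TR e > 0 \<longleftrightarrow> e \<in> T" for e using T(1) col st1 by simp
      have "fst st1 LT (a g) \<noteq> fst st1 LT (b g) \<longleftrightarrow> j \<in> sep T (a g) (b g)" if "g \<in> E" for g
        using lab ends_V[OF that] True by (auto simp: labels_def sep_def)
      then have C: "{g \<in> E - T. fst st1 LT (a g) \<noteq> fst st1 LT (b g)} = C j"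
        by (auto simp: C_def)
      have CNT: "fst st2 CNT 0 = card (C j)"
        unfolding st2_def count_com(1)[OF ar1 T1] C ..
      have PA: "fst st2 PA g = (if g \<in> C j then 1 - fst st' PA g else fst st' PA g)" for g
        unfolding st2_def count_com(2)[OF ar1 T1] C using st1[of PA] by simp
      have c2: "fst st2 cI 0 = j" "fst st2 EA = a" "fst st2 LC = fst st LC" "fst st2 BA = fst st' BA"
        using st1 st2 col j(3) by simp_all
      have sem: "fst (sem n ?c st') =
          (if 2 \<le> card (C j) then upd BA (fst st LC (a j)) 1 (fst st2) else fst st2)"
        using True T(1)[of j] col j(3) c2 CNT
        by (simp add: st1_def[symmetric] st2_def[symmetric])
      have "fst (sem n ?c st') PA g =
          (if g \<in> E - T then card {f \<in> sep T (a g) (b g). f < Suc j} mod 2 else 0)" for g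
      proof -
        have old: "fst st' PA g = (if g \<in> E - T then card {f \<in> sep T (a g) (b g). f < j} mod 2 else 0)"
          using j(2) by (simp add: inv_def)
        have eq: "fst (sem n ?c st') PA g = fst st2 PA g" unfolding sem by (simp add: upd_apply)
        show ?thesis
        proof (cases "g \<in> C j")
          case True
          then have "{f \<in> sep T (a g) (b g). f < Suc j} = insert j {f \<in> sep T (a g) (b g). f < j}"
            by (auto simp: C_def less_Suc_eq)
          moreover have "finite {f \<in> sep T (a g) (b g). f < j}" by simp
          ultimately have "card {f \<in> sep T (a g) (b g). f < Suc j} = Suc (card {f \<in> sep T (a g) (b g). f < j})"
            by simp
          moreover have "1 - m mod 2 = Suc m mod 2" for m :: nat by presburger
          ultimately show ?thesis using eq PA[of g] True old by (simp add: C_def)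
        next
          case False
          then have "g \<in> E - T \<Longrightarrow> {f \<in> sep T (a g) (b g). f < Suc j} = {f \<in> sep T (a g) (b g). f < j}"
            by (auto simp: C_def less_Suc_eq)
          then show ?thesis using eq PA[of g] False old by auto
        qed
      qed
      moreover have "fst (sem n ?c st') BA r > 0 \<longleftrightarrow>
          (\<exists>f\<in>T. f < Suc j \<and> fst st LC (a f) = r \<and> 2 \<le> card (C f))" for r
      proof -
        have "fst st' BA r > 0 \<longleftrightarrow> (\<exists>f\<in>T. f < j \<and> fst st LC (a f) = r \<and> 2 \<le> card (C f))"
          using j(2) by (simp add: inv_def)
        then show ?thesis unfolding sem using True c2(4) by (auto simp: upd_apply less_Suc_eq)
      qed
      ultimately show ?thesis by (simp add: inv_def)
    qed
  next
    fix j k st' assume "?I j st'"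
    then show "?I j (apfst (upd cI 0 k) st')" by (simp add: upd_apply inv_def)
  qed
  then have inv: "inv n s'" by (simp add: s'_def cycles_com_def)
  have less: "f \<in> T \<Longrightarrow> f < n" for f using T E_less by auto
  then have "{f \<in> sep T (a g) (b g). f < n} = sep T (a g) (b g)" using sepT by blast
  then show "s' PA g = (if g \<in> E - T then card (sep T (a g) (b g)) mod 2 else 0)"
    using inv by (simp add: inv_def)
  show "s' BA r > 0 \<longleftrightarrow>
      (\<exists>f\<in>T. fst st LC (a f) = r \<and> 2 \<le> card {g \<in> E - T. f \<in> sep T (a g) (b g)})"
    using inv less by (auto simp: inv_def C_def)
qed

lemma bad_com:
  assumes ar: "arrays (fst st)"
  shows "fst (sem n bad_com st) BA r > 0 \<longleftrightarrow>
    fst st BA r > 0 \<or> (\<exists>g<n. fst st PA g > 0 \<and> fst st LC (a g) = r)"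
proof -
  let ?c = "Cond (arr PA cJ) (Assign BA (Cell LC (arr EA cJ)) (Num 1)) Skip"
  let ?I = "\<lambda>j (st' :: store \<times> nat list). \<forall>r. fst st' BA r > 0 \<longleftrightarrow>
      fst st BA r > 0 \<or> (\<exists>g<j. fst st PA g > 0 \<and> fst st LC (a g) = r)"
  have "?I n (sem n (For cJ ?c) st)"
  proof (rule For_rule[where I = ?I])
    show "?I 0 st" by simp
  next
    fix j st' assume j: "j < n" "?I j st'" "fst st' cJ 0 = j"
      and fr: "\<And>x. x \<notin> assigned (For cJ ?c) \<Longrightarrow> fst st' x = fst st x"
    have "fst st' EA = a" "fst st' PA = fst st PA" "fst st' LC = fst st LC"
      using fr ar by (simp_all add: arrays_def)
    then show "?I (Suc j) (sem n ?c st')"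
      using j by (auto simp: upd_apply less_Suc_eq)
  next
    fix j k st' assume "?I j st'"
    then show "?I j (apfst (upd cJ 0 k) st')" by (simp add: upd_apply)
  qed
  then show ?thesis by (simp add: bad_com_def)
qed

lemma answer_com:
  assumes ar: "arrays (fst st)" and zero: "fst st 0 0 = 0"
  shows "fst (sem n answer_com st) 0 0 =
    card {i. i < n \<and> (i \<in> E \<or> fst st LC i = i \<and> fst st BA i = 0)}"
proof -
  let ?inc = "Assign 0 (Num 0) (Plus (scal 0) (Num 1))"
  let ?c = "Cond (arr IE cI) ?inc (IfEq (arr LC cI) (scal cI) (Cond (arr BA cI) Skip ?inc) Skip)"
  define P where "P i \<longleftrightarrow> i \<in> E \<or> fst st LC i = i \<and> fst st BA i = 0" for i
  let ?I = "\<lambda>j (st' :: store \<times> nat list). fst st' 0 0 = card {i. i < j \<and> P i}"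
  have "?I n (sem n (For cI ?c) st)"
  proof (rule For_rule[where I = ?I])
    show "?I 0 st" using zero by simp
  next
    fix j st' assume j: "j < n" "?I j st'" "fst st' cI 0 = j"
      and fr: "\<And>x. x \<notin> assigned (For cI ?c) \<Longrightarrow> fst st' x = fst st x"
    have col: "fst st' BA = fst st BA" "fst st' LC = fst st LC" "fst st' IE = fst st IE"
      using fr by simp_all
    have IE: "fst st IE j > 0 \<longleftrightarrow> j \<in> E" using ar by (simp add: arrays_def)
    have "fst (sem n ?c st') 0 0 = fst st' 0 0 + (if P j then 1 else 0)"
      using col IE j(3) by (auto simp: P_def upd_apply)
    moreover have "{i. i < Suc j \<and> P i} = (if P j then insert j {i. i < j \<and> P i} else {i. i < j \<and> P i})"
      by (auto simp: less_Suc_eq)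
    ultimately show "?I (Suc j) (sem n ?c st')" using j(2) by simp
  next
    fix j k st' assume "?I j st'"
    then show "?I j (apfst (upd cI 0 k) st')" by (simp add: upd_apply)
  qed
  then show ?thesis by (simp add: answer_com_def P_def Let_def)
qed

end

section \<open>Correctness of the assembled program\<close>

definition program :: com where
  "program = init_com LS ;; read_com ;; classify_com ;; forest_com ;; cycles_com ;; bad_com ;;
     answer_com"

lemma assigned_read_com [simp]:
  "assigned read_com = {cI, cJ, cX, cP, cQ, cM, LS, EB, EA, DEG}"
  by (auto simp: read_com_def read_entry_def)

definition index_graph :: "nat \<Rightarrow> (nat \<Rightarrow> nat \<Rightarrow> bool) \<Rightarrow> nat pair_pre_digraph" where
  "index_graph n adj = \<lparr>pverts = {..<n}, parcs = {(u, v). u < n \<and> v < n \<and> adj u v}\<rparr>"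

lemma (in half_graph) nb_pair:
  assumes "row_ok z n s" "card (nb z n) = 2"
  shows "nb z n = {s EA z, s EB z} \<and> s EA z \<noteq> s EB z"
proof -
  have "nb z n \<noteq> {}" using assms(2) by auto
  then have *: "s EA z \<in> nb z n" "s EB z \<in> nb z n" "s EB z \<noteq> s EA z"
    using assms by (simp_all add: row_ok_def)
  have "{s EA z, s EB z} = nb z n"
    by (rule card_subset_eq) (use * assms(2) in auto)
  then show ?thesis using *(3) by metis
qed

text \<open>\<open>E\<close> is the side found by the classification, with no relation to
  \<open>E0\<close> claimed. It satisfies \<open>subdivided\<close>, where the formula for the super
  domination number is available.\<close>

theorem (in half_graph) program_correct:
  "fst (sem n program (upd 1 0 n (\<lambda>_ _. 0), rows 0)) 0 0 =
     super_domination_number (index_graph n adj)"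
proof -
  define st0 where "st0 = (upd 1 0 n (\<lambda>_ _. 0) :: store, rows 0)"
  define st1 where "st1 = sem n (init_com LS) st0"
  define st2 where "st2 = sem n read_com st1"
  define st3 where "st3 = sem n classify_com st2"
  define st4 where "st4 = sem n forest_com st3"
  define st5 where "st5 = sem n cycles_com st4"
  define st6 where "st6 = sem n bad_com st5"
  have fr0: "fst st0 x i = 0" if "x \<noteq> 1" for x i
    using that by (simp add: st0_def upd_apply)
  have fr1: "fst st1 x = fst st0 x" if "x \<notin> {cM, LS}" for x
    unfolding st1_def using that by (subst sem_unassigned) auto
  have fr2: "fst st2 x = fst st1 x" if "x \<notin> {cI, cJ, cX, cP, cQ, cM, LS, EB, EA, DEG}" for x
    unfolding st2_def using that by (subst sem_unassigned) auto
  have fr3: "fst st3 x = fst st2 x" if "x \<notin> {cI, BD, IE}" for x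
    unfolding st3_def using that by (subst sem_unassigned) auto
  have fr4: "fst st4 x = fst st3 x" if "x \<notin> {cI, cM, cP, cQ, LC, TR}" for x
    unfolding st4_def using that by (subst sem_unassigned) auto
  have fr5: "fst st5 x = fst st4 x" if "x \<notin> {cI, cJ, cM, cP, cQ, LT, PA, CNT, BA}" for x
    unfolding st5_def using that by (subst sem_unassigned) auto
  have fr6: "fst st6 x = fst st5 x" if "x \<notin> {cJ, BA}" for x
    unfolding st6_def using that by (subst sem_unassigned) auto
  have snd1: "snd st1 = rows 0" by (simp add: st1_def sem_input_free) (simp add: st0_def)
  have init: "fst st1 LS v = v" if "v < n" for v
    unfolding st1_def using that by (simp add: sem_init_com)
  have deg0: "fst st1 DEG v = 0" for v using fr1[of DEG] fr0 by simp
  have read: "row_ok z n (fst st2)" if "z < n" for z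
    unfolding st2_def by (rule read_com(1)) (use init deg0 snd1 that in auto)
  have sound: "sound (fst st2)"
    unfolding st2_def by (rule read_com(2)) (use init deg0 snd1 in auto)
  have zero2: "fst st2 x i = 0" if "x \<notin> {1, cI, cJ, cX, cP, cQ, cM, LS, EB, EA, DEG}" for x i
    using that fr0 fr1 fr2 by simp
  define E where "E = {z. fst st3 IE z > 0}"
  have zero2': "fst st2 BD i = 0" "fst st2 IE i = 0" for i using zero2 by simp_all
  have E_sub: "E \<subseteq> {..<n}"
    unfolding E_def st3_def by (rule classify_com(1)) (rule read sound zero2' | assumption)+
  have E_adj: "v \<in> E \<longleftrightarrow> u \<notin> E" if "u < n" "v < n" "adj u v" for u v
    unfolding E_def st3_def
    by (rule classify_com(2)) (rule read sound zero2' that | assumption)+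
  have E_card: "card (nb z n) = 2" if "z \<in> E" for z
    using that unfolding E_def st3_def
    by (elim classify_com(3)[rotated -1]) (rule read sound zero2' | assumption)+
  \<comment> \<open>This includes the isolated vertices, each of which is a component of its
    own.\<close>
  define V where "V = {..<n} - E"
  define a where "a = fst st3 EA"
  define b where "b = fst st3 EB"
  have ab: "nb e n = {a e, b e}" "a e \<noteq> b e" if "e \<in> E" for e
  proof -
    have "e < n" using E_sub that by auto
    then show "nb e n = {a e, b e}" "a e \<noteq> b e"
      using nb_pair[OF read[OF \<open>e < n\<close>] E_card[OF that]] fr3 by (simp_all add: a_def b_def)
  qed
  have endsV: "a e \<in> V \<and> b e \<in> V" if e: "e \<in> E" for e
  proof -
    have "x \<in> V" if "x \<in> nb e n" for x
      using E_sub E_adj[of e x] e that by (auto simp: nb_def V_def)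
    then show ?thesis using ab[OF e] by simp
  qed
  interpret edge_arrays a b n V E
    by unfold_locales (use E_sub endsV in \<open>auto simp: V_def\<close>)
  have ar3: "arrays (fst st3)" unfolding arrays_def by (simp add: a_def b_def E_def)
  have "fst st3 TR e = 0" for e using fr3 zero2 by simp
  note forest = forest_com[OF ar3 this, folded st4_def]
  define T where "T = {e. fst st4 TR e > 0}"
  define L where "L = fst st4 LC"
  note forest = forest[folded T_def L_def]
  have ar4: "arrays (fst st4)" using ar3 fr4 by (simp add: arrays_def)
  have T: "fst st4 TR e > 0 \<longleftrightarrow> e \<in> T" for e by (simp add: T_def)
  have zero4: "fst st4 PA g = 0" "fst st4 BA g = 0" for g using fr4 fr3 zero2 by simp_all
  note cyc = cycles_com[OF ar4 T forest(1) zero4, folded st5_def L_def]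
  have ar5: "arrays (fst st5)" using ar4 fr5 by (simp add: arrays_def)
  have ar6: "arrays (fst st6)" using ar5 fr6 by (simp add: arrays_def)
  have L5: "fst st5 LC = L" "fst st6 LC = L" using fr5 fr6 by (simp_all add: L_def)
  let ?F = "index_graph n adj"
  have nbhd: "nbhd ?F u = nb u n" if "u < n" for u
    using that by (auto simp: nbhd_def index_graph_def nb_def)
  interpret subdivided a b V E T L ?F
  proof unfold_locales
    show "finite V" "finite E" by (fact finite_V, fact finite_E)
    show "V \<inter> E = {}" by (auto simp: V_def)
    show "pverts ?F = V \<union> E" using E_sub by (auto simp: index_graph_def V_def)
    show "nbhd ?F e = {a e, b e}" if "e \<in> E" for e
      using that E_sub nbhd[of e] ab(1)[OF that] by auto
    show "nbhd ?F v = {e \<in> E. a e = v \<or> b e = v}" if v: "v \<in> V" for v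
    proof -
      have vn: "v < n" "v \<notin> E" using v by (auto simp: V_def)
      have "u \<in> nb v n \<longleftrightarrow> u \<in> E \<and> (a u = v \<or> b u = v)" for u
      proof
        assume u: "u \<in> nb v n"
        then have "u < n" "adj v u" by (simp_all add: nb_def)
        then have "u \<in> E" using E_adj vn by blast
        moreover have "v \<in> nb u n" using \<open>adj v u\<close> adj_sym vn by (simp add: nb_def)
        ultimately show "u \<in> E \<and> (a u = v \<or> b u = v)" using ab(1) by auto
      next
        assume u: "u \<in> E \<and> (a u = v \<or> b u = v)"
        then have "v \<in> nb u n" using ab(1) by auto
        then show "u \<in> nb v n" using adj_sym u E_sub by (auto simp: nb_def)
      qed
      then show ?thesis using nbhd[OF vn(1)] by auto
    qed
  qed (use ab endsV forest in auto)
  have BA: "fst st6 BA r = 0 \<longleftrightarrow> \<not> bad r" for r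
  proof -
    have "(\<exists>g<n. fst st5 PA g > 0 \<and> L (a g) = r) \<longleftrightarrow>
        (\<exists>g\<in>E - T. L (a g) = r \<and> odd (card (sep T (a g) (b g))))"
      using E_sub by (auto simp: cyc(1) odd_iff_mod_2_eq_one split: if_splits)
    then have "fst st6 BA r > 0 \<longleftrightarrow> bad r"
      unfolding st6_def bad_com[OF ar5] cyc(2) L5 bad_def by blast
    then show ?thesis by auto
  qed
  have "fst (sem n program st0) 0 0 = fst (sem n answer_com st6) 0 0"
    by (simp add: program_def st1_def st2_def st3_def st4_def st5_def st6_def)
  also have "\<dots> = card {i. i < n \<and> (i \<in> E \<or> L i = i \<and> fst st6 BA i = 0)}"
    using answer_com[OF ar6] fr6 fr5 fr4 fr3 zero2 L5 by simp
  also have "{i. i < n \<and> (i \<in> E \<or> L i = i \<and> fst st6 BA i = 0)} = E \<union> good_roots"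
  proof -
    have "x \<in> V \<longleftrightarrow> x < n \<and> x \<notin> E" for x by (simp add: V_def)
    then show ?thesis using E_sub BA by (auto simp: good_roots_def)
  qed
  also have "card (E \<union> good_roots) = card E + card good_roots"
  proof (intro card_Un_disjoint)
    show "finite E" by (fact finite_E)
    show "finite good_roots" using good_roots_sub finite_V by (rule finite_subset)
    show "E \<inter> good_roots = {}" using good_roots_sub disjoint by blast
  qed
  also have "\<dots> = super_domination_number ?F" by (simp add: super_domination_number_subdivided)
  finally show ?thesis by (simp add: st0_def)
qed

text \<open>Columns 0 to 19 are in use, and ten temporaries suffice for the depth of all expressions
  in the program.\<close>

interpretation layout 20 30
  by unfold_locales simp

lemma wf_program: "wf_com program"
  by (simp add: program_def init_com_def read_com_def read_entry_def classify_com_def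
      forest_com_def cut_labels_com_def count_com_def cycles_com_def bad_com_def answer_com_def
      merge_com_def IfEq_def Let_def)

subsection \<open>Isomorphic graphs\<close>

lemma super_dominating_set_image:
  assumes inj: "inj_on h (pverts F)" and arcs: "parcs F \<subseteq> pverts F \<times> pverts F"
    and F': "pverts F' = h ` pverts F" "parcs F' = map_prod h h ` parcs F"
    and D: "super_dominating_set F D"
  shows "super_dominating_set F' (h ` D)" "card (h ` D) = card D"
proof -
  have D_sub: "D \<subseteq> pverts F" using D by (simp add: super_dominating_set_def dominating_set_def)
  show "card (h ` D) = card D" by (rule card_image) (rule inj_on_subset[OF inj D_sub])
  have nbhd: "nbhd F' (h y) = h ` nbhd F y" if "y \<in> pverts F" for y
  proof -
    have "y' = y" if "(y', z) \<in> parcs F" "h y' = h y" for y' z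
      using inj arcs that \<open>y \<in> pverts F\<close> by (auto dest: inj_onD)
    then show ?thesis unfolding nbhd_def F' by force
  qed
  have nbhd_sub: "nbhd F y \<subseteq> pverts F" for y using arcs by (auto simp: nbhd_def)
  have diff: "pverts F' - h ` D = h ` (pverts F - D)"
    unfolding F' using inj D_sub by (simp add: inj_on_image_set_diff)
  show "super_dominating_set F' (h ` D)"
    unfolding super_dominating_set_def dominating_set_def diff
  proof (intro conjI ballI)
    show "h ` D \<subseteq> pverts F'" using D_sub by (auto simp: F')
    fix x' assume "x' \<in> h ` (pverts F - D)"
    then obtain x where x: "x \<in> pverts F - D" "x' = h x" by blast
    have "nbhd F x \<inter> D \<noteq> {}" using D x(1) by (simp add: super_dominating_set_def dominating_set_def)
    then show "nbhd F' x' \<inter> h ` D \<noteq> {}" using nbhd[of x] x by auto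
    obtain y where y: "y \<in> D" "nbhd F y \<inter> (pverts F - D) = {x}"
      using D x(1) unfolding super_dominating_set_def by blast
    have "nbhd F' (h y) \<inter> h ` (pverts F - D) = h ` (nbhd F y \<inter> (pverts F - D))"
      using nbhd[of y] D_sub y(1) inj_on_image_Int[OF inj nbhd_sub[of y], of "pverts F - D"] by auto
    then show "\<exists>y'\<in>h ` D. nbhd F' y' \<inter> h ` (pverts F - D) = {x'}" using y x(2) by auto
  qed
qed

lemma super_dominating_cards_image:
  assumes "inj_on h (pverts F)" "parcs F \<subseteq> pverts F \<times> pverts F"
    and "pverts F' = h ` pverts F" "parcs F' = map_prod h h ` parcs F"
  shows "card ` {D. super_dominating_set F D} \<subseteq> card ` {D. super_dominating_set F' D}"
proof (rule image_subsetI)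
  fix D assume "D \<in> {D. super_dominating_set F D}"
  then have "super_dominating_set F D" by simp
  from super_dominating_set_image[OF assms this]
  show "card D \<in> card ` {D. super_dominating_set F' D}"
    by (intro image_eqI[of _ _ "h ` D"]) simp_all
qed

text \<open>Transport along \<open>h\<close> and along its inverse shows that the sets of
  cardinalities coincide, hence their minima, without any appeal to finiteness.\<close>

lemma super_domination_number_image:
  assumes inj: "inj_on h (pverts F)" and arcs: "parcs F \<subseteq> pverts F \<times> pverts F"
    and F': "pverts F' = h ` pverts F" "parcs F' = map_prod h h ` parcs F"
  shows "super_domination_number F' = super_domination_number F"
proof -
  let ?g = "inv_into (pverts F) h"
  have "card ` {D. super_dominating_set F' D} \<subseteq> card ` {D. super_dominating_set F D}"
  proof (rule super_dominating_cards_image)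
    show "inj_on ?g (pverts F')" unfolding F' by (rule inj_on_inv_into) simp
    show "parcs F' \<subseteq> pverts F' \<times> pverts F'" using arcs by (auto simp: F')
    show "pverts F = ?g ` pverts F'" unfolding F' using inj by (simp add: inv_into_image_cancel)
    have "map_prod ?g ?g (map_prod h h e) = e" if "e \<in> parcs F" for e
      using that arcs inj by (cases e) auto
    then show "parcs F = map_prod ?g ?g ` parcs F'" unfolding F' image_image by simp
  qed
  then show ?thesis
    using super_dominating_cards_image[OF assms]
    unfolding super_domination_number_def by (metis subset_antisym)
qed

subsection \<open>Subdivision graphs with an odd number of subdivision vertices\<close>

text \<open>The trace of a subdivision that survives isomorphism: a bipartition with one side of
  degree 2. On positions in a vertex list it becomes the promise of
  \<open>half_graph\<close>.\<close>

definition edge_side :: "'a pair_pre_digraph \<Rightarrow> 'a set \<Rightarrow> bool" where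
  "edge_side F E0 \<longleftrightarrow> (\<forall>(x, y) \<in> parcs F. y \<in> E0 \<longleftrightarrow> x \<notin> E0) \<and>
     (\<forall>x \<in> E0. card (nbhd F x) = 2)"

fun odd_position :: "'a subdiv_vertex \<Rightarrow> bool" where
  "odd_position (Branch _) \<longleftrightarrow> False"
| "odd_position (Inner _ _ i) \<longleftrightarrow> odd i"

text \<open>Read from the other end, position \<open>i\<close> becomes \<open>k + 1 - i\<close>,
  which has the same parity because \<open>k + 1\<close> is even. For the same reason both branch
  vertices are at even positions.\<close>

lemma odd_position_path:
  assumes "odd k" "i \<le> k + 1"
  shows "odd_position (subdiv_path k u v i) \<longleftrightarrow> odd i"
  using assms by (auto simp: subdiv_path_def)

lemma subdiv_path_inner_eq:
  assumes "subdiv_path k u' v' j = subdiv_path k u v i" "0 < i" "i \<le> k" "j \<le> k + 1"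
    and "u \<noteq> v" "u' \<noteq> v'"
  shows "u' = u \<and> v' = v \<and> j = i \<or> u' = v \<and> v' = u \<and> j = k + 1 - i"
  using assms by (auto simp: subdiv_path_def split: if_splits)

lemma nbhd_subdiv_path:
  fixes G :: "'a::linorder pair_pre_digraph"
  assumes G: "pair_graph G" and uv: "(u, v) \<in> parcs G" and i: "0 < i" "i \<le> k"
  shows "nbhd (k_subdivision k G) (subdiv_path k u v i) =
    {subdiv_path k u v (i - 1), subdiv_path k u v (i + 1)}"
proof -
  interpret pair_graph G by fact
  have ne: "u' \<noteq> v'" if "(u', v') \<in> parcs G" for u' v' using pair_no_loops[OF that] by simp
  have vu: "(v, u) \<in> parcs G" using uv pair_sym_arcs by (auto simp: symmetric_def dest: symD)
  \<comment> \<open>Arcs are given as forward steps along paths, so the predecessor is obtained as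
    the successor on the reversed path.\<close>
  have rev: "subdiv_path k u v (i - 1) = subdiv_path k v u (k + 1 - i + 1)"
    "subdiv_path k u v i = subdiv_path k v u (k + 1 - i)"
    using subdiv_path_rev[OF ne[OF uv], of "i - 1" k] subdiv_path_rev[OF ne[OF uv], of i k] i
    by (simp_all add: Suc_diff_le)
  have arc: "y \<in> nbhd (k_subdivision k G) x \<longleftrightarrow>
      (\<exists>u v j. x = subdiv_path k u v j \<and> y = subdiv_path k u v (j + 1) \<and> (u, v) \<in> parcs G \<and> j \<le> k)"
    for x y by (auto simp: nbhd_def k_subdivision_def)
  show ?thesis
  proof (rule set_eqI, rule iffI)
    fix y assume "y \<in> nbhd (k_subdivision k G) (subdiv_path k u v i)"
    then obtain u' v' j where j: "subdiv_path k u v i = subdiv_path k u' v' j"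
        "y = subdiv_path k u' v' (j + 1)" "(u', v') \<in> parcs G" "j \<le> k"
      unfolding arc by blast
    from subdiv_path_inner_eq[OF j(1)[symmetric] i _ ne[OF uv] ne[OF j(3)]] j(4)
    have "u' = u \<and> v' = v \<and> j = i \<or> u' = v \<and> v' = u \<and> j = k + 1 - i" by simp
    then show "y \<in> {subdiv_path k u v (i - 1), subdiv_path k u v (i + 1)}"
      using j(2) rev(1) by auto
  next
    fix y assume "y \<in> {subdiv_path k u v (i - 1), subdiv_path k u v (i + 1)}"
    then consider "y = subdiv_path k u v (i + 1)" | "y = subdiv_path k v u (k + 1 - i + 1)"
      using rev(1) by auto
    then show "y \<in> nbhd (k_subdivision k G) (subdiv_path k u v i)"
    proof cases
      case 1
      then show ?thesis unfolding arc using uv i by blast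
    next
      case 2
      have "k + 1 - i \<le> k" using i by simp
      then show ?thesis unfolding arc rev(2) using 2 vu by blast
    qed
  qed
qed

lemma edge_side_k_subdivision:
  fixes G :: "'a::linorder pair_pre_digraph"
  assumes G: "pair_graph G" and k: "odd k"
  shows "edge_side (k_subdivision k G) {x \<in> pverts (k_subdivision k G). odd_position x}"
  unfolding edge_side_def
proof (intro conjI ballI)
  let ?S = "k_subdivision k G"
  interpret G: pair_graph G by fact
  interpret S: pair_graph ?S using G by (rule pair_graph_k_subdivision)
  show "case e of (x, y) \<Rightarrow> y \<in> {x \<in> pverts ?S. odd_position x} \<longleftrightarrow>
      x \<notin> {x \<in> pverts ?S. odd_position x}" if "e \<in> parcs ?S" for e
  proof -
    obtain u v i where e: "e = (subdiv_path k u v i, subdiv_path k u v (i + 1))" "i \<le> k"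
      using \<open>e \<in> parcs ?S\<close> by (auto simp: k_subdivision_def)
    show ?thesis using S.arc_fst_in_verts[OF that] S.arc_snd_in_verts[OF that]
      odd_position_path[OF k, of i u v] odd_position_path[OF k, of "i + 1" u v] e by simp
  qed
  fix x assume "x \<in> {x \<in> pverts ?S. odd_position x}"
  then have x: "x \<in> pverts ?S" "odd_position x" by auto
  then obtain u v i where uvi: "x = subdiv_path k u v i" "(u, v) \<in> parcs G" "i \<le> k + 1"
    by (auto simp: k_subdivision_def)
  then have "odd i" using x(2) odd_position_path[OF k] by blast
  then have i: "0 < i" "i \<le> k" using uvi(3) k by (auto simp: le_Suc_eq elim: oddE)
  have "u \<noteq> v" using G.pair_no_loops[OF uvi(2)] by simp
  then have "subdiv_path k u v (i - 1) \<noteq> subdiv_path k u v (i + 1)"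
    using i by (auto simp: subdiv_path_def)
  then show "card (nbhd ?S x) = 2" unfolding uvi(1) nbhd_subdiv_path[OF G uvi(2) i] by simp
qed

text \<open>Tail and head of an arc are its projections on both sides, which forces the arc map to
  be the product of the vertex map with itself.\<close>

lemma digraph_iso_with_projE:
  assumes "digraph_iso (with_proj S) (with_proj F)"
  obtains \<phi> where "inj_on \<phi> (pverts S)" "pverts F = \<phi> ` pverts S"
    "parcs F = map_prod \<phi> \<phi> ` parcs S"
proof -
  obtain f where f: "pre_digraph.digraph_isomorphism (with_proj S) f"
      "with_proj F = app_iso f (with_proj S)"
    using assms by (auto simp: digraph_iso_def)
  have eq: "verts (with_proj F) = iso_verts f ` pverts S" "arcs (with_proj F) = iso_arcs f ` parcs S"
      "tail (with_proj F) = iso_tail f" "head (with_proj F) = iso_head f"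
    unfolding f(2) by simp_all
  have arc: "iso_arcs f e = map_prod (iso_verts f) (iso_verts f) e" if "e \<in> parcs S" for e
  proof -
    have "iso_verts f (fst e) = iso_tail f (iso_arcs f e)" "iso_verts f (snd e) = iso_head f (iso_arcs f e)"
      using f(1) that by (auto simp: pre_digraph.digraph_isomorphism_def)
    then show ?thesis using eq(3,4) by (simp add: prod_eq_iff)
  qed
  show ?thesis
  proof
    show "inj_on (iso_verts f) (pverts S)"
      using f(1) by (simp add: pre_digraph.digraph_isomorphism_def)
    show "pverts F = iso_verts f ` pverts S" using eq(1) by simp
    show "parcs F = map_prod (iso_verts f) (iso_verts f) ` parcs S"
      using eq(2) arc by (simp cong: image_cong)
  qed
qed

lemma edge_side_k_subdivision_graph:
  assumes F: "k_subdivision_graph k F" and k: "odd k"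
  shows "\<exists>E0. edge_side F E0"
proof -
  obtain G :: "nat pair_pre_digraph" where G: "pair_graph G"
      "digraph_iso (with_proj (k_subdivision k G)) (with_proj F)"
    using F by (auto simp: k_subdivision_graph_def)
  let ?S = "k_subdivision k G"
  interpret S: pair_graph ?S using G(1) by (rule pair_graph_k_subdivision)
  obtain \<phi> where \<phi>: "inj_on \<phi> (pverts ?S)" "pverts F = \<phi> ` pverts ?S"
      "parcs F = map_prod \<phi> \<phi> ` parcs ?S"
    using digraph_iso_with_projE[OF G(2)] by blast
  let ?E = "{x \<in> pverts ?S. odd_position x}"
  have E: "edge_side ?S ?E" using G(1) k by (rule edge_side_k_subdivision)
  have arcD: "x \<in> pverts ?S \<and> y \<in> pverts ?S" if "(x, y) \<in> parcs ?S" for x y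
    using S.in_arcsD1[OF that] S.in_arcsD2[OF that] by simp
  have mem: "\<phi> x \<in> \<phi> ` ?E \<longleftrightarrow> x \<in> ?E" if "x \<in> pverts ?S" for x
    using inj_on_image_mem_iff[OF \<phi>(1) that, of ?E] by auto
  have "edge_side F (\<phi> ` ?E)"
    unfolding edge_side_def
  proof (intro conjI ballI)
    fix e assume "e \<in> parcs F"
    then obtain x y where xy: "e = (\<phi> x, \<phi> y)" "(x, y) \<in> parcs ?S" by (auto simp: \<phi>(3))
    then show "case e of (x, y) \<Rightarrow> y \<in> \<phi> ` ?E \<longleftrightarrow> x \<notin> \<phi> ` ?E"
      using E arcD[OF xy(2)] mem[of x] mem[of y] unfolding edge_side_def by auto
  next
    fix x' assume "x' \<in> \<phi> ` ?E"
    then obtain x where x: "x \<in> ?E" "x' = \<phi> x" by blast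
    have "nbhd F (\<phi> x) = \<phi> ` nbhd ?S x"
    proof -
      have "z = x" if "(z, y) \<in> parcs ?S" "\<phi> z = \<phi> x" for z y
        using inj_onD[OF \<phi>(1) that(2)] arcD[OF that(1)] x(1) by simp
      then show ?thesis unfolding nbhd_def \<phi>(3) by force
    qed
    moreover have "inj_on \<phi> (nbhd ?S x)"
      by (rule inj_on_subset[OF \<phi>(1)]) (use arcD in \<open>auto simp: nbhd_def\<close>)
    ultimately have "card (nbhd F x') = card (nbhd ?S x)" using x(2) by (simp add: card_image)
    then show "card (nbhd F x') = 2" using E x(1) by (simp add: edge_side_def)
  qed
  then show ?thesis by blast
qed

theorem theorem5p7:
  fixes k :: nat
  assumes "k > 0" and "k mod 4 = 1"
  shows "poly_time_computable_on {F. k_subdivision_graph k F} super_domination_number"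
proof -
  obtain p where p: "\<forall>n. cost program n = poly p n" using cost_poly by blast
  have "odd k" using assms(2) by presburger
  \<comment> \<open>Program and polynomial are fixed before \<open>F\<close> and \<open>vs\<close>.
    The summand 1 pays for the initial \<open>Read 1\<close>.\<close>
  have "computes_within (Read 1 # ccom 1 program) (graph_code F vs) (super_domination_number F)
      (poly (p + 1) (card (pverts F)))"
    if F: "k_subdivision_graph k F" and vs: "distinct vs" "set vs = pverts F"
    for F :: "nat pair_pre_digraph" and vs
  proof -
    define n where "n = length vs"
    define adj where "adj i j \<longleftrightarrow> i < n \<and> j < n \<and> (vs ! i, vs ! j) \<in> parcs F" for i j
    interpret F: pair_graph F using F by (simp add: k_subdivision_graph_def)
    obtain E0 where E0: "edge_side F E0"
      using edge_side_k_subdivision_graph[OF F \<open>odd k\<close>] by blast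
    have bij: "bij_betw (nth vs) {..<n} (pverts F)"
      using bij_betw_nth[OF vs(1)] vs(2) by (simp add: n_def)
    have inj: "inj_on (nth vs) {..<n}" and img: "nth vs ` {..<n} = pverts F"
      using bij by (simp_all add: bij_betw_def)
    interpret half_graph n adj "{i. vs ! i \<in> E0}"
    proof
      show "adj v u" if "adj u v" for u v
        using that F.pair_sym_arcs by (auto simp: adj_def symmetric_def dest: symD)
      show "v \<in> {i. vs ! i \<in> E0} \<longleftrightarrow> u \<notin> {i. vs ! i \<in> E0}" if "adj u v" for u v
        using that E0 by (auto simp: adj_def edge_side_def)
      fix u assume u: "u < n" "u \<in> {i. vs ! i \<in> E0}"
      have "nth vs ` {v. v < n \<and> adj u v} = nbhd F (vs ! u)"
      proof -
        have "x \<in> nth vs ` {..<n}" if "(vs ! u, x) \<in> parcs F" for x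
          using F.in_arcsD2[OF that] img by simp
        then show ?thesis using u(1) by (auto simp: adj_def nbhd_def image_iff)
      qed
      moreover have "inj_on (nth vs) {v. v < n \<and> adj u v}"
        by (rule inj_on_subset[OF inj]) auto
      ultimately have "card {v. v < n \<and> adj u v} = card (nbhd F (vs ! u))"
        by (metis card_image)
      then show "card {v. v < n \<and> adj u v} = 2" using E0 u(2) by (simp add: edge_side_def)
    qed
    have "super_domination_number F = super_domination_number (index_graph n adj)"
    proof (rule super_domination_number_image)
      show "parcs F = map_prod ((!) vs) ((!) vs) ` parcs (index_graph n adj)"
      proof
        show "parcs F \<subseteq> map_prod ((!) vs) ((!) vs) ` parcs (index_graph n adj)"
        proof
          fix e assume e: "e \<in> parcs F"
          obtain i j where "i < n" "j < n" "e = (vs ! i, vs ! j)"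
            using F.arc_fst_in_verts[OF e] F.arc_snd_in_verts[OF e] img[symmetric]
            by (cases e) auto
          then show "e \<in> map_prod ((!) vs) ((!) vs) ` parcs (index_graph n adj)"
            using e by (intro image_eqI[of _ _ "(i, j)"]) (auto simp: index_graph_def adj_def)
        qed
      qed (auto simp: index_graph_def adj_def)
    qed (use inj img in \<open>auto simp: index_graph_def\<close>)
    moreover have "graph_code F vs = n # rows 0"
    proof -
      have nth: "map g vs = map (\<lambda>i. g (vs ! i)) [0..<n]" for g :: "nat \<Rightarrow> 'z"
        by (rule nth_equalityI) (simp_all add: n_def)
      have "map (\<lambda>v. if (vs ! i, v) \<in> parcs F then 1 else 0) vs = row i" if "i < n" for i
        unfolding nth row_def using that by (auto simp: adj_def)
      then have "map (\<lambda>u. map (\<lambda>v. if (u, v) \<in> parcs F then 1 else 0) vs) vs = map row [0..<n]"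
        unfolding nth[of "\<lambda>u. map (\<lambda>v. if (u, v) \<in> parcs F then 1 else 0) vs"] by simp
      then show ?thesis by (simp add: graph_code_def rows_def n_def[symmetric])
    qed
    moreover have "n = card (pverts F)" using vs distinct_card by (metis n_def)
    ultimately show ?thesis
      using computes_within_ccom[OF wf_program, of n "rows 0"] program_correct p by simp
  qed
  then show ?thesis unfolding poly_time_computable_on_def
    by (intro exI[of _ "Read 1 # ccom 1 program"] exI[of _ "p + 1"]) auto
qed

end
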